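(* Let $g\ge1$, let $\mathbf C=(\mathbf c_1,\dots,\mathbf c_g)$ be an ordered collection of distinct real points, and let $A\in\mathrm{GMP}(\mathbf C)$ be a periodic GMP matrix with generating coefficients $\vec p$ and $\vec q$. Let $\Delta^A$ be its discriminant. Then $A$ has purely absolutely continuous spectrum, which is given by $$\sigma(A)=\sigma_{ac}(A)=\{z\in\mathbb C:\ \Delta^A(z)\in[-2,2]\}.$$
   Context: **GMP matrices.** $S$ is the right shift on $\ell^2(\mathbb Z)$, $Se_n=e_{n+1}$. Vectors in $\mathbb R^{g+1}$ are indexed by $0,\dots,g$; $\delta_g$ is the last standard basis vector. For a matrix $T$, $T^-$ is its upper triangular part excluding the main diagonal and $T^+=T-T^-$. For an ordered collection $\mathbf C=(\mathbf c_1,\dots,\mathbf c_g)$ of distinct real points, a bounded operator $A$ on $\ell^2(\mathbb Z)$ is of the class $\mathbb A$ (with respect to $\mathbf C$) if it is a $(g+1)$-block Jacobi matrix (block number $j$ consists of the indices $(g+1)j,\dots,(g+1)j+g$) whose $j$-th block row has the entries $A(\vec p_j)^*$, $B(\vec p_j,\vec q_j)$, $A(\vec p_{j+1})$ in block columns $j-1,j,j+1$ and zeros elsewhere, where $\vec p_j,\vec q_j\in\mathbb R^{g+1}$, the last entry of each $\vec p_j$ is positive, and $$A(\vec p)=\delta_g\vec p^{\,*},\qquad B(\vec p,\vec q)=(\vec q\,\vec p^{\,*})^-+(\vec p\,\vec q^{\,*})^++\operatorname{diag}(\mathbf c_1,\dots,\mathbf c_g,0).$$ The $(\vec p_j,\vec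 q_j)$ are the generating coefficients. $A\in\mathrm{GMP}(\mathbf C)$ if $A$ is of the class $\mathbb A$ with respect to $\mathbf C$, all $\mathbf c_k-A$ ($1\le k\le g$) are invertible, and for each $1\le k\le g$ the operator $S^{-k}(\mathbf c_k-A)^{-1}S^k$ is also of the class $\mathbb A$, with respect to the collection $\big(\tfrac1{\mathbf c_k-\mathbf c_{k+1}},\dots,\tfrac1{\mathbf c_k-\mathbf c_g},0,\tfrac1{\mathbf c_k-\mathbf c_1},\dots,\tfrac1{\mathbf c_k-\mathbf c_{k-1}}\big)$. A GMP matrix is periodic if $(\vec p_j,\vec q_j)=(\vec p,\vec q)$ for all $j\in\mathbb Z$; then write $\vec p=(p_0,\dots,p_g)$, $\vec q=(q_0,\dots,q_g)$. **Transfer matrix and discriminant.** Put $\mathfrak j=\begin{bmatrix}0&-1\\ 1&0\end{bmatrix}$, $$\mathfrak a(z;p,q)=\begin{bmatrix}0&-p\\ \frac1p&\frac{z-pq}{p}\end{bmatrix},\qquad \mathfrak a(z,\mathbf c;p,q)=I-\frac1{\mathbf c-z}\begin{bmatrix}p\\ q\end{bmatrix}\begin{bmatrix}p&q\end{bmatrix}\mathfrak j.$$ The transfer matrix of a periodic GMP matrix $A$ with generating coefficients $\vec p,\vec q$ is $$\mathfrak A(z)=\mathfrak a(z,\mathbf c_1;p_0,q_0)\,\mathfrak a(z,\mathbf c_2;p_1,q_1)\cdots\mathfrak a(z,\mathbf c_g;p_{g-1},q_{g-1})\,\mathfrak a(z;p_g,q_g),$$ and its discriminant is $\Delta^A(z)=\operatorname{tr}\mathfrak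 A(z)$. *)

theory Defs
  imports "HOL-Analysis.Analysis"
begin

lemma sq_summable_add:
  fixes f g :: "int \<Rightarrow> complex"
  assumes "(\<lambda>n. (cmod (f n))\<^sup>2) summable_on UNIV" "(\<lambda>n. (cmod (g n))\<^sup>2) summable_on UNIV"
  shows "(\<lambda>n. (cmod (f n + g n))\<^sup>2) summable_on UNIV"
proof (rule summable_on_comparison_test)
  show "(\<lambda>n. 2 * (cmod (f n))\<^sup>2 + 2 * (cmod (g n))\<^sup>2) summable_on UNIV"
    using assms by (intro summable_on_add summable_on_cmult_right)
  fix n
  have "(cmod (f n + g n))\<^sup>2 \<le> (cmod (f n) + cmod (g n))\<^sup>2"
    by (intro power_mono norm_triangle_ineq) auto
  also have "\<dots> \<le> 2 * (cmod (f n))\<^sup>2 + 2 * (cmod (g n))\<^sup>2"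
    using zero_le_power2[of "cmod (f n) - cmod (g n)"]
    by (simp add: power2_sum power2_diff)
  finally show "(cmod (f n + g n))\<^sup>2 \<le> 2 * (cmod (f n))\<^sup>2 + 2 * (cmod (g n))\<^sup>2" .
qed simp

lemma sq_summable_scale:
  fixes f :: "int \<Rightarrow> complex"
  assumes "(\<lambda>n. (cmod (f n))\<^sup>2) summable_on UNIV"
  shows "(\<lambda>n. (cmod (c * f n))\<^sup>2) summable_on UNIV"
  using summable_on_cmult_right[OF assms, of "(cmod c)\<^sup>2"]
  by (simp add: norm_mult power_mult_distrib)

lemma sq_summable_prod:
  fixes f g :: "int \<Rightarrow> complex"
  assumes "(\<lambda>n. (cmod (f n))\<^sup>2) summable_on UNIV" "(\<lambda>n. (cmod (g n))\<^sup>2) summable_on UNIV"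
  shows "(\<lambda>n. cnj (f n) * g n) summable_on UNIV"
proof -
  have sum: "(\<lambda>n. (cmod (f n))\<^sup>2 + (cmod (g n))\<^sup>2) summable_on UNIV"
    using assms by (rule summable_on_add)
  have "cmod (cnj (f n) * g n) \<le> (cmod (f n))\<^sup>2 + (cmod (g n))\<^sup>2" for n
  proof -
    have "2 * (cmod (f n) * cmod (g n)) \<le> (cmod (f n))\<^sup>2 + (cmod (g n))\<^sup>2"
      using zero_le_power2[of "cmod (f n) - cmod (g n)"] by (simp add: power2_diff)
    moreover have "0 \<le> cmod (f n) * cmod (g n)" by simp
    ultimately have "cmod (f n) * cmod (g n) \<le> (cmod (f n))\<^sup>2 + (cmod (g n))\<^sup>2" by linarith
    then show ?thesis by (simp add: norm_mult)
  qed
  then show ?thesis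
    by (rule abs_summable_summable[OF summable_on_comparison_test[OF sum]]) auto
qed

typedef ell2 = "{f :: int \<Rightarrow> complex. (\<lambda>n. (cmod (f n))\<^sup>2) summable_on UNIV}"
  morphisms coord Abs_ell2
  by (rule exI[of _ "\<lambda>_. 0"]) simp

setup_lifting type_definition_ell2

lemma coord_sq_summable: "(\<lambda>n. (cmod (coord f n))\<^sup>2) summable_on UNIV"
  using coord by auto

lift_definition scaleC_ell2 :: "complex \<Rightarrow> ell2 \<Rightarrow> ell2" (infixr "*\<^sub>C" 75)
  is "\<lambda>c f n. c * f n"
  by (rule sq_summable_scale)

lift_definition basis_ell2 :: "int \<Rightarrow> ell2" is "\<lambda>k n. if n = k then 1 else 0"
proof -
  fix k :: int
  let ?h = "\<lambda>n. (cmod (if n = k then 1 else 0))\<^sup>2"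
  have "?h summable_on {k}" by (rule summable_on_finite) simp
  moreover have "?h summable_on {k} \<longleftrightarrow> ?h summable_on UNIV"
    by (rule summable_on_cong_neutral) auto
  ultimately show "?h summable_on UNIV" by simp
qed

text \<open>Antilinear in the first argument.\<close>
lift_definition cinner :: "ell2 \<Rightarrow> ell2 \<Rightarrow> complex"
  is "\<lambda>f g. \<Sum>\<^sub>\<infinity>n. cnj (f n) * g n" .

instantiation ell2 :: real_vector
begin

lift_definition zero_ell2 :: ell2 is "\<lambda>_. 0" by simp
lift_definition plus_ell2 :: "ell2 \<Rightarrow> ell2 \<Rightarrow> ell2" is "\<lambda>f g n. f n + g n"
  by (rule sq_summable_add)
lift_definition uminus_ell2 :: "ell2 \<Rightarrow> ell2" is "\<lambda>f n. - f n" by simp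
lift_definition minus_ell2 :: "ell2 \<Rightarrow> ell2 \<Rightarrow> ell2" is "\<lambda>f g n. f n - g n"
proof -
  fix f g :: "int \<Rightarrow> complex"
  assume "(\<lambda>n. (cmod (f n))\<^sup>2) summable_on UNIV" "(\<lambda>n. (cmod (g n))\<^sup>2) summable_on UNIV"
  then show "(\<lambda>n. (cmod (f n - g n))\<^sup>2) summable_on UNIV"
    using sq_summable_add[of f "\<lambda>n. - g n"] by simp
qed
definition scaleR_ell2 :: "real \<Rightarrow> ell2 \<Rightarrow> ell2" where
  "scaleR_ell2 r f = complex_of_real r *\<^sub>C f"

instance
proof
  fix x y z :: ell2 and r s :: real
  show "x + y + z = x + (y + z)" by transfer (simp add: add.assoc)
  show "x + y = y + x" by transfer (simp add: add.commute)
  show "0 + x = x" by transfer simp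
  show "- x + x = 0" by transfer simp
  show "x - y = x + - y" by transfer simp
  show "r *\<^sub>R (x + y) = r *\<^sub>R x + r *\<^sub>R y"
    unfolding scaleR_ell2_def by transfer (simp add: algebra_simps)
  show "(r + s) *\<^sub>R x = r *\<^sub>R x + s *\<^sub>R x"
    unfolding scaleR_ell2_def by transfer (simp add: algebra_simps)
  show "r *\<^sub>R s *\<^sub>R x = (r * s) *\<^sub>R x"
    unfolding scaleR_ell2_def by transfer (simp add: mult.assoc)
  show "1 *\<^sub>R x = x"
    unfolding scaleR_ell2_def by transfer simp
qed

end

instantiation ell2 :: real_inner
begin

definition inner_ell2 :: "ell2 \<Rightarrow> ell2 \<Rightarrow> real" where
  "inner_ell2 f g = Re (cinner f g)"
definition norm_ell2 :: "ell2 \<Rightarrow> real" where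
  "norm_ell2 f = sqrt (\<Sum>\<^sub>\<infinity>n. (cmod (coord f n))\<^sup>2)"
definition dist_ell2 :: "ell2 \<Rightarrow> ell2 \<Rightarrow> real" where
  "dist_ell2 f g = norm (f - g)"
definition sgn_ell2 :: "ell2 \<Rightarrow> ell2" where
  "sgn_ell2 f = f /\<^sub>R norm f"
definition uniformity_ell2 :: "(ell2 \<times> ell2) filter" where
  "uniformity_ell2 = (INF e\<in>{0<..}. principal {(x, y). dist x y < e})"
definition open_ell2 :: "ell2 set \<Rightarrow> bool" where
  "open_ell2 U = (\<forall>x\<in>U. eventually (\<lambda>(x', y). x' = x \<longrightarrow> y \<in> U) uniformity)"

instance
proof
  fix x y z :: ell2 and r :: real and U :: "ell2 set"
  show "dist x y = norm (x - y)" by (rule dist_ell2_def)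
  show "sgn x = x /\<^sub>R norm x" by (rule sgn_ell2_def)
  show "(uniformity :: (ell2 \<times> ell2) filter) = (INF e\<in>{0<..}. principal {(x, y). dist x y < e})"
    by (rule uniformity_ell2_def)
  show "open U = (\<forall>x\<in>U. eventually (\<lambda>(x', y). x' = x \<longrightarrow> y \<in> U) uniformity)"
    by (rule open_ell2_def)
  have comm: "cinner y x = cnj (cinner x y)"
    by transfer (simp add: mult.commute flip: infsum_cnj)
  show "inner x y = inner y x" unfolding inner_ell2_def comm by simp
  have "cinner (x + y) z = cinner x z + cinner y z"
    by transfer (simp add: distrib_right infsum_add sq_summable_prod)
  then show "inner (x + y) z = inner x z + inner y z"
    unfolding inner_ell2_def by simp
  have "cinner (complex_of_real r *\<^sub>C x) y = complex_of_real r * cinner x y"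
    by transfer (simp add: mult.assoc flip: infsum_cmult_right')
  then show "inner (r *\<^sub>R x) y = r * inner x y"
    unfolding inner_ell2_def scaleR_ell2_def by simp
  have sq: "inner x x = (\<Sum>\<^sub>\<infinity>n. (cmod (coord x n))\<^sup>2)" for x :: ell2
  proof -
    have "inner x x = (\<Sum>\<^sub>\<infinity>n. Re (cnj (coord x n) * coord x n))"
      unfolding inner_ell2_def cinner.rep_eq
      by (rule infsum_Re[symmetric]) (intro sq_summable_prod coord_sq_summable)
    moreover have "Re (cnj (coord x n) * coord x n) = (cmod (coord x n))\<^sup>2" for n
      unfolding cmod_power2 by (simp add: power2_eq_square)
    ultimately show ?thesis by simp
  qed
  show "0 \<le> inner x x" unfolding sq by (rule infsum_nonneg) simp
  show "norm x = sqrt (inner x x)" unfolding sq by (rule norm_ell2_def)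
  show "inner x x = 0 \<longleftrightarrow> x = 0"
  proof
    assume "inner x x = 0"
    then have "(cmod (coord x n))\<^sup>2 = 0" for n
      unfolding sq
      by (intro nonneg_infsum_le_0D[where f = "\<lambda>n. (cmod (coord x n))\<^sup>2" and A = UNIV]
            coord_sq_summable) auto
    then have "coord x = (\<lambda>_. 0)" by auto
    then show "x = 0" by (simp add: zero_ell2.rep_eq flip: coord_inject)
  next
    assume "x = 0"
    then show "inner x x = 0" unfolding sq by (simp add: zero_ell2.rep_eq)
  qed
qed

end

definition bounded_operator :: "(ell2 \<Rightarrow> ell2) \<Rightarrow> bool" where
  "bounded_operator T \<longleftrightarrow> bounded_linear T \<and> (\<forall>c f. T (c *\<^sub>C f) = c *\<^sub>C T f)"

text \<open>For linear \<open>T\<close> leaving the subspace \<open>V\<close> invariant, this says that the restriction of \<open>T\<close> to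
  \<open>V\<close> has a bounded inverse.\<close>
definition invertible_on :: "ell2 set \<Rightarrow> (ell2 \<Rightarrow> ell2) \<Rightarrow> bool" where
  "invertible_on V T \<longleftrightarrow> bij_betw T V V \<and> (\<exists>K. \<forall>f\<in>V. norm f \<le> K * norm (T f))"

text \<open>The spectrum of the restriction of \<open>T\<close> to an invariant subspace \<open>V\<close>.\<close>
definition spectrum_on :: "ell2 set \<Rightarrow> (ell2 \<Rightarrow> ell2) \<Rightarrow> complex set" where
  "spectrum_on V T = {z. \<not> invertible_on V (\<lambda>f. z *\<^sub>C f - T f)}"

definition spectrum :: "(ell2 \<Rightarrow> ell2) \<Rightarrow> complex set" where
  "spectrum T = spectrum_on UNIV T"

text \<open>For self-adjoint \<open>T\<close>, the spectral measure of the vector \<open>f\<close> is the unique finite Borel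
  measure \<open>\<mu>\<close> on the real line with
  \<open>\<langle>f, (T - z)\<^sup>-\<^sup>1 f\<rangle> = \<integral> d\<mu>(t) / (t - z)\<close> for all nonreal \<open>z\<close>.\<close>
definition is_spectral_measure :: "(ell2 \<Rightarrow> ell2) \<Rightarrow> ell2 \<Rightarrow> real measure \<Rightarrow> bool" where
  "is_spectral_measure T f \<mu> \<longleftrightarrow> sets \<mu> = sets borel \<and> finite_measure \<mu> \<and>
     (\<forall>z. Im z \<noteq> 0 \<longrightarrow>
        cinner f (inv (\<lambda>h. T h - z *\<^sub>C h) f) = (\<integral>t. 1 / (complex_of_real t - z) \<partial>\<mu>))"

text \<open>Since the spectral measure of a vector is unique, the existential quantifier names it.\<close>
definition ac_subspace :: "(ell2 \<Rightarrow> ell2) \<Rightarrow> ell2 set" where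
  "ac_subspace T = {f. \<exists>\<mu>. is_spectral_measure T f \<mu> \<and> absolutely_continuous lborel \<mu>}"

definition ac_spectrum :: "(ell2 \<Rightarrow> ell2) \<Rightarrow> complex set" where
  "ac_spectrum T = spectrum_on (ac_subspace T) T"

definition purely_ac_spectrum :: "(ell2 \<Rightarrow> ell2) \<Rightarrow> bool" where
  "purely_ac_spectrum T \<longleftrightarrow> ac_subspace T = UNIV"

lift_definition shift :: "ell2 \<Rightarrow> ell2" is "\<lambda>f n. f (n - 1)"
proof -
  fix f :: "int \<Rightarrow> complex"
  assume "(\<lambda>n. (cmod (f n))\<^sup>2) summable_on UNIV"
  moreover have "bij_betw (\<lambda>n::int. n - 1) UNIV UNIV"
    by (rule bij_betw_byWitness[of _ "\<lambda>n. n + 1"]) auto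
  ultimately show "(\<lambda>n. (cmod (f (n - 1)))\<^sup>2) summable_on UNIV"
    by (subst summable_on_reindex_bij_betw[where f = "\<lambda>n. (cmod (f n))\<^sup>2"])
qed

lemma shift_basis: "shift (basis_ell2 n) = basis_ell2 (n + 1)"
  by transfer (auto simp: fun_eq_iff)

lemma bij_shift: "bij shift"
proof (rule bijI)
  show "inj shift"
  proof (rule injI)
    fix f g assume "shift f = shift g"
    then have "coord (shift f) (n + 1) = coord (shift g) (n + 1)" for n
      by simp
    then show "f = g" by (simp add: shift.rep_eq fun_eq_iff flip: coord_inject)
  qed
  show "surj shift"
  proof (rule surjI)
    fix f
    have "bij_betw (\<lambda>n::int. n + 1) UNIV UNIV"
      by (rule bij_betw_byWitness[of _ "\<lambda>n. n - 1"]) auto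
    then have "(\<lambda>n. (cmod (coord f (n + 1)))\<^sup>2) summable_on UNIV"
      using coord_sq_summable[of f]
      by (subst summable_on_reindex_bij_betw[where f = "\<lambda>n. (cmod (coord f n))\<^sup>2"])
    then show "shift (Abs_ell2 (\<lambda>n. coord f (n + 1))) = f"
      by (simp add: shift.rep_eq Abs_ell2_inverse flip: coord_inject)
  qed
qed

text \<open>A collection \<open>(c\<^sub>1, \<dots>, c\<^sub>g)\<close> is a list \<open>C\<close> of length \<open>g\<close>, so \<open>c\<^sub>k\<close> is \<open>C ! (k - 1)\<close>.
  Vectors and matrices of size \<open>g + 1\<close> are functions of indices of which only the values
  \<open>0, \<dots>, g\<close> are ever used.\<close>

definition outer :: "(nat \<Rightarrow> real) \<Rightarrow> (nat \<Rightarrow> real) \<Rightarrow> nat \<Rightarrow> nat \<Rightarrow> real" where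
  "outer u v = (\<lambda>i l. u i * v l)"

definition upper :: "(nat \<Rightarrow> nat \<Rightarrow> real) \<Rightarrow> nat \<Rightarrow> nat \<Rightarrow> real" where
  "upper T = (\<lambda>i l. if i < l then T i l else 0)"

definition lower :: "(nat \<Rightarrow> nat \<Rightarrow> real) \<Rightarrow> nat \<Rightarrow> nat \<Rightarrow> real" where
  "lower T = (\<lambda>i l. T i l - upper T i l)"

definition blockA :: "nat \<Rightarrow> (nat \<Rightarrow> real) \<Rightarrow> nat \<Rightarrow> nat \<Rightarrow> real" where
  "blockA g p = outer (\<lambda>i. if i = g then 1 else 0) p"

definition blockB :: "real list \<Rightarrow> (nat \<Rightarrow> real) \<Rightarrow> (nat \<Rightarrow> real) \<Rightarrow> nat \<Rightarrow> nat \<Rightarrow> real" where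
  "blockB C p q = (\<lambda>i l. upper (outer q p) i l + lower (outer p q) i l +
     (if i = l then (C @ [0]) ! i else 0))"

text \<open>Entry \<open>(i, l)\<close> of the block in block row \<open>j\<close> and block column \<open>j'\<close>. Swapping the indices of
  \<open>blockA\<close> gives the adjoint \<open>A(p\<^sub>j)\<^sup>*\<close>.\<close>
definition block_entry ::
    "real list \<Rightarrow> (int \<Rightarrow> nat \<Rightarrow> real) \<Rightarrow> (int \<Rightarrow> nat \<Rightarrow> real) \<Rightarrow> int \<Rightarrow> nat \<Rightarrow> int \<Rightarrow> nat \<Rightarrow> real" where
  "block_entry C P Q j i j' l =
     (if j' = j - 1 then blockA (length C) (P j) l i
      else if j' = j then blockB C (P j) (Q j) i l
      else if j' = j + 1 then blockA (length C) (P (j + 1)) i l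
      else 0)"

text \<open>The component with index \<open>(g + 1) j + i\<close> is entry \<open>i\<close> of block \<open>j\<close>.\<close>
definition generating_coeffs ::
    "real list \<Rightarrow> (ell2 \<Rightarrow> ell2) \<Rightarrow> (int \<Rightarrow> nat \<Rightarrow> real) \<Rightarrow> (int \<Rightarrow> nat \<Rightarrow> real) \<Rightarrow> bool" where
  "generating_coeffs C T P Q \<longleftrightarrow> (let g = length C; s = int (g + 1) in
     (\<forall>j. 0 < P j g) \<and>
     (\<forall>j j' i l. i \<le> g \<longrightarrow> l \<le> g \<longrightarrow>
        coord (T (basis_ell2 (s * j' + int l))) (s * j + int i)
          = complex_of_real (block_entry C P Q j i j' l)))"

definition class_A :: "real list \<Rightarrow> (ell2 \<Rightarrow> ell2) \<Rightarrow> bool" where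
  "class_A C T \<longleftrightarrow> bounded_operator T \<and> (\<exists>P Q. generating_coeffs C T P Q)"

definition dual_collection :: "real list \<Rightarrow> nat \<Rightarrow> real list" where
  "dual_collection C k = (let r = (\<lambda>x. 1 / (C ! (k - 1) - x)) in
     map r (drop k C) @ [0] @ map r (take (k - 1) C))"

definition GMP :: "real list \<Rightarrow> (ell2 \<Rightarrow> ell2) \<Rightarrow> bool" where
  "GMP C T \<longleftrightarrow> class_A C T \<and>
     (\<forall>k\<in>{1..length C}. let R = (\<lambda>f. complex_of_real (C ! (k - 1)) *\<^sub>C f - T f) in
        invertible_on UNIV R \<and>
        class_A (dual_collection C k) ((inv shift ^^ k) \<circ> inv R \<circ> (shift ^^ k)))"

definition symp :: "complex^2^2" where
  "symp = vector [vector [0, -1], vector [1, 0]]"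

definition transfer_last :: "complex \<Rightarrow> real \<Rightarrow> real \<Rightarrow> complex^2^2" where
  "transfer_last z p q =
     vector [vector [0, - of_real p],
             vector [1 / of_real p, (z - of_real p * of_real q) / of_real p]]"

text \<open>Defined for \<open>z \<noteq> c\<close> only: at \<open>z = c\<close> the division by zero makes the value meaningless,
  so the discriminant may only be evaluated outside of the collection \<open>C\<close>.\<close>
definition transfer_factor :: "complex \<Rightarrow> real \<Rightarrow> real \<Rightarrow> real \<Rightarrow> complex^2^2" where
  "transfer_factor z c p q = (let v = vector [of_real p, of_real q] in
     mat 1 - mat (1 / (of_real c - z)) ** ((columnvector v :: complex^1^2) ** rowvector v ** symp))"

definition transfer_matrix ::
    "real list \<Rightarrow> (nat \<Rightarrow> real) \<Rightarrow> (nat \<Rightarrow> real) \<Rightarrow> complex \<Rightarrow> complex^2^2" where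
  "transfer_matrix C p q z =
     foldr (\<lambda>k M. transfer_factor z (C ! k) (p k) (q k) ** M) [0..<length C]
       (transfer_last z (p (length C)) (q (length C)))"

definition discriminant ::
    "real list \<Rightarrow> (nat \<Rightarrow> real) \<Rightarrow> (nat \<Rightarrow> real) \<Rightarrow> complex \<Rightarrow> complex" where
  "discriminant C p q z = trace (transfer_matrix C p q z)"

end

theory Submission
  imports Defs "HOL-Probability.Probability"
begin

text \<open>
  Let \<open>W\<close> be the shift by one block and \<open>J = W + W\<^sup>-\<^sup>1\<close>. The three-term structure of a periodic GMP
  matrix, read as a recursion for the basis vectors over the commutative algebra generated by \<open>A\<close> and
  \<open>W\<close>, says that \<open>v = \<AA>(A) W v\<close> for a pair \<open>v\<close> of vectors; since \<open>\<AA>\<close> has determinant 1, this gives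
  the magic formula \<open>\<Delta>(A) = J\<close>. Hence the image under \<open>\<Delta>\<close> of the spectral measure of a basis vector
  with respect to \<open>A\<close> is its spectral measure with respect to \<open>J\<close>, which is the arcsine law. As \<open>\<Delta>\<close>
  maps null sets to null sets, the spectral measures of the basis vectors are absolutely continuous, and
  the vectors with this property form a closed subspace by the parallelogram law.

  For the spectrum, \<open>\<Delta>(z) - J\<close> is a multiple of \<open>z - A\<close>, so that \<open>\<Delta>(z) \<notin> [-2, 2]\<close> puts \<open>z\<close> into
  the resolvent set, whereas \<open>\<Delta>(z) \<in> [-2, 2]\<close> yields a bounded Bloch solution of \<open>A u = z u\<close>, whose
  truncations are approximate eigenvectors.

  The spectral measures are constructed from their moments \<open>\<langle>f, A\<^sup>k f\<rangle>\<close>, through a solution of the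
  Hausdorff moment problem by Bernstein polynomials.
\<close>

section \<open>Measures determined by their moments\<close>

text \<open>The discriminant Delta is rational with poles at the points of \<open>C\<close>, whereas
  only polynomials are evaluated at \<open>A\<close>. It is therefore kept as a quotient
  \<open>N / E\<close>, and the magic formula takes the form N(A) = E(A) J. Inverses never occur in
  it: as every c - A with c in \<open>C\<close> is invertible, E(A) is bijective and bounded below.
  It can be cancelled from identities and estimates, and every vector can be written as E(A)^n h.

  The moments <f, A^k f> are real, so measures are treated in the real inner product space with the
  form \<open>Re cinner\<close>. The complex structure enters through multiplication by i, an
  isometry that commutes with A.

  For sums of vectors the cross terms <f, A^k g> would lead to signed or complex measures. The
  parallelogram law contains plus signs only and can be read as an identity between positive
  measures. Uniqueness of a measure with given moments is drawn from the geometric growth of the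
  even moments, which the operator norm controls.\<close>

definition represents :: "real measure \<Rightarrow> (real poly \<Rightarrow> real) \<Rightarrow> bool" where
  "represents \<mu> L \<longleftrightarrow> sets \<mu> = sets borel \<and> (\<forall>p. has_bochner_integral \<mu> (poly p) (L p))"

lemma represents_sets: "represents \<mu> L \<Longrightarrow> sets \<mu> = sets borel"
  and represents_integral: "represents \<mu> L \<Longrightarrow> has_bochner_integral \<mu> (poly p) (L p)"
  by (auto simp: represents_def)

lemma represents_has_integral:
  assumes "represents \<mu> L" "\<And>x. poly p x = f x"
  shows "has_bochner_integral \<mu> f (L p)"
  using represents_integral[OF assms(1), of p] assms(2) by (simp cong: has_bochner_integral_cong)

lemma represents_finite_measure:
  assumes "represents \<mu> L"
  shows "finite_measure \<mu>"
proof
  have "integrable \<mu> (\<lambda>_. 1 :: real)"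
    using represents_has_integral[OF assms, of 1] by (simp add: has_bochner_integral_iff)
  then show "emeasure \<mu> (space \<mu>) \<noteq> \<infinity>"
    by (simp add: integrable_iff_bounded)
qed

lemma represents_measure_space:
  assumes "represents \<mu> L"
  shows "measure \<mu> (space \<mu>) = L 1"
  using represents_has_integral[OF assms, of 1 "\<lambda>_. 1"] by (simp add: has_bochner_integral_iff)

lemma borel_measurable_poly [measurable]: "poly (p :: real poly) \<in> borel_measurable borel"
  by (intro borel_measurable_continuous_onI continuous_on_poly continuous_on_id)

lemma represents_density:
  assumes "represents \<mu> L" "\<And>t. poly Q t \<ge> 0"
  shows "represents (density \<mu> (poly Q)) (\<lambda>p. L (Q * p))"
  unfolding represents_def
proof (intro conjI allI)
  note [measurable_cong] = represents_sets[OF assms(1)]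
  show "sets (density \<mu> (\<lambda>t. ennreal (poly Q t))) = sets borel"
    by (simp add: represents_sets[OF assms(1)])
  show "has_bochner_integral (density \<mu> (\<lambda>t. ennreal (poly Q t))) (poly p) (L (Q * p))" for p
    by (intro has_bochner_integral_density represents_has_integral[OF assms(1)]) (auto simp: assms(2))
qed

lemma represents_density_const:
  assumes "represents \<mu> L" "0 \<le> c"
  shows "represents (density \<mu> (\<lambda>_. ennreal c)) (\<lambda>p. c * L p)"
  unfolding represents_def
proof (intro conjI allI)
  note [measurable_cong] = represents_sets[OF assms(1)]
  show "sets (density \<mu> (\<lambda>t. ennreal c)) = sets borel"
    by (simp add: represents_sets[OF assms(1)])
  show "has_bochner_integral (density \<mu> (\<lambda>t. ennreal c)) (poly p) (c * L p)" for p
    using represents_integral[OF assms(1), of p] assms(2)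
    by (intro has_bochner_integral_density) auto
qed

lemma represents_distr:
  assumes "represents \<mu> L" and [measurable]: "h \<in> borel_measurable borel"
    and "\<And>p. has_bochner_integral \<mu> (\<lambda>t. poly p (h t)) (L' p)"
  shows "represents (distr \<mu> borel h) L'"
  unfolding represents_def
proof (intro conjI allI)
  note [measurable_cong] = represents_sets[OF assms(1)]
  show "has_bochner_integral (distr \<mu> borel h) (poly p) (L' p)" for p
    by (intro has_bochner_integral_distr assms) auto
qed simp

lemma represents_real_distribution:
  assumes "represents \<mu> L" "L 1 = 1"
  shows "real_distribution \<mu>"
proof -
  interpret finite_measure \<mu> by (rule represents_finite_measure[OF assms(1)])
  show ?thesis
    using represents_measure_space[OF assms(1)] represents_sets[OF assms(1)] assms(2)
    by (intro real_distribution.intro prob_spaceI real_distribution_axioms.intro)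
       (auto simp: emeasure_eq_measure)
qed

text \<open>The moments fix the Taylor polynomials of the characteristic function. Their error at
  degree 2n is at most 2|t|^(2n)/(2n)! times the absolute moment of order 2n. At even order this is
  an ordinary moment, bounded by c M^(2n), and the factorial wins.\<close>

lemma represents_unique_prob:
  assumes \<mu>: "represents \<mu> L" and \<nu>: "represents \<nu> L" and "L 1 = 1"
    and bound: "\<And>k. L (monom 1 (2 * k)) \<le> c * M ^ (2 * k)"
  shows "\<mu> = \<nu>"
proof (rule Levy_uniqueness)
  show "real_distribution \<mu>" "real_distribution \<nu>"
    using represents_real_distribution[OF \<mu>] represents_real_distribution[OF \<nu>] assms by auto
  have approx: "cmod (char \<sigma> t - (\<Sum>k\<le>2*n. ((\<i> * t) ^ k / fact k) * L (monom 1 k)))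
      \<le> (2 * \<bar>t\<bar> ^ (2 * n) / fact (2 * n)) * (c * M ^ (2 * n))" 
    if \<sigma>: "represents \<sigma> L" for \<sigma> t n
  proof -
    interpret real_distribution \<sigma> using represents_real_distribution[OF \<sigma>] assms by auto
    have mom: "has_bochner_integral \<sigma> (\<lambda>x. x ^ k) (L (monom 1 k))" for k
      by (rule represents_has_integral[OF \<sigma>]) (simp add: poly_monom)
    have eq: "integral\<^sup>L \<sigma> (\<lambda>x. x ^ k) = L (monom 1 k)" for k
      using mom[of k] by (simp add: has_bochner_integral_iff)
    have "cmod (char \<sigma> t - (\<Sum>k\<le>2*n. ((\<i> * t) ^ k / fact k) * L (monom 1 k)))
        \<le> (2 * \<bar>t\<bar> ^ (2 * n) / fact (2 * n)) * L (monom 1 (2 * n))"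
      using char_approx1[of "2 * n" t] mom unfolding has_bochner_integral_iff
      by (simp add: power_even_abs)
    also have "\<dots> \<le> (2 * \<bar>t\<bar> ^ (2 * n) / fact (2 * n)) * (c * M ^ (2 * n))"
      by (intro mult_left_mono bound) auto
    finally show ?thesis .
  qed
  show "char \<mu> = char \<nu>"
  proof
    fix t
    have "dist (char \<mu> t) (char \<nu> t) \<le> 4 * c * ((\<bar>t\<bar> * M) ^ (2 * n) / fact (2 * n))" for n
    proof -
      define S where "S = (\<Sum>k\<le>2*n. ((\<i> * t) ^ k / fact k) * L (monom 1 k))"
      define B where "B = (2 * \<bar>t\<bar> ^ (2 * n) / fact (2 * n)) * (c * M ^ (2 * n))"
      have "dist (char \<mu> t) S \<le> B" "dist (char \<nu> t) S \<le> B"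
        using approx[OF \<mu>, of t n] approx[OF \<nu>, of t n] unfolding S_def B_def dist_norm .
      then have "dist (char \<mu> t) (char \<nu> t) \<le> 2 * B"
        using dist_triangle2[of "char \<mu> t" "char \<nu> t" S] by simp
      also have "2 * B = 4 * c * ((\<bar>t\<bar> * M) ^ (2 * n) / fact (2 * n))"
        by (simp add: B_def power_mult_distrib)
      finally show ?thesis .
    qed
    moreover have "(\<lambda>n. 4 * c * ((\<bar>t\<bar> * M) ^ (2 * n) / fact (2 * n))) \<longlonglongrightarrow> 4 * c * 0"
    proof (intro tendsto_intros)
      have "(\<lambda>n. (\<bar>t\<bar> * M) ^ n / fact n) \<longlonglongrightarrow> 0"
        using summable_LIMSEQ_zero[OF summable_exp[of "\<bar>t\<bar> * M"]] by (simp add: field_simps)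
      then show "(\<lambda>n. (\<bar>t\<bar> * M) ^ (2 * n) / fact (2 * n)) \<longlonglongrightarrow> 0"
        by (rule LIMSEQ_subseq_LIMSEQ[where f = "\<lambda>n. 2 * n", unfolded comp_def])
           (auto intro: strict_monoI)
    qed
    ultimately have "dist (char \<mu> t) (char \<nu> t) \<le> 4 * c * 0"
      by (intro LIMSEQ_le_const) auto
    then show "char \<mu> t = char \<nu> t" by simp
  qed
qed

text \<open>Dividing by the total mass \<open>L 1\<close> gives probability measures. Mass 0 is set
  apart, because both measures then vanish.\<close>

lemma represents_unique:
  assumes \<mu>: "represents \<mu> L" and \<nu>: "represents \<nu> L"
    and bound: "\<And>k. L (monom 1 (2 * k)) \<le> c * M ^ (2 * k)"
  shows "\<mu> = \<nu>"
proof (cases "L 1 = 0")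
  case True
  have zero: "emeasure \<sigma> X = 0" if \<sigma>: "represents \<sigma> L" for \<sigma> X
  proof -
    interpret finite_measure \<sigma> by (rule represents_finite_measure[OF \<sigma>])
    have "emeasure \<sigma> (space \<sigma>) = 0"
      using represents_measure_space[OF \<sigma>] True by (simp add: emeasure_eq_measure)
    then show ?thesis
      using emeasure_space[of \<sigma> X] by simp
  qed
  show ?thesis
    by (rule measure_eqI) (auto simp: represents_sets[OF \<mu>] represents_sets[OF \<nu>] zero[OF \<mu>] zero[OF \<nu>])
next
  case False
  have "L 1 \<ge> 0"
    using represents_measure_space[OF \<mu>] by (metis measure_nonneg)
  with False have pos: "L 1 > 0" by simp
  define r where "r = 1 / L 1"
  have r: "r > 0" using pos by (simp add: r_def)
  have eq: "density \<mu> (\<lambda>_. ennreal r) = density \<nu> (\<lambda>_. ennreal r)"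
  proof (rule represents_unique_prob)
    show "represents (density \<mu> (\<lambda>_. ennreal r)) (\<lambda>p. r * L p)"
      "represents (density \<nu> (\<lambda>_. ennreal r)) (\<lambda>p. r * L p)"
      using represents_density_const[OF \<mu>] represents_density_const[OF \<nu>] r by auto
    show "r * L 1 = 1" using pos by (simp add: r_def)
    show "r * L (monom 1 (2 * k)) \<le> (r * c) * M ^ (2 * k)" for k
      using bound[of k] r by (simp add: mult.assoc)
  qed
  show ?thesis
  proof (rule measure_eqI)
    fix X assume X: "X \<in> sets \<mu>"
    then have X': "X \<in> sets \<nu>" by (simp add: represents_sets[OF \<mu>] represents_sets[OF \<nu>])
    have "ennreal r * emeasure \<mu> X = ennreal r * emeasure \<nu> X"
      using arg_cong[OF eq, of "\<lambda>\<sigma>. emeasure \<sigma> X"] X X' by (simp add: emeasure_density_const)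
    then show "emeasure \<mu> X = emeasure \<nu> X"
      using r by (simp add: ennreal_mult_cancel_left)
  qed (simp add: represents_sets[OF \<mu>] represents_sets[OF \<nu>])
qed

section \<open>Sums of measures, the measure side of the parallelogram law\<close>

definition sum_measures :: "'a measure \<Rightarrow> 'a measure \<Rightarrow> 'a measure" where
  "sum_measures \<mu> \<nu> = measure_of (space \<mu>) (sets \<mu>) (\<lambda>X. emeasure \<mu> X + emeasure \<nu> X)"

lemma sets_sum_measures [simp]: "sets (sum_measures \<mu> \<nu>) = sets \<mu>"
  and space_sum_measures [simp]: "space (sum_measures \<mu> \<nu>) = space \<mu>"
  by (auto simp: sum_measures_def)

lemma emeasure_sum_measures:
  assumes "sets \<nu> = sets \<mu>" "X \<in> sets \<mu>"
  shows "emeasure (sum_measures \<mu> \<nu>) X = emeasure \<mu> X + emeasure \<nu> X"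
proof (rule emeasure_measure_of[OF sum_measures_def sets.space_closed])
  show "countably_additive (sets (sum_measures \<mu> \<nu>)) (\<lambda>X. emeasure \<mu> X + emeasure \<nu> X)"
    unfolding countably_additive_def sets_sum_measures
  proof (intro allI impI)
    fix F :: "nat \<Rightarrow> 'a set" assume F: "range F \<subseteq> sets \<mu>" "disjoint_family F" "\<Union> (range F) \<in> sets \<mu>"
    then have "range F \<subseteq> sets \<nu>" using assms by simp
    then show "(\<Sum>i. emeasure \<mu> (F i) + emeasure \<nu> (F i)) = emeasure \<mu> (\<Union> (range F)) + emeasure \<nu> (\<Union> (range F))"
      using F by (simp add: suminf_add[symmetric] suminf_emeasure)
  qed
qed (use assms in \<open>auto simp: positive_def\<close>)

lemma nn_integral_sum_measures:
  assumes s: "sets \<nu> = sets \<mu>" and f: "f \<in> borel_measurable \<mu>"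
  shows "(\<integral>\<^sup>+x. f x \<partial>sum_measures \<mu> \<nu>) = (\<integral>\<^sup>+x. f x \<partial>\<mu>) + (\<integral>\<^sup>+x. f x \<partial>\<nu>)"
proof -
  have m: "u \<in> borel_measurable (sum_measures \<mu> \<nu>)" "u \<in> borel_measurable \<nu>"
    if "u \<in> borel_measurable \<mu>" for u :: "'a \<Rightarrow> ennreal"
    using that s by (simp_all cong: measurable_cong_sets)
  have sp: "space \<nu> = space \<mu>" using s by (rule sets_eq_imp_space_eq)
  from f show ?thesis
  proof (induction rule: borel_measurable_induct)
    case (cong f g)
    then show ?case
      using nn_integral_cong[of "sum_measures \<mu> \<nu>" f g] nn_integral_cong[of \<mu> f g]
        nn_integral_cong[of \<nu> f g] sp by auto
  next
    case (set A)
    then show ?case using s by (simp add: emeasure_sum_measures)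
  next
    case (mult u c)
    then show ?case
      using m[OF \<open>u \<in> borel_measurable \<mu>\<close>] by (simp add: nn_integral_cmult distrib_left)
  next
    case (add u v)
    then show ?case
      using m[OF \<open>u \<in> borel_measurable \<mu>\<close>] m[OF \<open>v \<in> borel_measurable \<mu>\<close>]
      by (simp add: nn_integral_add ac_simps)
  next
    case (seq U)
    have i: "incseq (\<lambda>i. \<integral>\<^sup>+x. U i x \<partial>\<mu>)" "incseq (\<lambda>i. \<integral>\<^sup>+x. U i x \<partial>\<nu>)"
      using \<open>incseq U\<close> by (auto simp: incseq_def le_fun_def intro!: nn_integral_mono)
    have sup: "(\<integral>\<^sup>+x. (SUP i. U i) x \<partial>\<sigma>) = (SUP i. \<integral>\<^sup>+x. U i x \<partial>\<sigma>)"
      if "\<And>i. U i \<in> borel_measurable \<sigma>" for \<sigma>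
      using nn_integral_monotone_convergence_SUP[OF \<open>incseq U\<close> that] by (simp add: image_comp)
    have "(SUP i. (\<integral>\<^sup>+x. U i x \<partial>sum_measures \<mu> \<nu>))
        = (SUP i. (\<integral>\<^sup>+x. U i x \<partial>\<mu>) + (\<integral>\<^sup>+x. U i x \<partial>\<nu>))"
      using seq.IH by simp
    also have "\<dots> = (SUP i. \<integral>\<^sup>+x. U i x \<partial>\<mu>) + (SUP i. \<integral>\<^sup>+x. U i x \<partial>\<nu>)"
      by (rule ennreal_SUP_add[OF i])
    finally show ?case
      using sup[OF seq.hyps(1)] sup[OF m(1)[OF seq.hyps(1)]] sup[OF m(2)[OF seq.hyps(1)]] by simp
  qed
qed

lemma represents_sum_measures:
  assumes \<mu>: "represents \<mu> L" and \<nu>: "represents \<nu> L'"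
  shows "represents (sum_measures \<mu> \<nu>) (\<lambda>p. L p + L' p)"
  unfolding represents_def
proof (intro conjI allI)
  have s: "sets \<nu> = sets \<mu>" using represents_sets[OF \<mu>] represents_sets[OF \<nu>] by simp
  show "sets (sum_measures \<mu> \<nu>) = sets borel" by (simp add: represents_sets[OF \<mu>])
  note [measurable_cong] = represents_sets[OF \<mu>] represents_sets[OF \<nu>]
  fix p
  have int: "integrable \<mu> (poly p)" "integrable \<nu> (poly p)"
    and eq: "integral\<^sup>L \<mu> (poly p) = L p" "integral\<^sup>L \<nu> (poly p) = L' p"
    using represents_integral[OF \<mu>, of p] represents_integral[OF \<nu>, of p]
    by (auto simp: has_bochner_integral_iff)
  have nn: "(\<integral>\<^sup>+x. f x \<partial>sum_measures \<mu> \<nu>) = (\<integral>\<^sup>+x. f x \<partial>\<mu>) + (\<integral>\<^sup>+x. f x \<partial>\<nu>)"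
    if "f \<in> borel_measurable borel" for f
    using that by (intro nn_integral_sum_measures s) (simp cong: measurable_cong_sets add: represents_sets[OF \<mu>])
  have bm: "poly p \<in> borel_measurable (sum_measures \<mu> \<nu>)"
    using borel_measurable_poly[of p]
    by (simp cong: measurable_cong_sets add: represents_sets[OF \<mu>] del: borel_measurable_poly)
  have I: "integrable (sum_measures \<mu> \<nu>) (poly p)"
    using int bm unfolding integrable_iff_bounded by (simp add: nn)
  have fin: "(\<integral>\<^sup>+x. ennreal (g x) \<partial>\<sigma>) < top" if "integrable \<sigma> g" for \<sigma> :: "real measure" and g :: "real \<Rightarrow> real"
    using that by (auto simp: real_integrable_def less_top)
  have "integral\<^sup>L (sum_measures \<mu> \<nu>) (poly p) = L p + L' p"
    using fin[OF int(1)] fin[OF int(2)] fin[of _ "\<lambda>x. - poly p x"] int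
    unfolding real_lebesgue_integral_def[OF I] eq[symmetric] real_lebesgue_integral_def[OF int(1)]
      real_lebesgue_integral_def[OF int(2)]
    by (simp add: nn enn2real_plus)
  with I show "has_bochner_integral (sum_measures \<mu> \<nu>) (poly p) (L p + L' p)"
    by (simp add: has_bochner_integral_iff)
qed

lemma representsI:
  assumes "sets \<mu> = sets borel"
    and add: "\<And>p q. L (p + q) = L p + L q" and smult: "\<And>c p. L (smult c p) = c * L p"
    and moments: "\<And>n. has_bochner_integral \<mu> (\<lambda>x. x ^ n) (L (monom 1 n))"
  shows "represents \<mu> L"
  unfolding represents_def
proof (intro conjI allI)
  fix p :: "real poly"
  have L0: "L 0 = 0" using smult[of 0 0] by simp
  have sum: "L (sum f S) = (\<Sum>x\<in>S. L (f x))" for f :: "nat \<Rightarrow> real poly" and S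
    by (induction S rule: infinite_finite_induct) (auto simp: L0 add)
  have "L p = L (\<Sum>i\<le>degree p. smult (coeff p i) (monom 1 i))"
    by (simp add: smult_monom poly_as_sum_of_monoms)
  also have "\<dots> = (\<Sum>i\<le>degree p. coeff p i * L (monom 1 i))"
    by (simp add: sum smult)
  finally have L: "L p = (\<Sum>i\<le>degree p. coeff p i * L (monom 1 i))" .
  have "has_bochner_integral \<mu> (\<lambda>x. \<Sum>i\<le>degree p. coeff p i * x ^ i) (L p)"
    unfolding L using moments by (intro has_bochner_integral_sum has_bochner_integral_mult_right) auto
  then show "has_bochner_integral \<mu> (poly p) (L p)"
    unfolding poly_altdef[abs_def] .
qed (rule assms)

text \<open>(n choose k)(k choose m) = (n choose m)(n-m choose k-m) takes out (n choose m) x^m, and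
  the binomial theorem with exponent n - m sums the rest. The ring is general because the identity
  is applied to the polynomials t and 1 - t.\<close>

lemma bernstein_falling:
  fixes x y :: "'a::comm_ring_1"
  assumes "m \<le> n" "x + y = 1"
  shows "(\<Sum>k\<le>n. of_nat ((n choose k) * (k choose m)) * x ^ k * y ^ (n - k)) = of_nat (n choose m) * x ^ m"
proof -
  have "(\<Sum>k\<le>n. of_nat ((n choose k) * (k choose m)) * x ^ k * y ^ (n - k))
      = (\<Sum>k\<in>{m..n}. of_nat ((n choose k) * (k choose m)) * x ^ k * y ^ (n - k))"
    by (intro sum.mono_neutral_right) (auto simp: not_le binomial_eq_0)
  also have "\<dots> = (\<Sum>k\<in>{m..n}. of_nat (n choose m) * x ^ m *
      (of_nat (n - m choose (k - m)) * x ^ (k - m) * y ^ (n - k)))"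
  proof (rule sum.cong)
    fix k assume k: "k \<in> {m..n}"
    then have "x ^ k = x ^ m * x ^ (k - m)" by (simp flip: power_add)
    then show "of_nat ((n choose k) * (k choose m)) * x ^ k * y ^ (n - k)
        = of_nat (n choose m) * x ^ m * (of_nat (n - m choose (k - m)) * x ^ (k - m) * y ^ (n - k))"
      using k choose_mult[of m k n] by (simp add: mult_ac)
  qed simp
  also have "\<dots> = of_nat (n choose m) * x ^ m *
      (\<Sum>j\<le>n - m. of_nat (n - m choose j) * x ^ j * y ^ (n - m - j))"
    unfolding sum_distrib_left
    by (rule sum.reindex_bij_witness[of _ "\<lambda>j. j + m" "\<lambda>k. k - m"])
       (use assms in \<open>auto simp: diff_diff_eq\<close>)
  also have "\<dots> = of_nat (n choose m) * x ^ m"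
    using binomial_ring[of x y "n - m"] assms by simp
  finally show ?thesis .
qed

text \<open>Both terms are products of m factors from [0,1], namely k/n and (k-i)/(n-i) for i < m,
  and corresponding factors differ by at most m/(n-m).\<close>

lemma binomial_ratio_approx:
  assumes "m < n" "k \<le> n"
  shows "\<bar>(real k / real n) ^ m - real (k choose m) / real (n choose m)\<bar> \<le> real m * (real m / real (n - m))"
proof -
  define a where "a i = real (k - i) / real (n - i)" for i
  have ratio: "real (k choose m) / real (n choose m) = (\<Prod>i<m. a i)"
  proof (cases "m \<le> k")
    case True
    then show ?thesis
      using assms by (simp add: binomial_altdef_of_nat a_def prod_dividef atLeast0LessThan)
  next
    case False
    \<comment> \<open>Here k < m, and the factor with i = k is zero.\<close>
    then have "(\<Prod>i<m. a i) = 0" by (intro prod_zero) (auto simp: a_def intro!: bexI[of _ k])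
    with False show ?thesis by (simp add: binomial_eq_0)
  qed
  have a01: "norm (a i) \<le> 1" if "i < m" for i
    using that assms by (simp add: a_def divide_le_eq_1)
  have k01: "norm (real k / real n) \<le> 1" using assms by (simp add: divide_le_eq_1)
  have diff: "norm (real k / real n - a i) \<le> real m / real (n - m)" if "i < m" for i
  proof -
    have n: "real (n - i) = real n - real i" using that assms by simp
    have pos: "real n - real i > 0" "real n > 0" using that assms by auto
    have 1: "real k / real n - a i \<le> real i / (real n - real i)"
    proof -
      have "real k / real n \<le> real k / (real n - real i)"
        using pos by (intro divide_left_mono) auto
      also have "\<dots> \<le> (real (k - i) + real i) / (real n - real i)"
        using pos by (intro divide_right_mono) linarith+
      finally show ?thesis by (simp add: a_def n add_divide_distrib)
    qed
    have "a i * real n \<le> real k"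
    proof (cases "i \<le> k")
      case True
      have "(real k - real i) * real n \<le> real k * (real n - real i)"
        using assms by (simp add: algebra_simps mult_left_mono)
      then show ?thesis using True pos by (simp add: a_def n field_simps)
    qed (simp add: a_def)
    then have 2: "a i \<le> real k / real n" using pos by (simp add: field_simps)
    have "real i / (real n - real i) \<le> real m / real (n - m)"
      using that assms by (intro frac_le) auto
    with 1 2 show ?thesis by simp
  qed
  have "norm ((\<Prod>i<m. real k / real n) - (\<Prod>i<m. a i)) \<le> (\<Sum>i<m. norm (real k / real n - a i))"
    by (rule norm_prod_diff) (use a01 k01 in auto)
  also have "\<dots> \<le> real m * (real m / real (n - m))"
    using sum_bounded_above[of "{..<m}" "\<lambda>i. norm (real k / real n - a i)" "real m / real (n - m)"] diff
    by simp
  finally show ?thesis by (simp add: ratio)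
qed

text \<open>The values of \<open>L\<close> on the Bernstein polynomials of degree n are the weights
  of a probability measure on the nodes k/n. Its moments tend to those of \<open>L\<close>, because
  (k/n)^m is close to (k choose m)/(n choose m), whose weighted sum is exact by
  \<open>bernstein_falling\<close>. All these measures live on [0,1], so a subsequence converges
  weakly.\<close>

theorem hausdorff_moment_problem:
  fixes L :: "real poly \<Rightarrow> real"
  assumes add: "\<And>p q. L (p + q) = L p + L q" and smult: "\<And>c p. L (smult c p) = c * L p"
    and nonneg: "\<And>a b. L ([:0, 1:] ^ a * [:1, -1:] ^ b) \<ge> 0" and one: "L 1 = 1"
  shows "\<exists>\<mu>. represents \<mu> L"
proof -
  define w where "w n k = real (n choose k) * L ([:0, 1:] ^ k * [:1, -1:] ^ (n - k))" for n k
  have w0: "w n k \<ge> 0" for n k unfolding w_def using nonneg by simp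
  have L0: "L 0 = 0" using smult[of 0 0] by simp
  have sum: "L (sum f S) = (\<Sum>x\<in>S. L (f x))" for f :: "nat \<Rightarrow> real poly" and S
    by (induction S rule: infinite_finite_induct) (auto simp: L0 add)
  have of_nat: "L (of_nat j * p) = real j * L p" for j p
    using smult[of "real j" p] by (simp add: of_nat_poly)
  have wsum: "(\<Sum>k\<le>n. w n k * real (k choose m)) = real (n choose m) * L (monom 1 m)" if "m \<le> n" for m n
  proof -
    have "L (\<Sum>k\<le>n. of_nat ((n choose k) * (k choose m)) * ([:0, 1:] ^ k * [:1, -1:] ^ (n - k)))
        = L (of_nat (n choose m) * [:0, 1:] ^ m)"
      using bernstein_falling[OF that, of "[:0, 1:] :: real poly" "[:1, -1:]"]
      by (simp add: mult.assoc one_pCons)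
    then show ?thesis
      unfolding sum of_nat by (simp add: w_def mult_ac flip: monom_altdef[of 1, simplified])
  qed
  have w1: "(\<Sum>k\<le>n. w n k) = 1" for n
    using wsum[of 0 n] by (simp add: one monom_0 flip: one_pCons)

  define D where "D n = embed_pmf (\<lambda>k. if k \<le> n then w n k else 0)" for n
  have D: "pmf (D n) k = (if k \<le> n then w n k else 0)" for n k
    unfolding D_def
  proof (rule pmf_embed_pmf)
    have "(\<integral>\<^sup>+k. ennreal (if k \<le> n then w n k else 0) \<partial>count_space UNIV)
        = (\<Sum>k\<le>n. ennreal (if k \<le> n then w n k else 0))"
      by (rule nn_integral_count_space') auto
    also have "\<dots> = ennreal (\<Sum>k\<le>n. w n k)" using w0 by simp
    finally show "(\<integral>\<^sup>+k. ennreal (if k \<le> n then w n k else 0) \<partial>count_space UNIV) = 1"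
      by (simp add: w1)
  qed (use w0 in auto)
  define \<rho> where "\<rho> n = distr (measure_pmf (D n)) borel (\<lambda>k. real k / real n)" for n
  have rd: "real_distribution (\<rho> n)" for n
    unfolding \<rho>_def by (rule prob_space.real_distribution_distr[OF prob_space_measure_pmf]) simp
  have \<rho>: "integral\<^sup>L (\<rho> n) f = (\<Sum>k\<le>n. w n k * f (real k / real n))"
    if "f \<in> borel_measurable borel" for f :: "real \<Rightarrow> real" and n
  proof -
    have "integral\<^sup>L (\<rho> n) f = integral\<^sup>L (measure_pmf (D n)) (\<lambda>k. f (real k / real n))"
      unfolding \<rho>_def by (rule integral_distr) (use that in auto)
    also have "\<dots> = (\<Sum>k\<le>n. f (real k / real n) * pmf (D n) k)"
      by (rule integral_measure_pmf_real) (auto simp: set_pmf_iff D split: if_splits)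
    finally show ?thesis by (simp add: D mult.commute)
  qed
  \<comment> \<open>Tightness is formulated with half-open intervals, so the left end has to lie
    strictly below the node 0.\<close>
  have supp: "measure (\<rho> n) {-1<..1} = 1" for n
  proof -
    interpret real_distribution "\<rho> n" by (rule rd)
    have "measure (\<rho> n) {-1<..1} = integral\<^sup>L (\<rho> n) (indicator {-1<..1})" by simp
    also have "\<dots> = (\<Sum>k\<le>n. w n k * indicator {-1<..1} (real k / real n))"
      by (rule \<rho>) simp
    also have "\<dots> = (\<Sum>k\<le>n. w n k)"
    proof (rule sum.cong)
      fix k assume "k \<in> {..n}"
      moreover have "-1 < real k / real n" by (rule less_le_trans[of _ 0]) auto
      ultimately show "w n k * indicator {-1<..1} (real k / real n) = w n k"
        by (auto simp: indicator_def divide_le_eq_1)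
    qed simp
    finally show ?thesis by (simp add: w1)
  qed
  have "tight \<rho>"
    unfolding tight_def
  proof (intro conjI allI impI rd)
    fix e :: real assume "e > 0"
    then have "-1 < (1 :: real) \<and> (\<forall>n. 1 - e < measure (\<rho> n) {-1<..1})" using supp by simp
    then show "\<exists>a b. a < b \<and> (\<forall>n. 1 - e < measure (\<rho> n) {a<..b})" by blast
  qed
  then obtain r \<mu> where r: "strict_mono (r :: nat \<Rightarrow> nat)" and \<mu>: "real_distribution \<mu>"
    and weak: "weak_conv_m (\<rho> \<circ> id \<circ> r) \<mu>"
    using tight_imp_convergent_subsubsequence[of \<rho> id] by (auto simp: strict_mono_def)
  interpret \<mu>: real_distribution \<mu> by (rule \<mu>)
  have lim: "(\<lambda>n. integral\<^sup>L (\<rho> (r n)) f) \<longlonglongrightarrow> integral\<^sup>L \<mu> f"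
    if "\<And>x. isCont f x" "\<And>x. norm (f x) \<le> B" for f :: "real \<Rightarrow> real" and B
    using weak_conv_imp_integral_bdd_continuous_conv[of "\<lambda>n. \<rho> (r n)" \<mu> f B] rd \<mu> weak that
    by (simp add: comp_def)

  \<comment> \<open>Weak convergence tests bounded functions only. Powers of \<open>clamp\<close>
    are bounded and agree with the true powers at all nodes.\<close>
  define clamp :: "real \<Rightarrow> real" where "clamp t = max 0 (min 1 t)" for t
  have clamp01: "0 \<le> clamp t" "clamp t \<le> 1" for t by (auto simp: clamp_def)
  have clamp_id: "clamp (real k / real n) = real k / real n" if "k \<le> n" for k n
  proof -
    have "real k / real n \<le> 1" using that by (auto simp: divide_le_eq_1)
    then show ?thesis by (simp add: clamp_def)
  qed
  have cont [continuous_intros]: "isCont clamp t" for t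
    unfolding clamp_def[abs_def] by (intro continuous_intros)
  have [measurable]: "clamp \<in> borel_measurable borel"
    unfolding clamp_def[abs_def] by simp
  have moment: "(\<lambda>n. integral\<^sup>L (\<rho> n) (\<lambda>t. clamp t ^ m)) \<longlonglongrightarrow> L (monom 1 m)" for m
  proof (rule LIM_zero_cancel, rule Lim_null_comparison)
    show "\<forall>\<^sub>F n in sequentially. norm (integral\<^sup>L (\<rho> n) (\<lambda>t. clamp t ^ m) - L (monom 1 m))
        \<le> real m * (real m / real (n - m))"
      using eventually_gt_at_top[of m]
    proof eventually_elim
      case (elim n)
      have "L (monom 1 m) = (\<Sum>k\<le>n. w n k * (real (k choose m) / real (n choose m)))"
        using wsum[of m n] elim by (simp flip: sum_divide_distrib)
      moreover have "integral\<^sup>L (\<rho> n) (\<lambda>t. clamp t ^ m) = (\<Sum>k\<le>n. w n k * (real k / real n) ^ m)"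
        by (subst \<rho>) (auto simp: clamp_id)
      ultimately have "norm (integral\<^sup>L (\<rho> n) (\<lambda>t. clamp t ^ m) - L (monom 1 m))
          = norm (\<Sum>k\<le>n. w n k * ((real k / real n) ^ m - real (k choose m) / real (n choose m)))"
        by (simp add: sum_subtractf right_diff_distrib)
      also have "\<dots> \<le> (\<Sum>k\<le>n. w n k * (real m * (real m / real (n - m))))"
      proof (rule sum_norm_le)
        fix k assume "k \<in> {..n}"
        then show "norm (w n k * ((real k / real n) ^ m - real (k choose m) / real (n choose m)))
            \<le> w n k * (real m * (real m / real (n - m)))"
          unfolding real_norm_def abs_mult abs_of_nonneg[OF w0]
          by (intro mult_left_mono binomial_ratio_approx w0 elim) auto
      qed
      also have "\<dots> = real m * (real m / real (n - m))"
        unfolding sum_distrib_right[symmetric] w1 by simp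
      finally show ?case .
    qed
    have "(\<lambda>n. real m * (real m / real (n + m - m))) \<longlonglongrightarrow> real m * 0"
      by (intro tendsto_intros) (simp add: lim_const_over_n)
    then have "(\<lambda>n. real m * (real m / real (n + m - m))) \<longlonglongrightarrow> 0" by simp
    then show "(\<lambda>n. real m * (real m / real (n - m))) \<longlonglongrightarrow> 0"
      by (rule LIMSEQ_offset)
  qed
  have clamp_moment: "integral\<^sup>L \<mu> (\<lambda>t. clamp t ^ m) = L (monom 1 m)" for m
  proof (rule LIMSEQ_unique)
    show "(\<lambda>n. integral\<^sup>L (\<rho> (r n)) (\<lambda>t. clamp t ^ m)) \<longlonglongrightarrow> integral\<^sup>L \<mu> (\<lambda>t. clamp t ^ m)"
      by (rule lim[of _ 1]) (use clamp01 in \<open>auto intro!: continuous_intros power_le_one\<close>)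
    show "(\<lambda>n. integral\<^sup>L (\<rho> (r n)) (\<lambda>t. clamp t ^ m)) \<longlonglongrightarrow> L (monom 1 m)"
      using LIMSEQ_subseq_LIMSEQ[OF moment r] by (simp add: comp_def)
  qed
  \<comment> \<open>The truncated distance between t and \<open>clamp t\<close> is bounded and
    continuous and has integral 0 under every \<open>\<rho> n\<close>, hence under the limit, which
    is therefore carried by [0,1].\<close>
  have AE: "AE t in \<mu>. clamp t = t"
  proof -
    have m: "(\<lambda>t. min 1 \<bar>t - clamp t\<bar>) \<in> borel_measurable borel" by simp
    have 0: "integral\<^sup>L (\<rho> n) (\<lambda>t. min 1 \<bar>t - clamp t\<bar>) = 0" for n
      by (subst \<rho>[OF m]) (auto simp: clamp_id)
    have "(\<lambda>n. integral\<^sup>L (\<rho> (r n)) (\<lambda>t. min 1 \<bar>t - clamp t\<bar>)) \<longlonglongrightarrow> integral\<^sup>L \<mu> (\<lambda>t. min 1 \<bar>t - clamp t\<bar>)"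
      by (rule lim[of _ 1]) (auto intro!: continuous_intros)
    then have "integral\<^sup>L \<mu> (\<lambda>t. min 1 \<bar>t - clamp t\<bar>) = 0"
      unfolding 0 by (simp add: LIMSEQ_const_iff)
    moreover have "integrable \<mu> (\<lambda>t. min 1 \<bar>t - clamp t\<bar>)"
      by (rule \<mu>.integrable_const_bound[of _ 1]) auto
    ultimately have "AE t in \<mu>. min 1 \<bar>t - clamp t\<bar> = 0"
      using integral_nonneg_eq_0_iff_AE[of \<mu> "\<lambda>t. min 1 \<bar>t - clamp t\<bar>"] by simp
    then show ?thesis by eventually_elim (auto simp: min_def split: if_splits)
  qed
  have "represents \<mu> L"
  proof (rule representsI[OF \<mu>.events_eq_borel add smult])
    fix n
    have "integrable \<mu> (\<lambda>t. clamp t ^ n)"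
      by (rule \<mu>.integrable_const_bound[of _ 1]) (use clamp01 in \<open>auto intro!: power_le_one\<close>)
    then have "has_bochner_integral \<mu> (\<lambda>t. clamp t ^ n) (L (monom 1 n))"
      by (simp add: has_bochner_integral_iff clamp_moment)
    then show "has_bochner_integral \<mu> (\<lambda>x. x ^ n) (L (monom 1 n))"
      by (rule has_bochner_integralI_AE) (use AE in auto)
  qed
  then show ?thesis by blast
qed

section \<open>Symmetric operators and their polynomials\<close>

text \<open>Horner's scheme, so that evaluation follows the induction over \<open>pCons\<close>.
  Real coefficients keep p(T) symmetric when T is.\<close>

definition poly_op :: "('a::real_vector \<Rightarrow> 'a) \<Rightarrow> real poly \<Rightarrow> 'a \<Rightarrow> 'a" where
  "poly_op T p f = fold_coeffs (\<lambda>a h. a *\<^sub>R f + T h) p 0"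

context
  fixes T :: "'a::real_vector \<Rightarrow> 'a"
  assumes lin: "linear T"
begin

lemma poly_op_0 [simp]: "poly_op T 0 f = 0"
  by (simp add: poly_op_def)

lemma poly_op_pCons [simp]: "poly_op T (pCons a p) f = a *\<^sub>R f + T (poly_op T p f)"
  using linear_0[OF lin] by (cases "a = 0 \<and> p = 0") (auto simp: poly_op_def)

lemma poly_op_0_fun: "poly_op T 0 = (\<lambda>_. 0)"
  by (rule ext) simp

lemma poly_op_pCons_fun: "poly_op T (pCons a p) = (\<lambda>f. a *\<^sub>R f + T (poly_op T p f))"
  by (rule ext) simp

lemma poly_op_1 [simp]: "poly_op T 1 f = f"
  using linear_0[OF lin] by (simp add: one_pCons)

lemma poly_op_add: "poly_op T (p + q) f = poly_op T p f + poly_op T q f"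
  by (induction p q rule: poly_induct2) (simp_all add: linear_add[OF lin] algebra_simps)

lemma poly_op_smult: "poly_op T (smult c p) f = c *\<^sub>R poly_op T p f"
  by (induction p) (simp_all add: linear_scale[OF lin] algebra_simps)

lemma poly_op_diff: "poly_op T (p - q) f = poly_op T p f - poly_op T q f"
  using poly_op_add[of p "smult (-1) q"] poly_op_smult[of "-1" q] by simp

lemma linear_poly_op: "linear (poly_op T p)"
proof (induction p)
  case (pCons a p)
  have "linear (\<lambda>f. a *\<^sub>R f + T (poly_op T p f))"
    using linear_compose[OF pCons.IH lin]
    by (intro linear_compose_add linear_compose_scale_right linear_ident) (simp add: comp_def)
  then show ?case by (simp only: poly_op_pCons_fun)
qed (simp add: poly_op_0_fun linear_zero)

lemma poly_op_commute:
  assumes "linear S" "\<And>f. S (T f) = T (S f)"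
  shows "S (poly_op T p f) = poly_op T p (S f)"
  by (induction p) (simp_all add: linear_0[OF assms(1)] linear_add[OF assms(1)] linear_scale[OF assms(1)] assms(2))

lemma poly_op_mult: "poly_op T (p * q) f = poly_op T p (poly_op T q f)"
proof (induction p)
  case (pCons a p)
  then show ?case by (simp add: poly_op_add poly_op_smult)
qed simp

lemma poly_op_swap: "poly_op T p (poly_op T q f) = poly_op T q (poly_op T p f)"
  unfolding poly_op_mult[symmetric] by (simp add: mult.commute)

lemma poly_op_monom: "poly_op T (monom 1 n) f = (T ^^ n) f"
  using linear_0[OF lin] by (induction n) (simp_all add: monom_0 monom_Suc)

end

lemma bounded_linear_poly_op:
  assumes "bounded_linear T"
  shows "bounded_linear (poly_op T p)"
proof (induction p)
  case 0
  then show ?case using assms by (simp add: poly_op_0_fun bounded_linear.linear)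
next
  case (pCons a p)
  have "bounded_linear (\<lambda>f. a *\<^sub>R f + T (poly_op T p f))"
    using pCons.IH assms
    by (intro bounded_linear_add bounded_linear_scaleR_right bounded_linear_compose[OF assms] )
  then show ?case using assms by (simp only: poly_op_pCons_fun bounded_linear.linear)
qed

text \<open>The moment functional of the spectral measure of \<open>f\<close>.\<close>
definition moment_functional :: "('a::real_inner \<Rightarrow> 'a) \<Rightarrow> 'a \<Rightarrow> real poly \<Rightarrow> real" where
  "moment_functional T f p = inner f (poly_op T p f)"

locale symmetric_operator =
  fixes T :: "'a::real_inner \<Rightarrow> 'a"
  assumes bounded: "bounded_linear T" and symmetric: "inner (T f) g = inner f (T g)"
begin

lemma lin: "linear T" using bounded by (rule bounded_linear.linear)

lemmas poly_op_simps = poly_op_0[OF lin] poly_op_1[OF lin] poly_op_pCons[OF lin] poly_op_add[OF lin]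
  poly_op_smult[OF lin] poly_op_diff[OF lin]

lemma poly_op_symmetric: "inner (poly_op T p f) g = inner f (poly_op T p g)"
proof (induction p arbitrary: f)
  case (pCons a p)
  then show ?case
    by (simp add: poly_op_simps inner_add_left inner_add_right symmetric poly_op_commute[OF lin lin])
qed (simp add: poly_op_simps)

text \<open>On the side of measures: passing from f to P(T) f multiplies the spectral measure by the
  square of P.\<close>

lemma moment_functional_poly_op:
  "moment_functional T (poly_op T P f) p = moment_functional T f (P * P * p)"
  unfolding moment_functional_def poly_op_symmetric poly_op_mult[OF lin]
  by (simp add: poly_op_swap[OF lin, of p P])

lemma moment_functional_parallelogram:
  "moment_functional T (f + g) p + moment_functional T (f - g) p =
    (moment_functional T f p + moment_functional T f p) + (moment_functional T g p + moment_functional T g p)"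
  unfolding moment_functional_def
  by (simp add: linear_add[OF linear_poly_op[OF lin]] linear_diff[OF linear_poly_op[OF lin]]
      inner_add_left inner_add_right inner_diff_left inner_diff_right)

lemma moment_functional_even_bound:
  "moment_functional T f (monom 1 (2 * k)) \<le> (norm f)\<^sup>2 * onorm T ^ (2 * k)"
proof -
  have pow: "norm ((T ^^ n) f) \<le> onorm T ^ n * norm f" for n
  proof (induction n)
    case (Suc n)
    have "norm ((T ^^ Suc n) f) \<le> onorm T * norm ((T ^^ n) f)"
      using onorm[OF bounded] by simp
    also have "\<dots> \<le> onorm T * (onorm T ^ n * norm f)"
      by (intro mult_left_mono Suc onorm_pos_le bounded)
    finally show ?case by (simp add: mult_ac)
  qed simp
  have "moment_functional T f (monom 1 (2 * k)) \<le> norm f * norm ((T ^^ (2 * k)) f)"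
    unfolding moment_functional_def poly_op_monom[OF lin] by (rule norm_cauchy_schwarz)
  also have "\<dots> \<le> norm f * (onorm T ^ (2 * k) * norm f)"
    by (intro mult_left_mono pow) auto
  finally show ?thesis by (simp add: power2_eq_square mult_ac)
qed

lemma representing_measure_unique:
  assumes "represents \<mu> (moment_functional T f)" "represents \<nu> (moment_functional T f)"
  shows "\<mu> = \<nu>"
  using assms moment_functional_even_bound by (rule represents_unique)

text \<open>An affine map r takes [-M, M] onto [0, 1], so r(T) and 1 - r(T) are positive, and the
  Hausdorff moment problem applies to p -> <f, p(r(T)) f> divided by the squared norm of f. The
  inverse map t -> 2Mt - M and multiplication by the squared norm carry the solution back.\<close>

lemma ex_representing_measure: "\<exists>\<mu>. represents \<mu> (moment_functional T f)"
proof (cases "f = 0")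
  case True
  then have "represents (null_measure borel) (moment_functional T f)"
    by (auto simp: represents_def moment_functional_def has_bochner_integral_iff integrable_iff_bounded integral_null_measure)
  then show ?thesis by blast
next
  case False
  \<comment> \<open>The summand 1 keeps M positive even if T = 0.\<close>
  define M where "M = onorm T + 1"
  have M: "M > 0" using onorm_pos_le[OF bounded] by (simp add: M_def)
  have bound: "\<bar>inner g (T g)\<bar> \<le> M * inner g g" for g
  proof -
    have "\<bar>inner g (T g)\<bar> \<le> norm g * norm (T g)" by (rule Cauchy_Schwarz_ineq2)
    also have "\<dots> \<le> norm g * (M * norm g)"
      using onorm[OF bounded, of g] mult_right_mono[of "onorm T" M "norm g"]
      by (intro mult_left_mono) (auto simp: M_def)
    finally show ?thesis by (simp add: dot_square_norm power2_eq_square mult_ac)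
  qed
  define r where "r = [:1 / 2, 1 / (2 * M):]"
  define pos where "pos q \<longleftrightarrow> (\<forall>g. inner g (poly_op T q g) \<ge> 0)" for q
  have pos_square: "pos (q * q * q')" if "pos q'" for q q'
    using that moment_functional_poly_op[of q _ q'] unfolding pos_def moment_functional_def by metis
  have pos_add: "pos (q + q')" if "pos q" "pos q'" for q q'
    using that unfolding pos_def by (simp add: poly_op_simps inner_add_right)
  have pos_1: "pos 1" unfolding pos_def by (simp add: poly_op_simps)
  have pos_r: "pos r"
    unfolding pos_def
  proof
    fix g
    have "inner g (poly_op T r g) = (M * inner g g + inner g (T g)) / (2 * M)"
      using M linear_0[OF lin] linear_scale[OF lin] by (simp add: r_def poly_op_simps inner_add_right field_simps)
    then show "inner g (poly_op T r g) \<ge> 0" using bound[of g] M by simp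
  qed
  have pos_r': "pos (1 - r)"
    unfolding pos_def
  proof
    fix g
    have "inner g (poly_op T (1 - r) g) = (M * inner g g - inner g (T g)) / (2 * M)"
      using M linear_0[OF lin] linear_scale[OF lin]
      by (simp add: r_def poly_op_simps inner_add_right inner_diff_right field_simps)
    then show "inner g (poly_op T (1 - r) g) \<ge> 0" using bound[of g] M by simp
  qed
  \<comment> \<open>Positivity of a product of commuting positive operators would usually come from
    a square root. Here an identity writes the product as a sum of two terms q^2 q' with q'
    positive.\<close>
  have pos_rr': "pos (r * (1 - r))"
  proof -
    have "r * (1 - r) = r * r * (1 - r) + (1 - r) * (1 - r) * r" by (simp add: algebra_simps)
    then show ?thesis using pos_add pos_square pos_r pos_r' by metis
  qed
  have pos_pow: "pos (r ^ a * (1 - r) ^ b)" for a b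
  proof -
    \<comment> \<open>The even parts of both exponents form a square; what remains is 1, r, 1 - r or
      r(1 - r).\<close>
    define q where "q = r ^ (a div 2) * (1 - r) ^ (b div 2)"
    have "r ^ a * (1 - r) ^ b = q * q * (r ^ (a mod 2) * (1 - r) ^ (b mod 2))"
    proof -
      have split: "x ^ n = x ^ (n div 2) * x ^ (n div 2) * x ^ (n mod 2)" for x :: "real poly" and n
        by (simp flip: power_add mult_2)
      show ?thesis
        unfolding q_def split[of r a] split[of "1 - r" b] by (simp only: mult_ac)
    qed
    moreover have "pos (r ^ (a mod 2) * (1 - r) ^ (b mod 2))"
      using pos_1 pos_r pos_r' pos_rr' mod_2_eq_odd[of a] mod_2_eq_odd[of b] by (simp add: of_bool_def)
    ultimately show ?thesis using pos_square by simp
  qed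
  define L where "L p = (1 / (norm f)\<^sup>2) * moment_functional T f (pcompose p r)" for p
  have "\<exists>\<mu>. represents \<mu> L"
  proof (rule hausdorff_moment_problem)
    show "L (p + q) = L p + L q" for p q
      by (simp add: L_def moment_functional_def pcompose_add poly_op_simps inner_add_right add_divide_distrib)
    show "L (smult c p) = c * L p" for c p
      by (simp add: L_def moment_functional_def pcompose_smult poly_op_simps)
    show "L 1 = 1"
      using False by (simp add: L_def moment_functional_def poly_op_simps dot_square_norm pcompose_1)
    show "0 \<le> L ([:0, 1:] ^ a * [:1, -1:] ^ b)" for a b
    proof -
      have pc: "pcompose (x ^ n) r = pcompose x r ^ n" for x n
        by (induction n) (auto simp: pcompose_mult pcompose_1)
      have "pcompose ([:0, 1:] ^ a * [:1, -1:] ^ b) r = r ^ a * (1 - r) ^ b"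
        by (simp add: pcompose_mult pc pcompose_pCons one_pCons)
      then show ?thesis
        using pos_pow unfolding L_def moment_functional_def pos_def by simp
    qed
  qed
  then obtain \<mu> where \<mu>: "represents \<mu> L" by blast
  define \<nu> where "\<nu> = distr \<mu> borel (\<lambda>t. poly [:-M, 2 * M:] t)"
  have \<nu>: "represents \<nu> (\<lambda>p. L (pcompose p [:-M, 2 * M:]))"
    unfolding \<nu>_def
  proof (rule represents_distr[OF \<mu>])
    show "has_bochner_integral \<mu> (\<lambda>t. poly p (poly [:-M, 2 * M:] t)) (L (pcompose p [:-M, 2 * M:]))" for p
      by (rule represents_has_integral[OF \<mu>]) (simp add: poly_pcompose)
  qed measurable
  have "pcompose [:-M, 2 * M:] r = [:0, 1:]"
    using M by (simp add: r_def pcompose_pCons)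
  then have "(norm f)\<^sup>2 * L (pcompose p [:-M, 2 * M:]) = moment_functional T f p" for p
    using False by (simp add: L_def pcompose_assoc[symmetric] pcompose_idR)
  then have "represents (density \<nu> (\<lambda>_. ennreal ((norm f)\<^sup>2))) (moment_functional T f)"
    using represents_density_const[OF \<nu>, of "(norm f)\<^sup>2"] by simp
  then show ?thesis by blast
qed

lemma representing_measure_density:
  assumes "represents \<mu> (moment_functional T f)" "represents \<nu> (moment_functional T g)"
    and "\<And>t. poly Q t \<ge> 0" "\<And>p. moment_functional T g p = moment_functional T f (Q * p)"
  shows "\<nu> = density \<mu> (poly Q)"
proof (rule representing_measure_unique)
  show "represents (density \<mu> (\<lambda>x. ennreal (poly Q x))) (moment_functional T g)"
    using represents_density[OF assms(1,3)] unfolding assms(4)[symmetric] .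
qed (fact assms)

text \<open>By the parallelogram law, the left hand side plus the measure of \<open>f - g\<close> equals the right
  hand side.\<close>
lemma representing_measure_add_le:
  assumes f: "represents \<mu> (moment_functional T f)" and g: "represents \<nu> (moment_functional T g)"
    and fg: "represents \<sigma> (moment_functional T (f + g))" and "X \<in> sets borel"
  shows "emeasure \<sigma> X \<le> 2 * emeasure \<mu> X + 2 * emeasure \<nu> X"
proof -
  obtain \<tau> where \<tau>: "represents \<tau> (moment_functional T (f - g))"
    using ex_representing_measure by blast
  note s = represents_sets[OF f] represents_sets[OF g] represents_sets[OF fg] represents_sets[OF \<tau>]
  have "sum_measures \<sigma> \<tau> = sum_measures (sum_measures \<mu> \<mu>) (sum_measures \<nu> \<nu>)"
  proof (rule represents_unique)
    show "represents (sum_measures \<sigma> \<tau>)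
        (\<lambda>p. moment_functional T (f + g) p + moment_functional T (f - g) p)"
      by (rule represents_sum_measures[OF fg \<tau>])
    show "represents (sum_measures (sum_measures \<mu> \<mu>) (sum_measures \<nu> \<nu>))
        (\<lambda>p. moment_functional T (f + g) p + moment_functional T (f - g) p)"
      unfolding moment_functional_parallelogram
      by (rule represents_sum_measures[OF represents_sum_measures[OF f f] represents_sum_measures[OF g g]])
    show "moment_functional T (f + g) (monom 1 (2 * k)) + moment_functional T (f - g) (monom 1 (2 * k))
        \<le> ((norm (f + g))\<^sup>2 + (norm (f - g))\<^sup>2) * onorm T ^ (2 * k)" for k
      unfolding distrib_right by (intro add_mono moment_functional_even_bound)
  qed
  then have "emeasure \<sigma> X + emeasure \<tau> X
      = (emeasure \<mu> X + emeasure \<mu> X) + (emeasure \<nu> X + emeasure \<nu> X)"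
    using assms(4) s by (metis emeasure_sum_measures sets_sum_measures)
  then have "emeasure \<sigma> X + emeasure \<tau> X = 2 * emeasure \<mu> X + 2 * emeasure \<nu> X"
    by (simp add: mult_2)
  then show ?thesis by (metis le_iff_add)
qed

end

section \<open>The Hilbert space of square summable sequences\<close>

lemmas coord_simps [simp] = zero_ell2.rep_eq plus_ell2.rep_eq uminus_ell2.rep_eq minus_ell2.rep_eq
  scaleC_ell2.rep_eq basis_ell2.rep_eq

lemma coord_scaleR [simp]: "coord (r *\<^sub>R f) n = complex_of_real r * coord f n"
  by (simp add: scaleR_ell2_def)

lemma coord_sum [simp]: "coord (sum F S) n = (\<Sum>i\<in>S. coord (F i) n)"
  by (induction S rule: infinite_finite_induct) auto

lemma ell2_eqI: "(\<And>n. coord f n = coord g n) \<Longrightarrow> f = g"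
  by (simp add: fun_eq_iff flip: coord_inject)

lemma power2_norm_ell2: "(norm f)\<^sup>2 = (\<Sum>\<^sub>\<infinity>n. (cmod (coord f n))\<^sup>2)"
  unfolding norm_ell2_def by (simp add: infsum_nonneg)

lemma norm_ell2_le_infsum: "finite F \<Longrightarrow> (\<Sum>n\<in>F. (cmod (coord f n))\<^sup>2) \<le> (norm f)\<^sup>2"
  unfolding power2_norm_ell2 by (rule finite_sum_le_infsum) (auto simp: coord_sq_summable)

lemma norm_coord_le: "cmod (coord f n) \<le> norm f"
  using norm_ell2_le_infsum[of "{n}" f] by (simp add: power2_le_iff_abs_le)

lemma scaleC_simps [simp]:
  "0 *\<^sub>C f = 0" "1 *\<^sub>C f = f" "(- 1) *\<^sub>C f = - f" "c *\<^sub>C 0 = 0" "a *\<^sub>C b *\<^sub>C f = (a * b) *\<^sub>C f"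
  by (auto intro: ell2_eqI)

lemma scaleC_add_right: "c *\<^sub>C (f + g) = c *\<^sub>C f + c *\<^sub>C g"
  and scaleC_add_left: "(c + d) *\<^sub>C f = c *\<^sub>C f + d *\<^sub>C f"
  and scaleC_diff_right: "c *\<^sub>C (f - g) = c *\<^sub>C f - c *\<^sub>C g"
  and scaleC_diff_left: "(c - d) *\<^sub>C f = c *\<^sub>C f - d *\<^sub>C f"
  and scaleC_scaleR: "c *\<^sub>C (r *\<^sub>R f) = r *\<^sub>R (c *\<^sub>C f)"
  and scaleC_of_real: "complex_of_real r *\<^sub>C f = r *\<^sub>R f"
  and scaleC_minus_left: "(- c) *\<^sub>C f = - (c *\<^sub>C f)"
  by (auto intro!: ell2_eqI simp: algebra_simps)

lemma scaleC_sum_right: "c *\<^sub>C sum F S = (\<Sum>i\<in>S. c *\<^sub>C F i)"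
  by (induction S rule: infinite_finite_induct) (auto simp: scaleC_add_right)

lemma scaleC_sum_left: "sum c S *\<^sub>C f = (\<Sum>i\<in>S. c i *\<^sub>C f)"
  by (induction S rule: infinite_finite_induct) (auto simp: scaleC_add_left)

lemma norm_scaleC [simp]: "norm (c *\<^sub>C f) = cmod c * norm f"
  unfolding norm_ell2_def
  by (simp add: norm_mult power_mult_distrib infsum_cmult_right' real_sqrt_mult)

lemma bounded_linear_scaleC: "bounded_linear (\<lambda>f. c *\<^sub>C f)"
  by (rule bounded_linear_intro[of _ "cmod c"]) (auto simp: scaleC_add_right scaleC_scaleR mult.commute)

lemma cinner_scaleC_right: "cinner f (c *\<^sub>C g) = c * cinner f g"
  unfolding cinner.rep_eq by (simp add: mult.left_commute infsum_cmult_right')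

lemma cinner_scaleC_left: "cinner (c *\<^sub>C f) g = cnj c * cinner f g"
  unfolding cinner.rep_eq by (simp add: mult.assoc infsum_cmult_right')

lemma inner_ii: "inner (\<i> *\<^sub>C f) (\<i> *\<^sub>C g) = inner f g"
  and inner_ii_skew: "inner (\<i> *\<^sub>C f) g = - inner f (\<i> *\<^sub>C g)"
  by (simp_all add: inner_ell2_def cinner_scaleC_left cinner_scaleC_right)

lemma Im_cinner: "Im (cinner f g) = - inner f (\<i> *\<^sub>C g)"
  by (simp add: inner_ell2_def cinner_scaleC_right)

lemma ell2_of_bounded_partial_sums:
  assumes "\<And>F. finite F \<Longrightarrow> (\<Sum>n\<in>F. (cmod (f n))\<^sup>2) \<le> B\<^sup>2" "B \<ge> 0"
  shows "\<exists>g. coord g = f \<and> norm g \<le> B"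
proof -
  have s: "(\<lambda>n. (cmod (f n))\<^sup>2) summable_on UNIV"
    by (rule nonneg_bdd_above_summable_on) (auto intro!: bdd_aboveI[of _ "B\<^sup>2"] assms)
  then have c: "coord (Abs_ell2 f) = f" by (simp add: Abs_ell2_inverse)
  have "(norm (Abs_ell2 f))\<^sup>2 \<le> B\<^sup>2"
    unfolding power2_norm_ell2 c using s assms by (intro infsum_le_finite_sums) auto
  with c show ?thesis using assms(2) by (auto simp: power2_le_iff_abs_le)
qed

text \<open>Completeness is what the fixed point argument in \<open>coercive_surj\<close> rests
  on.\<close>

instance ell2 :: banach
proof
  fix X :: "nat \<Rightarrow> ell2" assume X: "Cauchy X"
  have "Cauchy (\<lambda>k. coord (X k) n)" for n
  proof (rule CauchyI)
    fix e :: real assume "e > 0"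
    then obtain N where "\<And>k l. k \<ge> N \<Longrightarrow> l \<ge> N \<Longrightarrow> norm (X k - X l) < e"
      using CauchyD[OF X] by blast
    then show "\<exists>N. \<forall>k\<ge>N. \<forall>l\<ge>N. norm (coord (X k) n - coord (X l) n) < e"
      using norm_coord_le[of "X k - X l" n for k l] by (metis minus_ell2.rep_eq order_le_less_trans)
  qed
  then have "\<forall>n. \<exists>l. (\<lambda>k. coord (X k) n) \<longlonglongrightarrow> l"
    unfolding Cauchy_convergent_iff convergent_def by blast
  then obtain c where c: "\<And>n. (\<lambda>k. coord (X k) n) \<longlonglongrightarrow> c n"
    unfolding choice_iff by blast
  \<comment> \<open>On finitely many coordinates the Cauchy bound survives the coordinatewise limit.
    Hence c minus X k is itself square summable with small norm, and so c is square summable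
    too.\<close>
  have close: "\<exists>N. \<forall>k\<ge>N. \<exists>d. coord d = (\<lambda>n. c n - coord (X k) n) \<and> norm d \<le> e" if "e > 0" for e
  proof -
    obtain N where N: "\<And>k l. k \<ge> N \<Longrightarrow> l \<ge> N \<Longrightarrow> norm (X k - X l) < e"
      using CauchyD[OF X \<open>e > 0\<close>] by blast
    show ?thesis
    proof (intro exI[of _ N] allI impI ell2_of_bounded_partial_sums)
      fix k and F :: "int set" assume k: "k \<ge> N" and F: "finite F"
      show "(\<Sum>n\<in>F. (cmod (c n - coord (X k) n))\<^sup>2) \<le> e\<^sup>2"
      proof (rule LIMSEQ_le_const2)
        show "(\<lambda>l. \<Sum>n\<in>F. (cmod (coord (X l) n - coord (X k) n))\<^sup>2)
            \<longlonglongrightarrow> (\<Sum>n\<in>F. (cmod (c n - coord (X k) n))\<^sup>2)"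
          by (intro tendsto_intros c)
        have "(\<Sum>n\<in>F. (cmod (coord (X l) n - coord (X k) n))\<^sup>2) \<le> e\<^sup>2" if "l \<ge> N" for l
          using norm_ell2_le_infsum[OF F, of "X l - X k"] power_mono[of "norm (X l - X k)" e 2] N[OF that k]
          by simp
        then show "\<exists>M. \<forall>l\<ge>M. (\<Sum>n\<in>F. (cmod (coord (X l) n - coord (X k) n))\<^sup>2) \<le> e\<^sup>2" by blast
      qed
    qed (use that in auto)
  qed
  obtain k d where "coord d = (\<lambda>n. c n - coord (X k) n)"
    using close[of 1] by auto
  then have Y: "coord (X k + d) = c" by (simp add: fun_eq_iff)
  define Y where "Y = X k + d"
  have "X \<longlonglongrightarrow> Y"
  proof (rule LIMSEQ_I)
    fix e :: real assume "e > 0"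
    then obtain N where N: "\<And>k. k \<ge> N \<Longrightarrow> \<exists>d. coord d = (\<lambda>n. c n - coord (X k) n) \<and> norm d \<le> e / 2"
      using close[of "e / 2"] by auto
    have "norm (X k - Y) < e" if "k \<ge> N" for k
    proof -
      obtain d where d: "coord d = (\<lambda>n. c n - coord (X k) n)" "norm d \<le> e / 2" using N[OF \<open>k \<ge> N\<close>] by blast
      have "d = Y - X k" by (rule ell2_eqI) (simp add: d Y_def Y[simplified fun_eq_iff, simplified])
      then show ?thesis using d \<open>e > 0\<close> by (simp add: norm_minus_commute)
    qed
    then show "\<exists>N. \<forall>k\<ge>N. norm (X k - Y) < e" by blast
  qed
  then show "convergent X" by (auto simp: convergent_def)
qed

lemma ell2_finite_approx:
  assumes "e > 0"
  shows "\<exists>F. finite F \<and> norm (f - (\<Sum>n\<in>F. coord f n *\<^sub>C basis_ell2 n)) < e"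
proof -
  have "((\<lambda>n. (cmod (coord f n))\<^sup>2) has_sum (norm f)\<^sup>2) UNIV"
    unfolding power2_norm_ell2 by (rule has_sum_infsum[OF coord_sq_summable])
  then have "\<forall>\<^sub>F F in finite_subsets_at_top UNIV. dist (\<Sum>n\<in>F. (cmod (coord f n))\<^sup>2) ((norm f)\<^sup>2) < e\<^sup>2"
    unfolding has_sum_def by (rule tendstoD) (use assms in simp)
  then obtain F where F: "finite F" "dist (\<Sum>n\<in>F. (cmod (coord f n))\<^sup>2) ((norm f)\<^sup>2) < e\<^sup>2"
    by (auto simp: eventually_finite_subsets_at_top)
  define g where "g = f - (\<Sum>n\<in>F. coord f n *\<^sub>C basis_ell2 n)"
  have g: "coord g n = (if n \<in> F then 0 else coord f n)" for n
    using F(1) by (simp add: g_def if_distrib[of "(*) _"] sum.delta cong: if_cong)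
  have "(norm g)\<^sup>2 = (\<Sum>\<^sub>\<infinity>n\<in>UNIV - F. (cmod (coord f n))\<^sup>2)"
    unfolding power2_norm_ell2 by (rule infsum_cong_neutral) (auto simp: g)
  also have "\<dots> = (norm f)\<^sup>2 - (\<Sum>n\<in>F. (cmod (coord f n))\<^sup>2)"
    unfolding power2_norm_ell2 using F(1) by (subst infsum_Diff) (auto simp: coord_sq_summable)
  also have "\<dots> < e\<^sup>2" using F(2) by (simp add: dist_real_def)
  finally have "norm g < e" using assms by (simp add: power2_less_imp_less)
  then show ?thesis using F(1) unfolding g_def by blast
qed

text \<open>\<open>bounded_linear\<close> means real linear, so agreement is asked on all complex
  multiples of basis vectors. The general codomain admits real functionals such as inner
  products.\<close>

lemma bounded_linear_eq_on_basis:
  fixes S T :: "ell2 \<Rightarrow> 'b::real_normed_vector"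
  assumes S: "bounded_linear S" and T: "bounded_linear T"
    and eq: "\<And>c n. S (c *\<^sub>C basis_ell2 n) = T (c *\<^sub>C basis_ell2 n)"
  shows "S f = T f"
proof -
  define D where "D = (\<lambda>f. S f - T f)"
  have D: "bounded_linear D" unfolding D_def by (rule bounded_linear_sub[OF S T])
  have D0: "D (\<Sum>n\<in>F. coord f n *\<^sub>C basis_ell2 n) = 0" for F
    using eq by (simp add: D_def linear_sum[OF bounded_linear.linear[OF S]] linear_sum[OF bounded_linear.linear[OF T]])
  have le: "norm (D f) \<le> e" if "e > 0" for e
  proof -
    have K: "onorm D + 1 > 0" using onorm_pos_le[OF D] by simp
    then obtain F where F: "norm (f - (\<Sum>n\<in>F. coord f n *\<^sub>C basis_ell2 n)) < e / (onorm D + 1)"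
      using ell2_finite_approx[OF divide_pos_pos[OF \<open>0 < e\<close> K]] by blast
    have "norm (D f) = norm (D (f - (\<Sum>n\<in>F. coord f n *\<^sub>C basis_ell2 n)))"
      using D0 by (simp add: linear_diff[OF bounded_linear.linear[OF D]])
    also have "\<dots> \<le> onorm D * norm (f - (\<Sum>n\<in>F. coord f n *\<^sub>C basis_ell2 n))"
      by (rule onorm[OF D])
    also have "\<dots> \<le> (onorm D + 1) * (e / (onorm D + 1))"
      using F K onorm_pos_le[OF D] by (intro mult_mono) auto
    finally show ?thesis using K by simp
  qed
  then have "norm (D f) \<le> 0" by (rule field_le_epsilon[of _ 0, simplified])
  then show ?thesis by (simp add: D_def)
qed

lift_definition translate :: "int \<Rightarrow> ell2 \<Rightarrow> ell2" is "\<lambda>k f n. f (n - k)"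
proof -
  fix k and f :: "int \<Rightarrow> complex"
  assume "(\<lambda>n. (cmod (f n))\<^sup>2) summable_on UNIV"
  moreover have "bij_betw (\<lambda>n::int. n - k) UNIV UNIV"
    by (rule bij_betw_byWitness[of _ "\<lambda>n. n + k"]) auto
  ultimately show "(\<lambda>n. (cmod (f (n - k)))\<^sup>2) summable_on UNIV"
    by (subst summable_on_reindex_bij_betw[where f = "\<lambda>n. (cmod (f n))\<^sup>2"])
qed

lemma norm_translate [simp]: "norm (translate k f) = norm f"
proof -
  have "bij_betw (\<lambda>n::int. n - k) UNIV UNIV"
    by (rule bij_betw_byWitness[of _ "\<lambda>n. n + k"]) auto
  then show ?thesis
    unfolding norm_ell2_def translate.rep_eq
    by (subst infsum_reindex_bij_betw[where f = "\<lambda>n. (cmod (coord f n))\<^sup>2"]) auto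
qed

lemma translate_simps [simp]:
  "translate k (translate l f) = translate (k + l) f" "translate 0 f = f"
  "translate k (basis_ell2 n) = basis_ell2 (n + k)"
  by (auto intro!: ell2_eqI simp: translate.rep_eq algebra_simps)

lemma translate_linear:
  "translate k (f + g) = translate k f + translate k g"
  "translate k (f - g) = translate k f - translate k g"
  "translate k (c *\<^sub>C f) = c *\<^sub>C translate k f"
  "translate k (r *\<^sub>R f) = r *\<^sub>R translate k f"
  "translate k 0 = 0"
  by (auto intro!: ell2_eqI simp: translate.rep_eq)

lemma bounded_linear_translate: "bounded_linear (translate k)"
  by (rule bounded_linear_intro[of _ 1]) (auto simp: translate_linear)

section \<open>Coercive operators and resolvents of self-adjoint operators\<close>

lemma coercive_bounded_below:
  fixes L :: "'a::real_inner \<Rightarrow> 'a"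
  assumes "d * (norm h)\<^sup>2 \<le> inner (L h) h"
  shows "d * norm h \<le> norm (L h)"
proof (cases "h = 0")
  case False
  have "d * norm h * norm h \<le> norm (L h) * norm h"
    using assms norm_cauchy_schwarz[of "L h" h] by (simp add: power2_eq_square mult.assoc)
  with False show ?thesis by simp
qed simp

text \<open>The Lax-Milgram argument: solutions of L x = f are the fixed points of x -> x - r (L x -
  f), which is a contraction for suitable r > 0.\<close>

lemma coercive_surj:
  fixes L :: "'a::{real_inner, complete_space} \<Rightarrow> 'a"
  assumes L: "bounded_linear L" and d: "d > 0" and coercive: "\<And>h. d * (norm h)\<^sup>2 \<le> inner (L h) h"
  shows "surj L"
  unfolding surj_def
proof
  fix f
  \<comment> \<open>The summand d ensures K >= d > 0, so that the root defining c is taken of a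
    nonnegative number.\<close>
  define K where "K = onorm L + d"
  have K: "K > 0" "K \<ge> d" using onorm_pos_le[OF L] d by (auto simp: K_def)
  have LK: "norm (L h) \<le> K * norm h" for h
    using onorm[OF L, of h] mult_right_mono[of "onorm L" K "norm h"] d by (auto simp: K_def)
  \<comment> \<open>This r minimises 1 - 2rd + r^2 K^2, the bound for the squared contraction
    factor; the minimum is 1 - d^2/K^2.\<close>
  define r where "r = d / K\<^sup>2"
  define c where "c = sqrt (1 - d\<^sup>2 / K\<^sup>2)"
  have dK: "d\<^sup>2 / K\<^sup>2 \<le> 1" "d\<^sup>2 / K\<^sup>2 > 0" using K d by (auto simp: power_mono)
  have c: "0 \<le> c" "c < 1" "c\<^sup>2 = 1 - d\<^sup>2 / K\<^sup>2" using dK by (auto simp: c_def)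
  have contract: "norm (x - r *\<^sub>R L x) \<le> c * norm x" for x
  proof (rule power2_le_imp_le)
    have "(norm (x - r *\<^sub>R L x))\<^sup>2 = (norm x)\<^sup>2 - 2 * r * inner (L x) x + r\<^sup>2 * (norm (L x))\<^sup>2"
      unfolding power2_norm_eq_inner
      by (simp add: inner_diff_left inner_diff_right inner_commute power2_eq_square algebra_simps)
    also have "\<dots> \<le> (norm x)\<^sup>2 - 2 * r * (d * (norm x)\<^sup>2) + r\<^sup>2 * (K * norm x)\<^sup>2"
      using coercive[of x] LK[of x] K d
      by (intro add_mono diff_mono mult_left_mono power_mono) (auto simp: r_def)
    also have "\<dots> = (c * norm x)\<^sup>2"
      unfolding power_mult_distrib c(3) using K by (simp add: r_def power2_eq_square field_simps)
    finally show "(norm (x - r *\<^sub>R L x))\<^sup>2 \<le> (c * norm x)\<^sup>2" .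
  qed (use c in auto)
  have "dist (x - r *\<^sub>R (L x - f)) (y - r *\<^sub>R (L y - f)) \<le> c * dist x y" for x y
    using contract[of "x - y"]
    by (simp add: dist_norm linear_diff[OF bounded_linear.linear[OF L]] algebra_simps)
  then obtain x where "x - r *\<^sub>R (L x - f) = x"
    using banach_fix_type[OF c(1,2), of "\<lambda>x. x - r *\<^sub>R (L x - f)"] by blast
  moreover have "r \<noteq> 0" using K d by (simp add: r_def)
  ultimately have "f = L x" by simp
  then show "\<exists>x. f = L x" by blast
qed

lemma invertible_on_UNIV_I:
  assumes T: "linear T" and "surj T" and "K > 0" and "\<And>h. K * norm h \<le> norm (T h)"
  shows "invertible_on UNIV T"
  unfolding invertible_on_def
proof
  have "T h = 0 \<Longrightarrow> h = 0" for h using assms(3) assms(4)[of h] by (simp add: mult_le_0_iff)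
  then have "inj T" by (simp add: linear_injective_0[OF T])
  with \<open>surj T\<close> show "bij T" by (simp add: bij_def)
  show "\<exists>K. \<forall>f\<in>UNIV. norm f \<le> K * norm (T f)"
    using assms(3,4) by (intro exI[of _ "1 / K"]) (simp add: field_simps)
qed

text \<open>Symmetry for \<open>Re cinner\<close> together with complex linearity amounts to
  symmetry for \<open>cinner\<close>, as the imaginary part of \<open>cinner f g\<close> is minus
  the real inner product of f and i g.\<close>

locale selfadjoint_operator = symmetric_operator T for T :: "ell2 \<Rightarrow> ell2" +
  assumes scaleC: "T (c *\<^sub>C f) = c *\<^sub>C T f"
begin

lemma poly_op_scaleC: "poly_op T p (c *\<^sub>C f) = c *\<^sub>C poly_op T p f"
  by (rule poly_op_commute[OF lin bounded_linear.linear[OF bounded_linear_scaleC], symmetric]) (simp add: scaleC)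

text \<open>This expresses that <h, p(T) h> is a real number.\<close>

lemma inner_poly_op_ii: "inner (poly_op T p h) (\<i> *\<^sub>C h) = 0"
proof -
  have "inner (poly_op T p h) (\<i> *\<^sub>C h) = - inner (\<i> *\<^sub>C h) (poly_op T p h)"
    unfolding poly_op_symmetric poly_op_scaleC inner_ii_skew by simp
  then show ?thesis by (simp add: inner_commute)
qed

text \<open>The factor s, which is i or -i, rotates T - z: the form of T - Re z is real and drops
  out, and |Im z| times the squared norm remains. This makes \<open>coercive_surj\<close> applicable
  to nonreal z.\<close>

lemma resolvent_coercive:
  assumes "Im z \<noteq> 0"
  defines "s \<equiv> complex_of_real (sgn (Im z)) * \<i>"
  shows "\<bar>Im z\<bar> * (norm h)\<^sup>2 \<le> inner (s *\<^sub>C (T h - z *\<^sub>C h)) h"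
proof -
  have z: "z *\<^sub>C h = Re z *\<^sub>R h + Im z *\<^sub>R (\<i> *\<^sub>C h)"
    by (rule ell2_eqI) (simp add: complex_eq_iff)
  have "inner (T h) (\<i> *\<^sub>C h) = 0"
    using inner_poly_op_ii[of "[:0, 1:]" h] linear_0[OF lin] by (simp add: poly_op_simps)
  moreover have "inner h (\<i> *\<^sub>C h) = 0"
    using inner_poly_op_ii[of 1 h] by (simp add: poly_op_simps)
  ultimately have "inner (\<i> *\<^sub>C (T h - z *\<^sub>C h)) h = Im z * (norm h)\<^sup>2"
    by (simp add: inner_ii_skew z inner_diff_left inner_add_left inner_ii power2_norm_eq_inner)
  moreover have "inner (s *\<^sub>C g) h = sgn (Im z) * inner (\<i> *\<^sub>C g) h" for g
    by (simp add: s_def scaleC_of_real flip: scaleC_simps(5) inner_scaleR_left)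
  ultimately show ?thesis by (simp add: abs_sgn mult_ac)
qed

lemma resolvent_norm_ge:
  assumes "Im z \<noteq> 0"
  shows "\<bar>Im z\<bar> * norm h \<le> norm (T h - z *\<^sub>C h)"
proof -
  have "\<bar>Im z\<bar> * norm h \<le> norm ((complex_of_real (sgn (Im z)) * \<i>) *\<^sub>C (T h - z *\<^sub>C h))"
    by (rule coercive_bounded_below) (rule resolvent_coercive[OF assms])
  then show ?thesis using assms by (simp add: norm_mult sgn_real_def split: if_splits)
qed

lemma resolvent_bounded_linear: "bounded_linear (\<lambda>h. T h - z *\<^sub>C h)"
  by (intro bounded_linear_sub bounded bounded_linear_scaleC)

lemma resolvent_bij:
  assumes "Im z \<noteq> 0"
  shows "bij (\<lambda>h. T h - z *\<^sub>C h)"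
proof -
  define s where "s = complex_of_real (sgn (Im z)) * \<i>"
  have s: "s * s = -1" using assms by (simp add: s_def sgn_real_def)
  have "surj (\<lambda>h. s *\<^sub>C (T h - z *\<^sub>C h))"
    by (rule coercive_surj[OF bounded_linear_compose[OF bounded_linear_scaleC resolvent_bounded_linear]])
       (use assms resolvent_coercive in \<open>auto simp: s_def\<close>)
  then have "\<exists>h. T h - z *\<^sub>C h = f" for f
  proof -
    obtain h where "s *\<^sub>C f = s *\<^sub>C (T h - z *\<^sub>C h)" using \<open>surj _\<close> unfolding surj_def by blast
    from arg_cong[OF this, of "\<lambda>g. (- s) *\<^sub>C g"] show ?thesis
      using s by (auto simp: scaleC_minus_left)
  qed
  then have "surj (\<lambda>h. T h - z *\<^sub>C h)" unfolding surj_def by metis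
  moreover have "inj (\<lambda>h. T h - z *\<^sub>C h)"
    unfolding linear_injective_0[OF bounded_linear.linear[OF resolvent_bounded_linear]]
  proof (intro allI impI)
    fix h assume "T h - z *\<^sub>C h = 0"
    then show "h = 0" using resolvent_norm_ge[OF assms, of h] assms by (simp add: mult_le_0_iff)
  qed
  ultimately show ?thesis by (simp add: bij_def)
qed

lemma nonreal_invertible:
  assumes "Im z \<noteq> 0"
  shows "invertible_on UNIV (\<lambda>f. z *\<^sub>C f - T f)"
proof (rule invertible_on_UNIV_I)
  show "linear (\<lambda>f. z *\<^sub>C f - T f)"
    by (intro linear_compose_sub lin bounded_linear.linear[OF bounded_linear_scaleC])
  show "surj (\<lambda>f. z *\<^sub>C f - T f)"
    unfolding surj_def
  proof
    fix f
    obtain h where "- f = T h - z *\<^sub>C h"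
      using bij_is_surj[OF resolvent_bij[OF assms]] unfolding surj_def by blast
    then have "- (- f) = z *\<^sub>C h - T h" by (simp only: minus_diff_eq)
    then have "f = z *\<^sub>C h - T h" by simp
    then show "\<exists>h. f = z *\<^sub>C h - T h" by blast
  qed
  show "\<bar>Im z\<bar> * norm h \<le> norm (z *\<^sub>C h - T h)" for h
    using resolvent_norm_ge[OF assms, of h] by (simp add: norm_minus_commute)
qed (use assms in auto)

text \<open>With h the resolvent applied to f, the measure of f = (T - z) h is |t - z|^2 times that
  of h. This cancels 1/(t - z) and leaves the integral of t minus the conjugate of z, a polynomial
  in t, which the moments of h evaluate.\<close>

lemma representing_measure_spectral:
  assumes \<mu>: "represents \<mu> (moment_functional T f)"
  shows "is_spectral_measure T f \<mu>"
  unfolding is_spectral_measure_def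
proof (intro conjI allI impI)
  show "sets \<mu> = sets borel" by (rule represents_sets[OF \<mu>])
  show "finite_measure \<mu>" by (rule represents_finite_measure[OF \<mu>])
  fix z assume z: "Im z \<noteq> 0"
  define h where "h = inv (\<lambda>h. T h - z *\<^sub>C h) f"
  have h: "T h - z *\<^sub>C h = f"
    unfolding h_def using bij_is_surj[OF resolvent_bij[OF z]] by (rule surj_f_inv_f)
  define q where "q = [:- Re z, 1:]"
  define u where "u = poly_op T q h"
  have f: "f = u - Im z *\<^sub>R (\<i> *\<^sub>C h)"
    unfolding h[symmetric] u_def q_def
    by (rule ell2_eqI) (simp add: poly_op_simps linear_0[OF lin] complex_eq_iff)
  obtain \<nu> where \<nu>: "represents \<nu> (moment_functional T h)" using ex_representing_measure by blast
  \<comment> \<open>Q(t) = |t - z|^2 for real t.\<close>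
  define Q where "Q = q * q + [:(Im z)\<^sup>2:]"
  have Q: "poly Q t = (t - Re z)\<^sup>2 + (Im z)\<^sup>2" for t
    by (simp add: Q_def q_def power2_eq_square algebra_simps)
  have Q_pos: "poly Q t > 0" for t unfolding Q using z by (simp add: add_nonneg_pos)
  have "\<mu> = density \<nu> (poly Q)"
  proof (rule representing_measure_density[OF \<nu> \<mu>])
    fix p
    have "inner (poly_op T p u) (\<i> *\<^sub>C h) = 0"
      using inner_poly_op_ii[of "p * q" h] by (simp add: u_def poly_op_mult[OF lin])
    then have cross: "inner u (poly_op T p (\<i> *\<^sub>C h)) = 0" "inner (\<i> *\<^sub>C h) (poly_op T p u) = 0"
      by (simp_all add: poly_op_symmetric inner_commute[of "\<i> *\<^sub>C h"])
    have "moment_functional T f p = inner u (poly_op T p u) + (Im z)\<^sup>2 * inner h (poly_op T p h)"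
      unfolding moment_functional_def f
      using cross by (simp add: linear_diff[OF linear_poly_op[OF lin]] linear_scale[OF linear_poly_op[OF lin]]
          inner_diff_left inner_diff_right poly_op_scaleC inner_ii power2_eq_square)
    also have "\<dots> = moment_functional T h (Q * p)"
      using moment_functional_poly_op[of q h p] linear_0[OF lin]
      by (simp add: u_def Q_def moment_functional_def distrib_right poly_op_simps inner_add_right)
    finally show "moment_functional T f p = moment_functional T h (Q * p)" .
  qed (simp add: less_imp_le Q_pos)
  note [measurable_cong] = represents_sets[OF \<nu>]
  have "(\<integral>t. 1 / (complex_of_real t - z) \<partial>\<mu>) = (\<integral>t. poly Q t *\<^sub>R (1 / (complex_of_real t - z)) \<partial>\<nu>)"
    unfolding \<open>\<mu> = _\<close> by (rule integral_density) (auto simp: less_imp_le Q_pos)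
  also have "\<dots> = (\<integral>t. complex_of_real (poly q t) + \<i> * complex_of_real (poly [:Im z:] t) \<partial>\<nu>)"
  proof (rule Bochner_Integration.integral_cong)
    fix t
    have "complex_of_real t - z \<noteq> 0" using z by (auto simp: complex_eq_iff)
    moreover have "complex_of_real (poly Q t)
        = (complex_of_real (poly q t) + \<i> * complex_of_real (poly [:Im z:] t)) * (complex_of_real t - z)"
      by (simp add: Q q_def complex_eq_iff power2_eq_square algebra_simps)
    ultimately show "poly Q t *\<^sub>R (1 / (complex_of_real t - z))
        = complex_of_real (poly q t) + \<i> * complex_of_real (poly [:Im z:] t)"
      by (simp add: scaleR_conv_of_real field_simps)
  qed simp
  also have "\<dots> = complex_of_real (moment_functional T h q) + \<i> * complex_of_real (moment_functional T h [:Im z:])"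
    by (intro has_bochner_integral_integral_eq has_bochner_integral_add has_bochner_integral_mult_right
        has_bochner_integral_bounded_linear[OF bounded_linear_of_real] represents_integral[OF \<nu>])
  also have "\<dots> = cinner f h"
  proof -
    have "inner u (\<i> *\<^sub>C h) = 0" "inner h (\<i> *\<^sub>C h) = 0"
      using inner_poly_op_ii[of q h] inner_poly_op_ii[of 1 h] by (simp_all add: u_def poly_op_simps)
    then have "Re (cinner f h) = moment_functional T h q" "Im (cinner f h) = moment_functional T h [:Im z:]"
      unfolding Im_cinner inner_ell2_def[symmetric] f moment_functional_def u_def
      using linear_0[OF lin]
      by (simp_all add: inner_diff_left inner_ii inner_ii_skew poly_op_simps poly_op_symmetric u_def)
    then show ?thesis by (simp add: complex_eq_iff)
  qed
  finally show "cinner f (inv (\<lambda>h. T h - z *\<^sub>C h) f) = (\<integral>t. 1 / (complex_of_real t - z) \<partial>\<mu>)"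
    unfolding h_def by simp
qed

end

section \<open>The magic formula\<close>

lemma cinner_basis: "cinner f (basis_ell2 n) = cnj (coord f n)"
proof -
  have "cinner f (basis_ell2 n) = (\<Sum>\<^sub>\<infinity>m\<in>{n}. cnj (coord f m) * coord (basis_ell2 n) m)"
    unfolding cinner.rep_eq by (rule infsum_cong_neutral) auto
  then show ?thesis by simp
qed

lemma inner_scaleC_basis: "inner f (d *\<^sub>C basis_ell2 n) = Re (cnj (coord f n) * d)"
  by (simp add: inner_ell2_def cinner_scaleC_right cinner_basis mult.commute)

lemma symmetric_on_basisI:
  fixes T :: "ell2 \<Rightarrow> ell2"
  assumes T: "bounded_linear T" and scaleC: "\<And>c f. T (c *\<^sub>C f) = c *\<^sub>C T f"
    and entries: "\<And>m n. coord (T (basis_ell2 m)) n = cnj (coord (T (basis_ell2 n)) m)"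
  shows "inner (T f) g = inner f (T g)"
proof -
  have T_left: "bounded_linear (\<lambda>f. inner (T f) g)" for g
    by (rule bounded_linear_compose[OF bounded_linear_inner_left T])
  have T_right: "bounded_linear (\<lambda>f. inner g (T f))" for g
    by (rule bounded_linear_compose[OF bounded_linear_inner_right T])
  have "inner (T f) (d *\<^sub>C basis_ell2 n) = inner f (T (d *\<^sub>C basis_ell2 n))" for f d n
  proof (rule bounded_linear_eq_on_basis[OF T_left bounded_linear_inner_left])
    fix c m
    have "inner (c *\<^sub>C basis_ell2 m) (T (d *\<^sub>C basis_ell2 n))
        = inner (d *\<^sub>C T (basis_ell2 n)) (c *\<^sub>C basis_ell2 m)"
      by (simp add: inner_commute scaleC)
    then show "inner (T (c *\<^sub>C basis_ell2 m)) (d *\<^sub>C basis_ell2 n) =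
        inner (c *\<^sub>C basis_ell2 m) (T (d *\<^sub>C basis_ell2 n))"
      by (simp add: inner_scaleC_basis scaleC entries[of m n] algebra_simps)
  qed
  then show ?thesis
    by (rule bounded_linear_eq_on_basis[OF bounded_linear_inner_right T_right])
qed

text \<open>This is \<open>transfer_factor\<close> multiplied by z - c. Polynomial entries can be
  evaluated at the operator A.\<close>

definition factor_poly :: "real \<Rightarrow> real \<Rightarrow> real \<Rightarrow> real poly^2^2" where
  "factor_poly c p q = vector [vector [[:p * q - c, 1:], [:- (p * p):]], vector [[:q * q:], [:- (p * q) - c, 1:]]]"

definition last_poly :: "real \<Rightarrow> real \<Rightarrow> real poly^2^2" where
  "last_poly p q = vector [vector [0, [:- p:]], vector [[:1 / p:], [:- q, 1 / p:]]]"

text \<open>The tail \<open>\<aa>(z, c\<^sub>k) \<cdots> \<aa>(z, c\<^sub>g) \<aa>(z)\<close> of the transfer matrix, multiplied by its denominator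
  \<open>(z - c\<^sub>k) \<cdots> (z - c\<^sub>g)\<close>.\<close>
definition transfer_poly :: "real list \<Rightarrow> (nat \<Rightarrow> real) \<Rightarrow> (nat \<Rightarrow> real) \<Rightarrow> nat \<Rightarrow> real poly^2^2" where
  "transfer_poly C p q k =
     foldr (\<lambda>k M. factor_poly (C ! k) (p k) (q k) ** M) [k..<length C] (last_poly (p (length C)) (q (length C)))"

definition denom_poly :: "real list \<Rightarrow> nat \<Rightarrow> real poly" where
  "denom_poly C k = (\<Prod>i\<in>{k..<length C}. [:- (C ! i), 1:])"

lemma transfer_poly_length [simp]: "transfer_poly C p q (length C) = last_poly (p (length C)) (q (length C))"
  and denom_poly_length [simp]: "denom_poly C (length C) = 1"
  by (simp_all add: transfer_poly_def denom_poly_def)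

lemma transfer_poly_rec:
  "k < length C \<Longrightarrow> transfer_poly C p q k = factor_poly (C ! k) (p k) (q k) ** transfer_poly C p q (Suc k)"
  and denom_poly_rec: "k < length C \<Longrightarrow> denom_poly C k = [:- (C ! k), 1:] * denom_poly C (Suc k)"
  by (simp_all add: transfer_poly_def denom_poly_def upt_conv_Cons prod.atLeast_Suc_lessThan)

text \<open>Each factor has determinant (z - c)^2: this is determinant 1 of the transfer matrix with
  the denominators cleared.\<close>

lemma det_transfer_poly:
  assumes "p (length C) \<noteq> 0" "k \<le> length C"
  shows "det (transfer_poly C p q k) = denom_poly C k * denom_poly C k"
  using assms(2)
proof (induction rule: inc_induct)
  case base
  then show ?case using assms(1) by (simp add: det_2 last_poly_def one_pCons)
next
  case (step k)
  have "det (factor_poly (C ! k) (p k) (q k)) = [:- (C ! k), 1:] * [:- (C ! k), 1:]"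
    by (simp add: det_2 factor_poly_def algebra_simps)
  then have "det (transfer_poly C p q k)
      = ([:- (C ! k), 1:] * [:- (C ! k), 1:]) * (denom_poly C (Suc k) * denom_poly C (Suc k))"
    using step.IH unfolding transfer_poly_rec[OF step.hyps(2)] det_mul by (simp only:)
  also have "\<dots> = denom_poly C k * denom_poly C k"
    unfolding denom_poly_rec[OF step.hyps(2)] by (simp only: mult_ac)
  finally show ?case .
qed

lemma transfer_factor_entries:
  assumes "z \<noteq> of_real c"
  shows "transfer_factor z c p q = vector [vector [1 + of_real (p * q) / (z - of_real c), - of_real (p * p) / (z - of_real c)],
    vector [of_real (q * q) / (z - of_real c), 1 - of_real (p * q) / (z - of_real c)]]"
proof -
  have "z - of_real c \<noteq> 0" "of_real c - z \<noteq> 0" using assms by auto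
  then show ?thesis
    unfolding transfer_factor_def Let_def
    by (simp add: vec_eq_iff forall_2 matrix_matrix_mult_def sum_2 columnvector_def rowvector_def
        symp_def mat_def) (simp add: field_simps)
qed

lemma transfer_poly_eval:
  assumes "t \<notin> set C" and p: "p (length C) \<noteq> 0" and "k \<le> length C"
  shows "complex_of_real (poly (denom_poly C k) t) *
      foldr (\<lambda>k M. transfer_factor (of_real t) (C ! k) (p k) (q k) ** M) [k..<length C]
       (transfer_last (of_real t) (p (length C)) (q (length C))) $ i $ j
    = complex_of_real (poly (transfer_poly C p q k $ i $ j) t)"
  using assms(3)
proof (induction arbitrary: i j rule: inc_induct)
  case base
  have "i = 1 \<or> i = 2" "j = 1 \<or> j = 2" by (simp_all add: exhaust_2)
  then show ?case
    using p by (auto simp: last_poly_def transfer_last_def field_simps)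
next
  case (step k)
  define F where "F = (foldr (\<lambda>k M. transfer_factor (of_real t) (C ! k) (p k) (q k) ** M) [Suc k..<length C]
       (transfer_last (of_real t) (p (length C)) (q (length C))))"
  have F: "complex_of_real (poly (denom_poly C (Suc k)) t) * F $ i $ j = complex_of_real (poly (transfer_poly C p q (Suc k) $ i $ j) t)"
    for i j unfolding F_def by (rule step)
  have tk: "t \<noteq> C ! k" using assms(1) step.hyps by auto
  then have ne: "complex_of_real t \<noteq> of_real (C ! k)" by simp
  have ne': "complex_of_real t - of_real (C ! k) \<noteq> 0" using ne by simp
  have factor: "(complex_of_real t - of_real (C ! k)) * transfer_factor (of_real t) (C ! k) (p k) (q k) $ i $ j
      = of_real (poly (factor_poly (C ! k) (p k) (q k) $ i $ j) t)" for i j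
  proof -
    have "i = 1 \<or> i = 2" "j = 1 \<or> j = 2" by (simp_all add: exhaust_2)
    then show ?thesis
      using ne' unfolding transfer_factor_entries[OF ne]
      by (auto simp: factor_poly_def distrib_left right_diff_distrib)
  qed
  have "complex_of_real (poly (denom_poly C k) t) * (transfer_factor (of_real t) (C ! k) (p k) (q k) ** F) $ i $ j
      = (\<Sum>l\<in>UNIV. ((complex_of_real t - of_real (C ! k)) * transfer_factor (of_real t) (C ! k) (p k) (q k) $ i $ l) *
          (complex_of_real (poly (denom_poly C (Suc k)) t) * F $ l $ j))"
    using step.hyps by (simp add: denom_poly_rec matrix_matrix_mult_def sum_2 algebra_simps)
  also have "\<dots> = complex_of_real (poly (transfer_poly C p q k $ i $ j) t)"
    unfolding factor F using step.hyps by (simp add: transfer_poly_rec matrix_matrix_mult_def sum_2)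
  finally show ?case using step.hyps by (simp add: upt_conv_Cons F_def)
qed

definition discriminant_poly :: "real list \<Rightarrow> (nat \<Rightarrow> real) \<Rightarrow> (nat \<Rightarrow> real) \<Rightarrow> real poly" where
  "discriminant_poly C p q = trace (transfer_poly C p q 0)"

lemma poly_denom_poly_eq_0_iff: "poly (denom_poly C 0) t = 0 \<longleftrightarrow> t \<in> set C"
  by (auto simp: denom_poly_def poly_prod in_set_conv_nth)

lemma discriminant_of_real:
  assumes "t \<notin> set C" "p (length C) \<noteq> 0"
  shows "discriminant C p q (of_real t) = complex_of_real (poly (discriminant_poly C p q) t / poly (denom_poly C 0) t)"
proof -
  have "complex_of_real (poly (denom_poly C 0) t) * discriminant C p q (of_real t)
      = complex_of_real (poly (discriminant_poly C p q) t)"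
    using transfer_poly_eval[of t C p 0 q 1 1] transfer_poly_eval[of t C p 0 q 2 2] assms
    by (simp add: discriminant_def discriminant_poly_def transfer_matrix_def trace_def sum_2 algebra_simps)
  then show ?thesis
    using assms poly_denom_poly_eq_0_iff[of C t] by (simp add: field_simps)
qed

locale periodic_GMP =
  fixes C :: "real list" and A :: "ell2 \<Rightarrow> ell2" and p q :: "nat \<Rightarrow> real"
  assumes bounded_operator: "bounded_operator A"
    and coeffs: "generating_coeffs C A (\<lambda>_. p) (\<lambda>_. q)"
    and invertible: "c \<in> set C \<Longrightarrow> invertible_on UNIV (\<lambda>f. complex_of_real c *\<^sub>C f - A f)"
begin

abbreviation "g \<equiv> length C"
abbreviation "s \<equiv> int (length C) + 1"

lemma p_pos: "p g > 0"
  using coeffs by (simp add: generating_coeffs_def Let_def)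

section \<open>Block coordinates and the block shift\<close>

definition bv :: "int \<Rightarrow> nat \<Rightarrow> ell2" where
  "bv j i = basis_ell2 (s * j + int i)"

lemma index_eq_iff:
  assumes "i \<le> g" "l \<le> g"
  shows "s * j + int i = s * k + int l \<longleftrightarrow> j = k \<and> i = l"
proof
  assume eq: "s * j + int i = s * k + int l"
  have "(s * j + int i) div s = j" "(s * k + int l) div s = k" using assms by (simp_all add: div_pos_pos_trivial)
  then have "j = k" using eq by simp
  with eq show "j = k \<and> i = l" by simp
qed simp

lemma index_cases:
  obtains j i where "n = s * j + int i" "i \<le> g"
proof
  show "n = s * (n div s) + int (nat (n mod s))" by simp
  have "n mod s < s" by (rule pos_mod_bound) simp
  then show "nat (n mod s) \<le> g" by linarith
qed

lemma coord_bv: "i \<le> g \<Longrightarrow> l \<le> g \<Longrightarrow> coord (bv j i) (s * k + int l) = (if j = k \<and> i = l then 1 else 0)"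
  using index_eq_iff[of l i k j] by (auto simp: bv_def)

lemma coord_A_bv:
  "i \<le> g \<Longrightarrow> l \<le> g \<Longrightarrow> coord (A (bv j l)) (s * k + int i)
    = complex_of_real (block_entry C (\<lambda>_. p) (\<lambda>_. q) k i j l)"
  using coeffs by (simp add: generating_coeffs_def Let_def bv_def add.commute)

lemma A_bv:
  assumes l: "l \<le> g"
  shows "A (bv j l) = (\<Sum>i\<le>g. blockB C p q i l *\<^sub>R bv j i)
    + (if l = g then \<Sum>i\<le>g. p i *\<^sub>R bv (j + 1) i else 0) + p l *\<^sub>R bv (j - 1) g"
proof (rule ell2_eqI)
  fix n
  obtain k i where n: "n = s * k + int i" and i: "i \<le> g" by (rule index_cases)
  have sum: "(\<Sum>i'\<le>g. complex_of_real (a i') * coord (bv j' i') n) = (if j' = k then complex_of_real (a i) else 0)" for a j'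
  proof -
    have "(\<Sum>i'\<le>g. complex_of_real (a i') * coord (bv j' i') n)
        = (\<Sum>i'\<le>g. if i' = i then (if j' = k then complex_of_real (a i') else 0) else 0)"
      unfolding n by (intro sum.cong) (auto simp: coord_bv i)
    then show ?thesis using i by (simp add: sum.delta)
  qed
  show "coord (A (bv j l)) n = coord ((\<Sum>i\<le>g. blockB C p q i l *\<^sub>R bv j i)
    + (if l = g then \<Sum>i\<le>g. p i *\<^sub>R bv (j + 1) i else 0) + p l *\<^sub>R bv (j - 1) g) n"
    using coord_bv[OF order.refl i, of "j - 1" k] i l sum[of "\<lambda>i. blockB C p q i l" j] sum[of p "j + 1"]
    unfolding n by (auto simp: coord_A_bv block_entry_def blockA_def outer_def)
qed

lemma A_bounded: "bounded_linear A" and A_scaleC: "A (c *\<^sub>C f) = c *\<^sub>C A f"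
  using bounded_operator by (auto simp: bounded_operator_def)

lemma blockB_sym: "blockB C p q i l = blockB C p q l i"
  by (auto simp: blockB_def upper_def lower_def outer_def)

sublocale selfadjoint_operator A
proof (intro selfadjoint_operator.intro symmetric_operator.intro selfadjoint_operator_axioms.intro A_bounded A_scaleC)
  have "coord (A (basis_ell2 m)) n = cnj (coord (A (basis_ell2 n)) m)" for m n
  proof -
    obtain k i where n: "n = s * k + int i" and i: "i \<le> g" by (rule index_cases)
    obtain j l where m: "m = s * j + int l" and l: "l \<le> g" by (rule index_cases)
    show ?thesis
      using i l coord_A_bv[OF i l, of j k] coord_A_bv[OF l i, of k j] blockB_sym[of i l]
      by (auto simp: bv_def n m block_entry_def blockA_def outer_def)
  qed
  then show "inner (A f) h = inner f (A h)" for f h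
    by (rule symmetric_on_basisI[OF A_bounded A_scaleC])
qed

definition W :: "int \<Rightarrow> ell2 \<Rightarrow> ell2" where
  "W k = translate (s * k)"

lemma W_bv [simp]: "W k (bv j i) = bv (j + k) i"
  by (simp add: W_def bv_def algebra_simps)

lemma W_W [simp]: "W k (W l f) = W (k + l) f" and W_0 [simp]: "W 0 f = f"
  by (simp_all add: W_def distrib_left)

lemma bounded_linear_W: "bounded_linear (W k)"
  by (simp add: W_def bounded_linear_translate)

lemmas linear_W = bounded_linear.linear[OF bounded_linear_W]

lemma W_scaleC: "W k (c *\<^sub>C f) = c *\<^sub>C W k f"
  by (simp add: W_def translate_linear)

lemmas W_linear = linear_add[OF linear_W] linear_diff[OF linear_W] linear_scale[OF linear_W]
  linear_sum[OF linear_W] linear_0[OF linear_W]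

lemma eq_on_bvI:
  fixes S T :: "ell2 \<Rightarrow> 'b::real_normed_vector"
  assumes "bounded_linear S" "bounded_linear T"
    and "\<And>c j i. i \<le> g \<Longrightarrow> S (c *\<^sub>C bv j i) = T (c *\<^sub>C bv j i)"
  shows "S f = T f"
proof (rule bounded_linear_eq_on_basis[OF assms(1,2)])
  fix c n
  obtain j i where n: "n = s * j + int i" and i: "i \<le> g" by (rule index_cases)
  show "S (c *\<^sub>C basis_ell2 n) = T (c *\<^sub>C basis_ell2 n)"
    using assms(3)[OF i, of c j] by (simp add: bv_def n)
qed

lemma W_A: "W k (A f) = A (W k f)"
proof (rule eq_on_bvI[OF bounded_linear_compose[OF bounded_linear_W bounded] bounded_linear_compose[OF bounded bounded_linear_W]])
  fix c j i assume "i \<le> g"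
  then show "W k (A (c *\<^sub>C bv j i)) = A (W k (c *\<^sub>C bv j i))"
    by (simp add: A_scaleC W_scaleC A_bv W_linear algebra_simps)
qed

lemma W_poly_op: "W k (poly_op A P f) = poly_op A P (W k f)"
  by (rule poly_op_commute[OF lin linear_W]) (rule W_A)

section \<open>The recursion for the basis vectors\<close>

abbreviation "e \<equiv> bv 0"

text \<open>Apart from c_l, column l of the diagonal block has the entries q_i p_l above the
  diagonal and p_i q_l from the diagonal on, and the coupling to the preceding block adds p_l times
  its last basis vector. So A e_l is c_l e_l plus p_l Y_l + q_l X_l, a combination of two running
  sums, with W X_0 added for l = g.\<close>

definition X :: "nat \<Rightarrow> ell2" where
  "X l = (\<Sum>i\<in>{l..g}. p i *\<^sub>R e i)"

definition Y :: "nat \<Rightarrow> ell2" where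
  "Y l = bv (-1) g + (\<Sum>i<l. q i *\<^sub>R e i)"

lemma X_rec: "l \<le> g \<Longrightarrow> X l = X (Suc l) + p l *\<^sub>R e l"
  by (simp add: X_def sum.atLeast_Suc_atMost)

lemma Y_rec: "Y (Suc l) = Y l + q l *\<^sub>R e l"
  by (simp add: Y_def)

lemma X_last: "X g = p g *\<^sub>R e g"
  by (simp add: X_def)

lemma Y_0: "Y 0 = bv (-1) g"
  by (simp add: Y_def)

lemma A_e_split:
  assumes "l \<le> g"
  shows "A (e l) = (C @ [0]) ! l *\<^sub>R e l + p l *\<^sub>R Y l + q l *\<^sub>R X l
    + (if l = g then W 1 (X 0) else 0)"
proof -
  have split: "{..g} = {..<l} \<union> {l..g}" "{..<l} \<inter> {l..g} = {}" using assms by auto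
  have "(\<Sum>i\<le>g. blockB C p q i l *\<^sub>R e i)
      = (\<Sum>i\<le>g. (if i < l then q i * p l else p i * q l) *\<^sub>R e i + (if i = l then (C @ [0]) ! i *\<^sub>R e i else 0))"
    by (rule sum.cong) (auto simp: blockB_def upper_def lower_def outer_def scaleR_add_left)
  also have "\<dots> = (\<Sum>i\<le>g. (if i < l then q i * p l else p i * q l) *\<^sub>R e i) + (C @ [0]) ! l *\<^sub>R e l"
    using assms by (simp add: sum.distrib)
  also have "(\<Sum>i\<le>g. (if i < l then q i * p l else p i * q l) *\<^sub>R e i)
      = (\<Sum>i<l. (q i * p l) *\<^sub>R e i) + (\<Sum>i\<in>{l..g}. (p i * q l) *\<^sub>R e i)"
    unfolding split(1) by (subst sum.union_disjoint) (auto intro!: arg_cong2[where f = "(+)"] sum.cong)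
  finally have B: "(\<Sum>i\<le>g. blockB C p q i l *\<^sub>R e i) = p l *\<^sub>R (\<Sum>i<l. q i *\<^sub>R e i) + q l *\<^sub>R X l + (C @ [0]) ! l *\<^sub>R e l"
    by (simp add: X_def scaleR_right.sum mult.commute)
  have "W 1 (X 0) = (\<Sum>i\<le>g. p i *\<^sub>R bv 1 i)"
    by (simp add: X_def W_linear atLeast0AtMost)
  then show ?thesis
    using A_bv[OF assms, of 0] unfolding B by (simp add: Y_def algebra_simps)
qed

text \<open>Replacing l by l + 1 in both running sums adds p_l q_l e_l to one term and removes it
  from the other, so p_l Y + q_l X does not change.\<close>

lemma A_e:
  assumes "l < g"
  shows "poly_op A [:- (C ! l), 1:] (e l) = p l *\<^sub>R Y (Suc l) + q l *\<^sub>R X (Suc l)"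
  using A_e_split[of l] assms linear_0[OF lin]
  by (simp add: poly_op_simps nth_append Y_rec X_rec[of l] algebra_simps)

lemma A_e_last: "A (e g) = (p g * q g) *\<^sub>R e g + p g *\<^sub>R Y g + W 1 (X 0)"
  using A_e_split[of g] by (simp add: X_last)

text \<open>The sign makes the matrix of the recursion equal to \<open>factor_poly\<close>.\<close>

definition v :: "nat \<Rightarrow> 2 \<Rightarrow> ell2" where
  "v l i = (if i = 1 then - X l else Y l)"

definition act :: "real poly^2^2 \<Rightarrow> (2 \<Rightarrow> ell2) \<Rightarrow> 2 \<Rightarrow> ell2" where
  "act M f i = poly_op A (M $ i $ 1) (f 1) + poly_op A (M $ i $ 2) (f 2)"

lemma poly_op_linear:
  "poly_op A P (f + h) = poly_op A P f + poly_op A P h"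
  "poly_op A P (f - h) = poly_op A P f - poly_op A P h"
  "poly_op A P (r *\<^sub>R f) = r *\<^sub>R poly_op A P f"
  "poly_op A P (- f) = - poly_op A P f"
  "poly_op A P 0 = 0"
  by (fact linear_add[OF linear_poly_op[OF lin]] linear_diff[OF linear_poly_op[OF lin]]
      linear_scale[OF linear_poly_op[OF lin]] linear_neg[OF linear_poly_op[OF lin]]
      linear_0[OF linear_poly_op[OF lin]])+

lemma act_mult: "act (M ** N) f i = act M (act N f) i"
  by (simp add: act_def matrix_matrix_mult_def sum_2 poly_op_simps poly_op_mult[OF lin] poly_op_linear)

lemma poly_op_act: "poly_op A P (act M f i) = act M (\<lambda>i. poly_op A P (f i)) i"
  by (simp add: act_def poly_op_linear poly_op_swap[OF lin, of P])

lemma v_rec: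
  assumes "l < g"
  shows "poly_op A [:- (C ! l), 1:] (v l i) = act (factor_poly (C ! l) (p l) (q l)) (v (Suc l)) i"
proof -
  have X: "poly_op A [:- (C ! l), 1:] (X l) = poly_op A [:- (C ! l), 1:] (X (Suc l))
      + p l *\<^sub>R (p l *\<^sub>R Y (Suc l) + q l *\<^sub>R X (Suc l))"
    using assms by (simp only: X_rec[of l] less_imp_le poly_op_linear A_e)
  have "Y l = Y (Suc l) - q l *\<^sub>R e l" by (simp add: Y_rec)
  then have Y: "poly_op A [:- (C ! l), 1:] (Y l) = poly_op A [:- (C ! l), 1:] (Y (Suc l))
      - q l *\<^sub>R (p l *\<^sub>R Y (Suc l) + q l *\<^sub>R X (Suc l))"
    using assms by (simp only: poly_op_linear A_e)
  have "i = 1 \<or> i = 2" by (simp add: exhaust_2)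
  then show ?thesis
  proof
    assume "i = 1"
    then have "v l i = - X l" by (simp add: v_def)
    then show ?thesis
      using \<open>i = 1\<close> by (simp only: poly_op_linear X)
         (simp add: act_def v_def factor_poly_def poly_op_simps linear_0[OF lin] linear_neg[OF lin] algebra_simps)
  next
    assume "i = 2"
    then have "v l i = Y l" by (simp add: v_def)
    then show ?thesis
      using \<open>i = 2\<close> by (simp only: Y)
         (simp add: act_def v_def factor_poly_def poly_op_simps linear_0[OF lin] linear_neg[OF lin] algebra_simps)
  qed
qed

text \<open>The last basis vector of block 0 is W Y_0. Thus both entries of v g are expressed
  through the shifted pair v 0, and the recursion closes up.\<close>

lemma v_last: "v g i = act (last_poly (p g) (q g)) (\<lambda>i. W 1 (v 0 i)) i"
proof -
  have WY: "W 1 (Y 0) = e g" by (simp add: Y_0)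
  have "i = 1 \<or> i = 2" by (simp add: exhaust_2)
  then show ?thesis
    using p_pos A_e_last
    by (auto simp: v_def act_def last_poly_def poly_op_simps linear_0[OF lin] linear_neg[OF linear_W] X_last WY
        linear_scale[OF lin] scaleR_add_right)
qed

lemma denom_v:
  assumes "k \<le> g"
  shows "poly_op A (denom_poly C k) (v k i) = act (transfer_poly C p q k) (\<lambda>i. W 1 (v 0 i)) i"
  using assms
proof (induction arbitrary: i rule: inc_induct)
  case base
  then show ?case by (simp add: poly_op_simps v_last)
next
  case (step k)
  have "poly_op A (denom_poly C k) (v k i)
      = poly_op A (denom_poly C (Suc k)) (poly_op A [:- (C ! k), 1:] (v k i))"
    using step.hyps by (simp only: denom_poly_rec poly_op_mult[OF lin, symmetric] mult.commute)
  also have "\<dots> = act (factor_poly (C ! k) (p k) (q k)) (\<lambda>i. poly_op A (denom_poly C (Suc k)) (v (Suc k) i)) i"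
    using step.hyps by (simp only: v_rec poly_op_act)
  also have "\<dots> = act (transfer_poly C p q k) (\<lambda>i. W 1 (v 0 i)) i"
    using step.hyps unfolding step.IH by (simp only: transfer_poly_rec act_mult)
  finally show ?case .
qed

definition boundedly_invertible :: "real poly \<Rightarrow> bool" where
  "boundedly_invertible P \<longleftrightarrow> bij (poly_op A P) \<and> (\<exists>K>0. \<forall>f. K * norm f \<le> norm (poly_op A P f))"

lemma boundedly_invertible_prod:
  "(\<And>i. i \<in> I \<Longrightarrow> boundedly_invertible (P i)) \<Longrightarrow> boundedly_invertible (prod P I)"
proof (induction I rule: infinite_finite_induct)
  case (insert x I)
  then obtain K K' where K: "K > 0" "\<And>f. K * norm f \<le> norm (poly_op A (P x) f)"
    and K': "K' > 0" "\<And>f. K' * norm f \<le> norm (poly_op A (prod P I) f)"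
    unfolding boundedly_invertible_def by blast
  have "poly_op A (prod P (insert x I)) = poly_op A (P x) \<circ> poly_op A (prod P I)"
    using insert.hyps by (auto simp: poly_op_mult[OF lin])
  moreover have "bij (poly_op A (P x) \<circ> poly_op A (prod P I))"
    using insert unfolding boundedly_invertible_def by (intro bij_comp) auto
  moreover have "(K * K') * norm f \<le> norm ((poly_op A (P x) \<circ> poly_op A (prod P I)) f)" for f
  proof -
    have "K * (K' * norm f) \<le> K * norm (poly_op A (prod P I) f)"
      using K(1) K'(2) by (intro mult_left_mono) auto
    also have "\<dots> \<le> norm (poly_op A (P x) (poly_op A (prod P I) f))" by (rule K(2))
    finally show ?thesis by (simp add: mult.assoc)
  qed
  ultimately show ?case unfolding boundedly_invertible_def using K(1) K'(1) by (metis mult_pos_pos)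
qed (auto simp: boundedly_invertible_def poly_op_1[OF lin, abs_def] bij_id[unfolded id_def] intro!: exI[of _ 1])

lemma boundedly_invertible_linear:
  assumes "c \<in> set C"
  shows "boundedly_invertible [:- c, 1:]"
proof -
  have eq: "poly_op A [:- c, 1:] f = - (complex_of_real c *\<^sub>C f - A f)" for f
    by (simp add: poly_op_simps linear_0[OF lin] scaleC_of_real)
  obtain K where bij: "bij (\<lambda>f. complex_of_real c *\<^sub>C f - A f)"
    and K: "\<And>f. norm f \<le> K * norm (complex_of_real c *\<^sub>C f - A f)"
    using invertible[OF assms] unfolding invertible_on_def by auto
  have "bij (uminus \<circ> (\<lambda>f. complex_of_real c *\<^sub>C f - A f))"
    by (rule bij_comp[OF bij bij_uminus])
  then have "bij (poly_op A [:- c, 1:])" unfolding eq[abs_def] comp_def .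
  moreover have "inverse (\<bar>K\<bar> + 1) * norm f \<le> norm (poly_op A [:- c, 1:] f)" for f
  proof -
    have "norm f \<le> (\<bar>K\<bar> + 1) * norm (complex_of_real c *\<^sub>C f - A f)"
      by (rule order.trans[OF K mult_right_mono]) auto
    then have "inverse (\<bar>K\<bar> + 1) * norm f
        \<le> inverse (\<bar>K\<bar> + 1) * ((\<bar>K\<bar> + 1) * norm (complex_of_real c *\<^sub>C f - A f))"
      by (rule mult_left_mono) auto
    also have "\<dots> = norm (complex_of_real c *\<^sub>C f - A f)"
      by (simp flip: mult.assoc)
    finally show ?thesis unfolding eq norm_minus_cancel .
  qed
  moreover have "inverse (\<bar>K\<bar> + 1) > 0" by (simp add: add_nonneg_pos)
  ultimately show ?thesis unfolding boundedly_invertible_def by blast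
qed

lemma boundedly_invertible_denom: "boundedly_invertible (denom_poly C 0)"
  unfolding denom_poly_def by (rule boundedly_invertible_prod) (auto intro: boundedly_invertible_linear)

lemma boundedly_invertible_inj: "boundedly_invertible P \<Longrightarrow> poly_op A P f = 0 \<Longrightarrow> f = 0"
  unfolding boundedly_invertible_def by (metis bij_is_inj injD poly_op_linear(5))

section \<open>Cayley-Hamilton and the magic formula\<close>

definition J :: "ell2 \<Rightarrow> ell2" where
  "J f = W 1 f + W (-1) f"

abbreviation "N \<equiv> discriminant_poly C p q"
abbreviation "E \<equiv> denom_poly C 0"

text \<open>This map commutes with A and with every W k, so its kernel is invariant under both, and
  a factor A - c_k can be cancelled from membership in the kernel. It remains to find the basis
  vectors of one block in the kernel.\<close>

definition magic_defect :: "ell2 \<Rightarrow> ell2" where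
  "magic_defect f = poly_op A N f - poly_op A E (J f)"

text \<open>Cayley--Hamilton for \<open>v 0 = \<AA>(A) (W 1 (v 0))\<close>, where \<open>\<AA>\<close> has determinant 1.\<close>
lemma magic_defect_v0: "magic_defect (v 0 i) = 0"
proof -
  define M where "M = transfer_poly C p q 0"
  have det: "M $ 1 $ 1 * M $ 2 $ 2 - M $ 1 $ 2 * M $ 2 $ 1 = E * E"
    using det_transfer_poly[of p C 0 q] p_pos by (simp add: det_2 M_def)
  have N: "N = M $ 1 $ 1 + M $ 2 $ 2"
    by (simp add: discriminant_poly_def M_def trace_def sum_2)
  have Ev: "poly_op A E (v 0 i) = poly_op A (M $ i $ 1) (W 1 (v 0 1)) + poly_op A (M $ i $ 2) (W 1 (v 0 2))" for i
    using denom_v[of 0 i] by (simp add: M_def act_def)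
  \<comment> \<open>With M evaluated at A, E v = M W v gives E^2 v = M^2 W^2 v, and M^2 = N M - E^2
    turns this into N E W v - E^2 W^2 v.\<close>
  have quad: "poly_op A (E * E) (v 0 i) = poly_op A (N * E) (W 1 (v 0 i)) - poly_op A (E * E) (W 2 (v 0 i))" for i
  proof -
    have EE: "poly_op A (E * E) (v 0 i) = poly_op A (M $ i $ 1) (W 1 (poly_op A E (v 0 1)))
        + poly_op A (M $ i $ 2) (W 1 (poly_op A E (v 0 2)))" for i
      unfolding poly_op_mult[OF lin] Ev[of i] poly_op_linear
      by (simp add: W_poly_op poly_op_swap[OF lin, of E])
    have NE: "poly_op A (N * E) (W 1 (v 0 i)) = poly_op A N (W 1 (poly_op A E (v 0 i)))" for i
      by (simp add: poly_op_mult[OF lin] W_poly_op)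
    have "i = 1 \<or> i = 2" by (simp add: exhaust_2)
    then show ?thesis
      unfolding EE NE unfolding Ev unfolding det[symmetric] N
      by (auto simp: W_linear W_poly_op poly_op_linear poly_op_simps algebra_simps simp flip: poly_op_mult[OF lin])
  qed
  \<comment> \<open>One factor E(A) is cancelled, and W^-1 then makes the relation symmetric in W
    and W^-1.\<close>
  have "poly_op A E (poly_op A E (v 0 i) - poly_op A N (W 1 (v 0 i)) + poly_op A E (W 2 (v 0 i))) = 0"
    using quad[of i] by (simp add: poly_op_linear mult.commute flip: poly_op_mult[OF lin])
  then have "poly_op A E (v 0 i) - poly_op A N (W 1 (v 0 i)) + poly_op A E (W 2 (v 0 i)) = 0"
    by (rule boundedly_invertible_inj[OF boundedly_invertible_denom])
  then have "W (-1) (poly_op A E (v 0 i) - poly_op A N (W 1 (v 0 i)) + poly_op A E (W 2 (v 0 i))) = 0"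
    by (simp add: W_linear)
  then show ?thesis
    by (simp add: magic_defect_def J_def W_linear W_poly_op poly_op_linear algebra_simps)
qed

lemma bounded_linear_J: "bounded_linear J"
  unfolding J_def by (intro bounded_linear_add bounded_linear_W)

lemma bounded_linear_magic_defect: "bounded_linear magic_defect"
  unfolding magic_defect_def
  by (intro bounded_linear_sub bounded_linear_poly_op bounded bounded_linear_compose[OF _ bounded_linear_J])

lemmas linear_magic_defect = bounded_linear.linear[OF bounded_linear_magic_defect]

lemma J_poly_op: "J (poly_op A P f) = poly_op A P (J f)"
  by (simp add: J_def W_poly_op poly_op_linear)

lemma magic_defect_poly_op: "magic_defect (poly_op A P f) = poly_op A P (magic_defect f)"
  by (simp add: magic_defect_def J_poly_op poly_op_linear poly_op_swap[OF lin, of P])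

lemma magic_defect_W: "magic_defect (W k f) = W k (magic_defect f)"
  by (simp add: magic_defect_def J_def W_linear W_poly_op poly_op_linear algebra_simps)

lemma magic_defect_act: "(\<And>i. magic_defect (f i) = 0) \<Longrightarrow> magic_defect (act M f i) = 0"
  by (simp add: act_def linear_add[OF linear_magic_defect] magic_defect_poly_op poly_op_linear)

text \<open>From v 0 the kernel property passes to its shift and thereby to v g; from there the
  recursion descends to v k, each step cancelling one A - c_k.\<close>

lemma magic_defect_v: "k \<le> g \<Longrightarrow> magic_defect (v k i) = 0"
proof (induction arbitrary: i rule: inc_induct)
  case base
  show ?case
    unfolding v_last by (rule magic_defect_act) (simp add: magic_defect_W magic_defect_v0 W_linear)
next
  case (step k)
  have "poly_op A [:- (C ! k), 1:] (magic_defect (v k i)) = 0"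
    unfolding magic_defect_poly_op[symmetric] v_rec[OF step.hyps(2)]
    by (rule magic_defect_act) (rule step.IH)
  then show ?case
    by (rule boundedly_invertible_inj[OF boundedly_invertible_linear[OF nth_mem[OF step.hyps(2)]]])
qed

lemma magic_defect_e:
  assumes "l \<le> g"
  shows "magic_defect (e l) = 0"
proof (cases "l = g")
  case True
  have "e g = W 1 (v 0 2)" by (simp add: v_def Y_0)
  then show ?thesis using True by (simp only: magic_defect_W magic_defect_v0 W_linear)
next
  case False
  then have l: "l < g" using assms by simp
  have X: "magic_defect (X k) = 0" and Y: "magic_defect (Y k) = 0" if "k \<le> g" for k
    using magic_defect_v[OF that, of 1] magic_defect_v[OF that, of 2]
    by (simp_all add: v_def linear_neg[OF linear_magic_defect])
  have "poly_op A [:- (C ! l), 1:] (magic_defect (e l)) = 0"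
    unfolding magic_defect_poly_op[symmetric] A_e[OF l]
    using X[of "Suc l"] Y[of "Suc l"] l by (simp add: linear_add[OF linear_magic_defect] linear_scale[OF linear_magic_defect])
  then show ?thesis
    by (rule boundedly_invertible_inj[OF boundedly_invertible_linear[OF nth_mem[OF l]]])
qed

text \<open>The magic formula \<open>\<Delta>(A) = W + W\<^sup>-\<^sup>1\<close>, with denominators cleared.\<close>
theorem magic_formula: "poly_op A N f = poly_op A E (J f)"
proof -
  have "magic_defect f = 0"
  proof (rule eq_on_bvI[OF bounded_linear_magic_defect bounded_linear_zero])
    fix c j i assume "i \<le> g"
    have "magic_defect (c *\<^sub>C bv j i) = c *\<^sub>C magic_defect (W j (e i))"
      by (simp add: magic_defect_def J_def poly_op_scaleC W_scaleC scaleC_diff_right flip: scaleC_add_right)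
    then show "magic_defect (c *\<^sub>C bv j i) = 0"
      unfolding magic_defect_W by (simp add: magic_defect_e[OF \<open>i \<le> g\<close>] W_linear)
  qed
  then show ?thesis by (simp add: magic_defect_def)
qed

end

section \<open>Absolute continuity\<close>

text \<open>The image need not be Borel, whereas the null sets of \<open>lborel\<close> are; hence
  the enclosing set.\<close>

lemma null_set_differentiable_image:
  fixes f :: "real \<Rightarrow> real"
  assumes "N \<in> null_sets lborel" "S \<subseteq> N" "f differentiable_on S"
  obtains N' where "N' \<in> null_sets lborel" "f ` S \<subseteq> N'"
proof -
  have "negligible N"
    using assms(1) by (auto simp: negligible_iff_null_sets null_sets_completion_iff2)
  then have "negligible (f ` S)"
    by (intro negligible_differentiable_image_negligible assms order.refl negligible_subset[OF _ assms(2)])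
  then show ?thesis
    using that by (auto simp: negligible_iff_null_sets null_sets_completion_iff2)
qed

text \<open>The uniform distribution on [0, pi]. Its image under 2 cos is the arcsine law on
  [-2, 2].\<close>

definition arc_measure :: "real measure" where
  "arc_measure = density lborel (\<lambda>x. ennreal (indicator {0..pi} x / pi))"

lemma sets_arc_measure [simp, measurable_cong]: "sets arc_measure = sets borel"
  by (simp add: arc_measure_def)

lemma has_bochner_integral_arc_measure:
  fixes f :: "real \<Rightarrow> real"
  assumes "has_bochner_integral lborel (\<lambda>x. f x * indicator {0..pi} x) (pi * c)" "f \<in> borel_measurable borel"
  shows "has_bochner_integral arc_measure f c"
  unfolding arc_measure_def
proof (rule has_bochner_integral_density)
  have "has_bochner_integral lborel (\<lambda>x. (1 / pi) * (f x * indicator {0..pi} x)) ((1 / pi) * (pi * c))"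
    by (rule has_bochner_integral_mult_right) (use assms in simp)
  then show "has_bochner_integral lborel (\<lambda>x. (indicator {0..pi} x / pi) *\<^sub>R f x) c"
    by (simp add: mult_ac)
qed (use assms in auto)

lemma integral_cos_int:
  "has_bochner_integral lborel (\<lambda>x. cos (real_of_int m * x) * indicator {0..pi} x) (if m = 0 then pi else 0)"
proof (cases "m = 0")
  case True
  then show ?thesis
    using has_bochner_integral_FTC_Icc_real[of 0 pi "\<lambda>x. x" "\<lambda>x. 1"] by simp
next
  case False
  have "has_bochner_integral lborel (\<lambda>x. cos (real_of_int m * x) * indicator {0..pi} x)
      (sin (real_of_int m * pi) / real_of_int m - sin (real_of_int m * 0) / real_of_int m)"
    by (rule has_bochner_integral_FTC_Icc_real)
       (use False in \<open>auto intro!: derivative_eq_intros continuous_intros\<close>)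
  moreover have "sin (real_of_int m * pi) = 0" by (simp add: sin_times_pi_eq_0)
  ultimately show ?thesis using False by simp
qed

text \<open>Strictly between -2 and 2 the inverse t -> arccos (t/2) is differentiable and so
  preserves null sets. The endpoints, where this fails, have only the preimages 0 and pi in
  [0, pi].\<close>

lemma arc_measure_two_cos_null:
  assumes "N \<in> null_sets lborel"
  shows "emeasure (distr arc_measure borel (\<lambda>x. 2 * cos x)) N = 0"
proof -
  have [measurable]: "N \<in> sets borel" using assms by auto
  define S where "S = N \<inter> {-2<..<2}"
  have "(\<lambda>t. arccos (t / 2)) differentiable_on S"
    unfolding differentiable_on_def
  proof
    fix t assume "t \<in> S"
    then have "DERIV (\<lambda>t. arccos (t / 2)) t :> inverse (- sqrt (1 - (t / 2)\<^sup>2)) * (1 / 2)"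
      by (intro DERIV_chain2[of arccos _ "\<lambda>t. t / 2"] DERIV_arccos)
         (auto simp: S_def intro!: derivative_eq_intros)
    then show "(\<lambda>t. arccos (t / 2)) differentiable (at t within S)"
      using real_differentiable_def differentiable_at_withinI by blast
  qed
  then obtain N' where N': "N' \<in> null_sets lborel" "(\<lambda>t. arccos (t / 2)) ` S \<subseteq> N'"
    using null_set_differentiable_image[OF assms, of S] by (auto simp: S_def)
  define B where "B = {x \<in> {0..pi}. 2 * cos x \<in> N}"
  have B: "B \<in> sets lborel" unfolding B_def by measurable
  have "B \<subseteq> N' \<union> {0, pi}"
  proof
    fix x assume x: "x \<in> B"
    show "x \<in> N' \<union> {0, pi}"
    proof (cases "x = 0 \<or> x = pi")
      case False
      then have "0 < x" "x < pi" using x by (auto simp: B_def)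
      then have "cos x < 1" "- 1 < cos x"
        using cos_monotone_0_pi[of 0 x] cos_monotone_0_pi[of x pi] by auto
      then have "2 * cos x \<in> S" using x by (auto simp: S_def B_def)
      moreover have "arccos (2 * cos x / 2) = x" using x by (simp add: B_def arccos_cos)
      ultimately have "x \<in> (\<lambda>t. arccos (t / 2)) ` S" by (metis image_eqI)
      then show ?thesis using N' by auto
    qed auto
  qed
  moreover have "N' \<union> {0, pi} \<in> null_sets lborel"
    using N'(1) by (intro null_sets.Un) (auto intro: finite_imp_null_set_lborel)
  ultimately have "emeasure lborel B = 0"
    using B null_sets_subset null_setsD1 by blast
  have "emeasure (distr arc_measure borel (\<lambda>x. 2 * cos x)) N = emeasure arc_measure {x. 2 * cos x \<in> N}"
    by (subst emeasure_distr) (auto simp: vimage_def arc_measure_def)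
  also have "\<dots> = (\<integral>\<^sup>+x. ennreal (1 / pi) * indicator B x \<partial>lborel)"
    unfolding arc_measure_def
    by (subst emeasure_density) (auto simp: B_def indicator_def intro!: nn_integral_cong)
  also have "\<dots> = 0"
    using B \<open>emeasure lborel B = 0\<close> by (simp add: nn_integral_cmult)
  finally show ?thesis .
qed

section \<open>The arcsine law of J and its pullback to A\<close>

context periodic_GMP
begin

lemma inner_W: "inner (W k f) (W k h) = inner f h"
proof -
  have n: "norm (W k f) = norm f" for f by (simp add: W_def)
  have "norm (W k f + W k h) = norm (f + h)" using n[of "f + h"] by (simp add: W_linear)
  then show ?thesis by (simp add: dot_norm n)
qed

lemma inner_W_adjoint: "inner (W k f) h = inner f (W (- k) h)"
  using inner_W[of "- k" "W k f" h] by simp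

sublocale J: symmetric_operator J
proof (intro symmetric_operator.intro bounded_linear_J)
  show "inner (J f) h = inner f (J h)" for f h
    by (simp add: J_def inner_add_left inner_add_right inner_W_adjoint)
qed

text \<open>The translation by m carries the induction: J W^m = W^(m+1) + W^(m-1) mirrors 2 cos x
  cos mx = cos (m+1)x + cos (m-1)x. For k = 0 the orthonormality of the translates mirrors the
  vanishing of the integral of cos mx for m other than 0.\<close>

lemma J_moments:
  assumes "i \<le> g"
  shows "has_bochner_integral lborel (\<lambda>x. (2 * cos x) ^ k * cos (real_of_int m * x) * indicator {0..pi} x)
    (pi * inner (W m (bv j i)) ((J ^^ k) (bv j i)))"
proof (induction k arbitrary: m)
  case 0
  have "inner (bv (j + m) i) (bv j i) = (if m = 0 then 1 else 0)"
    using inner_scaleC_basis[of "bv (j + m) i" 1 "s * j + int i"] coord_bv[OF assms assms, of "j + m" j]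
    by (auto simp: bv_def)
  then show ?case using integral_cos_int[of m] by auto
next
  case (Suc k)
  have "inner (W m (bv j i)) ((J ^^ Suc k) (bv j i)) = inner (J (W m (bv j i))) ((J ^^ k) (bv j i))"
    by (simp add: J.symmetric)
  also have "\<dots> = inner (W (m + 1) (bv j i)) ((J ^^ k) (bv j i)) + inner (W (m - 1) (bv j i)) ((J ^^ k) (bv j i))"
    by (simp add: J_def inner_add_left ac_simps)
  finally have eq: "inner (W m (bv j i)) ((J ^^ Suc k) (bv j i))
      = inner (W (m + 1) (bv j i)) ((J ^^ k) (bv j i)) + inner (W (m - 1) (bv j i)) ((J ^^ k) (bv j i))" .
  have cos: "(2 * cos x) ^ Suc k * cos (real_of_int m * x) * indicator {0..pi} x
      = (2 * cos x) ^ k * cos (real_of_int (m + 1) * x) * indicator {0..pi} x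
        + (2 * cos x) ^ k * cos (real_of_int (m - 1) * x) * indicator {0..pi} x" for x
  proof -
    have "2 * cos x * cos (real_of_int m * x) = cos (real_of_int (m + 1) * x) + cos (real_of_int (m - 1) * x)"
      by (simp add: distrib_right left_diff_distrib cos_add cos_diff)
    then have "(2 * cos x) ^ k * (2 * cos x * cos (real_of_int m * x)) * indicator {0..pi} x
        = (2 * cos x) ^ k * (cos (real_of_int (m + 1) * x) + cos (real_of_int (m - 1) * x)) * indicator {0..pi} x"
      by (simp only:)
    then show ?thesis by (simp only: distrib_left distrib_right power_Suc mult_ac)
  qed
  show ?case
    unfolding cos eq distrib_left by (rule has_bochner_integral_add[OF Suc Suc])
qed

lemma represents_arcsine:
  assumes "i \<le> g"
  shows "represents (distr arc_measure borel (\<lambda>x. 2 * cos x)) (moment_functional J (bv j i))"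
proof (rule representsI)
  fix n
  have "has_bochner_integral arc_measure (\<lambda>x. (2 * cos x) ^ n) (inner (bv j i) ((J ^^ n) (bv j i)))"
    by (rule has_bochner_integral_arc_measure) (use J_moments[OF assms, of n 0 j] in auto)
  then show "has_bochner_integral (distr arc_measure borel (\<lambda>x. 2 * cos x)) (\<lambda>x. x ^ n)
      (moment_functional J (bv j i) (monom 1 n))"
    unfolding moment_functional_def poly_op_monom[OF J.lin]
    by (intro has_bochner_integral_distr) auto
qed (auto simp: moment_functional_def J.poly_op_simps inner_add_right)

text \<open>The discriminant on the real line. At the points of \<open>C\<close> division by zero
  yields 0; this value is immaterial, as spectral measures do not charge \<open>C\<close>.\<close>

definition \<delta> :: "real \<Rightarrow> real" where
  "\<delta> t = poly N t / poly E t"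

lemma \<delta>_measurable [measurable]: "\<delta> \<in> borel_measurable borel"
  unfolding \<delta>_def[abs_def] by measurable

lemma magic_formula_power: "poly_op A (N ^ n) f = poly_op A (E ^ n) ((J ^^ n) f)"
proof (induction n arbitrary: f)
  case (Suc n)
  have "poly_op A (N ^ Suc n) f = poly_op A (N ^ n) (poly_op A E (J f))"
    by (simp only: power_Suc2 poly_op_mult[OF lin] magic_formula)
  also have "\<dots> = poly_op A E (poly_op A (N ^ n) (J f))"
    by (rule poly_op_swap[OF lin])
  finally show ?case
    by (simp add: Suc poly_op_mult[OF lin] funpow_swap1)
qed (simp add: poly_op_simps)

lemma J_power_poly_op: "(J ^^ n) (poly_op A P f) = poly_op A P ((J ^^ n) f)"
  by (induction n) (simp_all add: J_poly_op)

lemma boundedly_invertible_power: "boundedly_invertible (E ^ n)"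
  using boundedly_invertible_prod[of "{..<n}" "\<lambda>_. E"] boundedly_invertible_denom by simp

text \<open>Writing \<open>f = E(A)\<^sup>n h\<close>, the spectral measure of \<open>f\<close> is \<open>E\<^sup>2\<^sup>n\<close> times that of \<open>h\<close>, which cancels
  the poles of \<open>\<Delta>\<^sup>n\<close>.\<close>
lemma obtain_denominator:
  assumes "represents \<mu> (moment_functional A f)"
  obtains h \<nu> where "f = poly_op A (E ^ n) h" "represents \<nu> (moment_functional A h)"
    "\<mu> = density \<nu> (poly (E ^ n * E ^ n))"
proof -
  obtain h where h: "f = poly_op A (E ^ n) h"
    using boundedly_invertible_power[of n] unfolding boundedly_invertible_def by (metis bij_pointE)
  obtain \<nu> where \<nu>: "represents \<nu> (moment_functional A h)" using ex_representing_measure by blast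
  have "\<mu> = density \<nu> (poly (E ^ n * E ^ n))"
    by (rule representing_measure_density[OF \<nu> assms]) (simp_all add: h moment_functional_poly_op)
  with h \<nu> show ?thesis by (rule that)
qed

text \<open>For each n, a vector h with f = E(A)^n h turns the n-th moment of Delta into the
  polynomial integral <h, (E^n N^n)(A) h>, which the magic formula identifies with <f, J^n
  f>.\<close>

lemma represents_distr_\<delta>:
  assumes \<mu>: "represents \<mu> (moment_functional A f)"
  shows "represents (distr \<mu> borel \<delta>) (moment_functional J f)"
proof (rule representsI)
  fix n
  note [measurable_cong] = represents_sets[OF \<mu>]
  obtain h \<nu> where h: "f = poly_op A (E ^ n) h" and \<nu>: "represents \<nu> (moment_functional A h)"
    and dens: "\<mu> = density \<nu> (poly (E ^ n * E ^ n))"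
    by (rule obtain_denominator[OF \<mu>])
  note [measurable_cong] = represents_sets[OF \<nu>]
  have "poly_op A (E ^ n) (poly_op A (N ^ n) h) = poly_op A (E ^ n) ((J ^^ n) f)"
    unfolding magic_formula_power h J_power_poly_op ..
  then have mom: "moment_functional A h (E ^ n * N ^ n) = inner f ((J ^^ n) f)"
    by (simp add: moment_functional_def poly_op_mult[OF lin] h flip: poly_op_symmetric)
  have "has_bochner_integral \<mu> (\<lambda>t. \<delta> t ^ n) (inner f ((J ^^ n) f))"
    unfolding dens
  proof (rule has_bochner_integral_density)
    \<comment> \<open>At a point of \<open>C\<close> the two integrands agree as well: for n > 0
      both contain a zero factor E^n, and for n = 0 both are 1.\<close>
    show "has_bochner_integral \<nu> (\<lambda>t. poly (E ^ n * E ^ n) t *\<^sub>R \<delta> t ^ n) (inner f ((J ^^ n) f))"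
      unfolding mom[symmetric]
      by (rule represents_has_integral[OF \<nu>])
         (auto simp: \<delta>_def power_divide)
  qed auto
  then show "has_bochner_integral (distr \<mu> borel \<delta>) (\<lambda>x. x ^ n) (moment_functional J f (monom 1 n))"
    unfolding moment_functional_def poly_op_monom[OF J.lin]
    by (intro has_bochner_integral_distr) auto
qed (auto simp: moment_functional_def J.poly_op_simps inner_add_right)

lemma \<delta>_differentiable: "\<delta> differentiable_on (S - set C)"
  unfolding differentiable_on_def
proof
  fix t assume "t \<in> S - set C"
  then have "DERIV \<delta> t :> (poly (pderiv N) t * poly E t - poly N t * poly (pderiv E) t) / (poly E t * poly E t)"
    unfolding \<delta>_def[abs_def]
    by (intro DERIV_divide poly_DERIV) (auto simp: poly_denom_poly_eq_0_iff)
  then show "\<delta> differentiable (at t within S - set C)"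
    using real_differentiable_def differentiable_at_withinI by blast
qed

definition ac_vector :: "ell2 \<Rightarrow> bool" where
  "ac_vector f \<longleftrightarrow> (\<forall>\<mu>. represents \<mu> (moment_functional A f) \<longrightarrow> absolutely_continuous lborel \<mu>)"

text \<open>Off \<open>C\<close>, Delta carries a null set X into a null set N', and the measure of
  the preimage of N' is the arcsine mass of N', which is 0. The points of \<open>C\<close> have no
  mass, because the measure has a density with the factor E^2.\<close>

lemma ac_vector_bv:
  assumes "i \<le> g"
  shows "ac_vector (bv j i)"
  unfolding ac_vector_def absolutely_continuous_def
proof (intro allI impI subsetI)
  fix \<mu> and X :: "real set"
  assume \<mu>: "represents \<mu> (moment_functional A (bv j i))" and X: "X \<in> null_sets lborel"
  note [measurable_cong] = represents_sets[OF \<mu>]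
  have [measurable]: "X \<in> sets borel" "set C \<in> sets borel" using X by (auto simp: finite_imp_closed)
  have distr: "distr \<mu> borel \<delta> = distr arc_measure borel (\<lambda>x. 2 * cos x)"
    by (rule J.representing_measure_unique[OF represents_distr_\<delta>[OF \<mu>] represents_arcsine[OF assms]])
  obtain N' where N': "N' \<in> null_sets lborel" "\<delta> ` (X - set C) \<subseteq> N'"
    by (rule null_set_differentiable_image[OF X Diff_subset \<delta>_differentiable])
  have [measurable]: "N' \<in> sets borel" using N' by auto
  have "emeasure \<mu> (X - set C) \<le> emeasure \<mu> (\<delta> -` N' \<inter> space \<mu>)"
  proof (rule emeasure_mono)
    show "X - set C \<subseteq> \<delta> -` N' \<inter> space \<mu>"
      using N'(2) by (auto simp: sets_eq_imp_space_eq[OF represents_sets[OF \<mu>]])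
  qed measurable
  also have "\<dots> = emeasure (distr \<mu> borel \<delta>) N'"
    by (subst emeasure_distr) auto
  also have "\<dots> = 0"
    unfolding distr by (rule arc_measure_two_cos_null[OF N'(1)])
  finally have 1: "emeasure \<mu> (X - set C) = 0" by simp
  obtain h \<nu> where \<nu>: "represents \<nu> (moment_functional A h)" and dens: "\<mu> = density \<nu> (poly (E ^ 1 * E ^ 1))"
    by (rule obtain_denominator[OF \<mu>])
  note [measurable_cong] = represents_sets[OF \<nu>]
  have "emeasure \<mu> (set C) = (\<integral>\<^sup>+t. ennreal (poly (E ^ 1 * E ^ 1) t) * indicator (set C) t \<partial>\<nu>)"
    unfolding dens by (rule emeasure_density) auto
  also have "\<dots> = (\<integral>\<^sup>+t. 0 \<partial>\<nu>)"
    by (rule nn_integral_cong) (auto simp: indicator_def poly_denom_poly_eq_0_iff[of C, THEN iffD2])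
  finally have 2: "emeasure \<mu> (set C) = 0" by simp
  have "emeasure \<mu> X \<le> emeasure \<mu> ((X - set C) \<union> set C)"
    by (rule emeasure_mono) auto
  also have "\<dots> \<le> emeasure \<mu> (X - set C) + emeasure \<mu> (set C)"
    by (rule emeasure_subadditive) auto
  finally have "emeasure \<mu> X = 0" using 1 2 by simp
  then show "X \<in> null_sets \<mu>" by (auto simp: null_sets_def)
qed

lemma ac_vector_scaleC:
  assumes "ac_vector f"
  shows "ac_vector (c *\<^sub>C f)"
  unfolding ac_vector_def
proof (intro allI impI)
  fix \<mu> assume \<mu>: "represents \<mu> (moment_functional A (c *\<^sub>C f))"
  obtain \<nu> where \<nu>: "represents \<nu> (moment_functional A f)" using ex_representing_measure by blast
  have "\<mu> = density \<nu> (poly [:(cmod c)\<^sup>2:])"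
  proof (rule representing_measure_density[OF \<nu> \<mu>])
    fix p
    have "inner (c *\<^sub>C f) (c *\<^sub>C h) = (cmod c)\<^sup>2 * inner f h" for h
    proof -
      have "cinner (c *\<^sub>C f) (c *\<^sub>C h) = complex_of_real ((cmod c)\<^sup>2) * cinner f h"
        by (simp only: cinner_scaleC_left cinner_scaleC_right complex_norm_square mult_ac)
      then show ?thesis by (simp add: inner_ell2_def)
    qed
    then show "moment_functional A (c *\<^sub>C f) p = moment_functional A f ([:(cmod c)\<^sup>2:] * p)"
      by (simp add: moment_functional_def poly_op_scaleC poly_op_simps)
  qed simp
  moreover have "absolutely_continuous \<nu> (density \<nu> (poly [:(cmod c)\<^sup>2:]))"
    by (rule absolutely_continuousI_density) (simp cong: measurable_cong_sets add: represents_sets[OF \<nu>])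
  moreover have "absolutely_continuous lborel \<nu>"
    using assms \<nu> unfolding ac_vector_def by blast
  ultimately show "absolutely_continuous lborel \<mu>"
    unfolding absolutely_continuous_def by blast
qed

lemma ac_vector_add:
  assumes "ac_vector f" "ac_vector h"
  shows "ac_vector (f + h)"
  unfolding ac_vector_def absolutely_continuous_def
proof (intro allI impI subsetI)
  fix \<sigma> and X :: "real set"
  assume \<sigma>: "represents \<sigma> (moment_functional A (f + h))" and X: "X \<in> null_sets lborel"
  obtain \<mu> \<nu> where \<mu>: "represents \<mu> (moment_functional A f)" and \<nu>: "represents \<nu> (moment_functional A h)"
    using ex_representing_measure by blast
  have X': "X \<in> sets borel" using X by auto
  have "emeasure \<mu> X = 0" "emeasure \<nu> X = 0"
    using assms \<mu> \<nu> X unfolding ac_vector_def absolutely_continuous_def by auto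
  then have "emeasure \<sigma> X = 0"
    using representing_measure_add_le[OF \<mu> \<nu> \<sigma> X'] by simp
  then show "X \<in> null_sets \<sigma>" using X' by (simp add: null_sets_def represents_sets[OF \<sigma>])
qed

lemma ac_vector_0: "ac_vector 0"
  using ac_vector_scaleC[OF ac_vector_bv[of 0 0], of 0] by simp

text \<open>For a finite combination h of basis vectors, \<open>representing_measure_add_le\<close>
  bounds the mass that f gives to X by twice the mass that f - h gives to it, hence by twice the
  squared norm of f - h. This explains the accuracy sqrt(eps/2).\<close>

lemma ac_vector_all: "ac_vector f"
  unfolding ac_vector_def absolutely_continuous_def
proof (intro allI impI subsetI)
  fix \<sigma> and X :: "real set"
  assume \<sigma>: "represents \<sigma> (moment_functional A f)" and X: "X \<in> null_sets lborel"
  have X': "X \<in> sets borel" using X by auto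
  interpret finite_measure \<sigma> by (rule represents_finite_measure[OF \<sigma>])
  have "measure \<sigma> X \<le> \<epsilon>" if "\<epsilon> > 0" for \<epsilon>
  proof -
    obtain F where F: "finite F" "norm (f - (\<Sum>n\<in>F. coord f n *\<^sub>C basis_ell2 n)) < sqrt (\<epsilon> / 2)"
      using ell2_finite_approx[of "sqrt (\<epsilon> / 2)" f] \<open>\<epsilon> > 0\<close> by auto
    define h where "h = (\<Sum>n\<in>F. coord f n *\<^sub>C basis_ell2 n)"
    have ac: "ac_vector (c *\<^sub>C basis_ell2 n)" for c n
    proof -
      obtain j i where "n = s * j + int i" "i \<le> g" by (rule index_cases)
      then show ?thesis using ac_vector_scaleC[OF ac_vector_bv[of i j]] by (simp add: bv_def)
    qed
    have h: "ac_vector h"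
      unfolding h_def using F(1) by (induction F) (auto intro: ac_vector_add ac ac_vector_0)
    obtain \<mu> \<nu> where \<mu>: "represents \<mu> (moment_functional A h)" and \<nu>: "represents \<nu> (moment_functional A (f - h))"
      using ex_representing_measure by blast
    interpret \<nu>: finite_measure \<nu> by (rule represents_finite_measure[OF \<nu>])
    have "emeasure \<mu> X = 0"
      using h \<mu> X unfolding ac_vector_def absolutely_continuous_def by auto
    then have "emeasure \<sigma> X \<le> 2 * emeasure \<nu> X"
      using representing_measure_add_le[OF \<mu> \<nu> _ X', of \<sigma>] \<sigma> by simp
    also have "\<dots> \<le> 2 * emeasure \<nu> (space \<nu>)"
      by (intro mult_left_mono emeasure_space) auto
    also have "\<dots> = ennreal (2 * (norm (f - h))\<^sup>2)"
      unfolding \<nu>.emeasure_eq_measure represents_measure_space[OF \<nu>]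
      by (simp add: moment_functional_def poly_op_simps dot_square_norm ennreal_mult)
    also have "\<dots> \<le> ennreal \<epsilon>"
    proof (rule ennreal_leI)
      have "(norm (f - h))\<^sup>2 \<le> (sqrt (\<epsilon> / 2))\<^sup>2"
        using F(2) by (intro power_mono) (auto simp: h_def)
      then show "2 * (norm (f - h))\<^sup>2 \<le> \<epsilon>" using that by simp
    qed
    finally show ?thesis using that by (simp add: emeasure_eq_measure)
  qed
  then have "measure \<sigma> X \<le> 0" by (rule field_le_epsilon[of _ 0, simplified])
  then have "measure \<sigma> X = 0" by (simp add: measure_le_0_iff)
  then show "X \<in> null_sets \<sigma>" using X' by (simp add: null_sets_def represents_sets[OF \<sigma>] emeasure_eq_measure)
qed

theorem ac_subspace_eq_UNIV: "ac_subspace A = UNIV"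
proof -
  have "f \<in> ac_subspace A" for f
  proof -
    obtain \<mu> where "represents \<mu> (moment_functional A f)" using ex_representing_measure by blast
    then show ?thesis
      using ac_vector_all[of f] representing_measure_spectral
      unfolding ac_subspace_def ac_vector_def by blast
  qed
  then show ?thesis by blast
qed

end

section \<open>The spectrum\<close>

lemma det_transfer_factor:
  assumes "z \<noteq> of_real c"
  shows "det (transfer_factor z c p q) = 1"
proof -
  show ?thesis
    unfolding transfer_factor_entries[OF assms] by (simp add: det_2 divide_inverse algebra_simps)
qed

lemma det_transfer_matrix:
  assumes "z \<notin> complex_of_real ` set C" "p (length C) \<noteq> 0"
  shows "det (transfer_matrix C p q z) = 1"
proof -
  have "det (foldr (\<lambda>k M. transfer_factor z (C ! k) (p k) (q k) ** M) ks (transfer_last z (p (length C)) (q (length C)))) = 1"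
    if "set ks \<subseteq> {..<length C}" for ks
    using that
  proof (induction ks)
    case Nil
    then show ?case using assms(2) by (simp add: transfer_last_def det_2)
  next
    case (Cons k ks)
    then have "z \<noteq> of_real (C ! k)" using assms(1) by auto
    with Cons show ?case by (simp add: det_mul det_transfer_factor)
  qed
  from this[of "[0..<length C]"] show ?thesis
    unfolding transfer_matrix_def by (simp add: atLeast0LessThan)
qed

lemma singular_matrix_kernel:
  fixes M :: "'a::field^'n^'n"
  assumes "det M = 0"
  obtains u where "u \<noteq> 0" "M *v u = 0"
  using assms that matrix_left_invertible_ker[of M] invertible_left_inverse[of M] invertible_det_nz[of M] by blast

context periodic_GMP
begin

lemma abs_inner_J_le: "\<bar>inner (J h) h\<bar> \<le> 2 * (norm h)\<^sup>2"
proof -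
  have "norm (J h) \<le> norm h + norm h"
    unfolding J_def W_def by (rule order.trans[OF norm_triangle_ineq]) simp
  then have "norm (J h) * norm h \<le> (2 * norm h) * norm h"
    by (intro mult_right_mono) auto
  with Cauchy_Schwarz_ineq2[of "J h" h] show ?thesis by (simp add: power2_eq_square)
qed

text \<open>The quadratic form of J is at most twice the squared norm in modulus, so J -
  \<open>\<zeta>\<close>, multiplied by minus the sign of \<open>\<zeta>\<close>, is coercive with
  constant |\<open>\<zeta>\<close>| - 2.\<close>

lemma J_resolvent:
  assumes "\<bar>\<zeta>\<bar> > 2"
  shows "surj (\<lambda>h. J h - \<zeta> *\<^sub>R h)" "(\<bar>\<zeta>\<bar> - 2) * norm h \<le> norm (J h - \<zeta> *\<^sub>R h)"
proof -
  define L where "L h = - sgn \<zeta> *\<^sub>R (J h - \<zeta> *\<^sub>R h)" for h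
  have L: "bounded_linear L"
    unfolding L_def by (intro bounded_linear_scaleR_right bounded_linear_const_scaleR bounded_linear_sub
        bounded_linear_J bounded_linear_scaleR_right bounded_linear_ident)
  have coercive: "(\<bar>\<zeta>\<bar> - 2) * (norm h)\<^sup>2 \<le> inner (L h) h" for h
    using abs_inner_J_le[of h] assms
    by (auto simp: L_def sgn_real_def inner_diff_left dot_square_norm algebra_simps)
  have sgn: "sgn \<zeta> * sgn \<zeta> = 1" using assms by (auto simp: sgn_real_def)
  have "surj L" by (rule coercive_surj[OF L _ coercive]) (use assms in simp)
  show "surj (\<lambda>h. J h - \<zeta> *\<^sub>R h)"
    unfolding surj_def
  proof
    fix f
    obtain h where "(- sgn \<zeta>) *\<^sub>R f = L h" using \<open>surj L\<close> unfolding surj_def by blast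
    then have "(- sgn \<zeta>) *\<^sub>R ((- sgn \<zeta>) *\<^sub>R f) = (- sgn \<zeta>) *\<^sub>R L h" by simp
    then have "f = J h - \<zeta> *\<^sub>R h" using sgn by (simp add: L_def)
    then show "\<exists>h. f = J h - \<zeta> *\<^sub>R h" by blast
  qed
  have "norm (L h) = norm (J h - \<zeta> *\<^sub>R h)" using assms by (auto simp: L_def sgn_real_def)
  with coercive_bounded_below[of _ h L, OF coercive] show "(\<bar>\<zeta>\<bar> - 2) * norm h \<le> norm (J h - \<zeta> *\<^sub>R h)" by simp
qed

text \<open>If \<open>\<zeta> = \<Delta>(z)\<close>, then \<open>A - z\<close> divides \<open>E(A) (J - \<zeta>) = (N - \<zeta> E)(A)\<close>.\<close>
lemma invertible_of_discriminant:
  assumes z: "z \<notin> set C" and "\<bar>\<delta> z\<bar> > 2"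
  shows "invertible_on UNIV (\<lambda>f. complex_of_real z *\<^sub>C f - A f)"
proof -
  define P where "P = N - smult (\<delta> z) E"
  have "poly P z = 0"
    using z by (simp add: P_def \<delta>_def poly_denom_poly_eq_0_iff)
  \<comment> \<open>A - z and G(A) commute. Applied last, A - z inherits surjectivity from the
    product; applied first, it inherits the lower bound.\<close>
  then obtain G where G: "P = [:- z, 1:] * G"
    unfolding poly_eq_0_iff_dvd by (auto elim: dvdE)
  have P: "poly_op A P f = poly_op A E (J f - \<delta> z *\<^sub>R f)" for f
    by (simp add: P_def poly_op_simps magic_formula poly_op_linear)
  have Az: "complex_of_real z *\<^sub>C f - A f = - poly_op A [:- z, 1:] f" for f
    by (simp add: poly_op_simps linear_0[OF lin] scaleC_of_real)
  obtain K where bijE: "bij (poly_op A E)" and K: "K > 0" "\<And>f. K * norm f \<le> norm (poly_op A E f)"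
    using boundedly_invertible_denom unfolding boundedly_invertible_def by blast
  obtain K' where K': "K' > 0" "\<And>f. norm (poly_op A G f) \<le> norm f * K'"
    using bounded_linear.pos_bounded[OF bounded_linear_poly_op[OF bounded, of G]] by blast
  show ?thesis
  proof (rule invertible_on_UNIV_I)
    show "linear (\<lambda>f. complex_of_real z *\<^sub>C f - A f)"
      by (intro linear_compose_sub lin bounded_linear.linear[OF bounded_linear_scaleC])
    show "surj (\<lambda>f. complex_of_real z *\<^sub>C f - A f)"
      unfolding surj_def
    proof
      fix f
      obtain h1 where h1: "- f = poly_op A E h1" using bij_is_surj[OF bijE] unfolding surj_def by blast
      obtain h where "h1 = J h - \<delta> z *\<^sub>R h" using J_resolvent(1)[OF assms(2)] unfolding surj_def by blast
      then have "- f = poly_op A [:- z, 1:] (poly_op A G h)"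
        unfolding h1 by (simp only: P[symmetric] G poly_op_mult[OF lin])
      then have "f = complex_of_real z *\<^sub>C poly_op A G h - A (poly_op A G h)"
        unfolding Az by (metis minus_minus)
      then show "\<exists>h. f = complex_of_real z *\<^sub>C h - A h" by blast
    qed
    show "K * (\<bar>\<delta> z\<bar> - 2) / K' > 0" using K(1) K'(1) assms(2) by simp
    show "K * (\<bar>\<delta> z\<bar> - 2) / K' * norm h \<le> norm (complex_of_real z *\<^sub>C h - A h)" for h
    proof -
      have "K * ((\<bar>\<delta> z\<bar> - 2) * norm h) \<le> K * norm (J h - \<delta> z *\<^sub>R h)"
        using K(1) J_resolvent(2)[OF assms(2)] by (intro mult_left_mono) auto
      also have "\<dots> \<le> norm (poly_op A P h)" unfolding P by (rule K(2))
      also have "\<dots> = norm (poly_op A G (poly_op A [:- z, 1:] h))"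
        unfolding G poly_op_mult[OF lin] by (simp only: poly_op_swap[OF lin, of G])
      also have "\<dots> \<le> norm (complex_of_real z *\<^sub>C h - A h) * K'"
        unfolding Az norm_minus_cancel by (rule K'(2))
      finally show ?thesis using K'(1) by (simp add: field_simps)
    qed
  qed
qed

text \<open>Nonreal points are excluded by self-adjointness, so that Delta has to be examined at
  real points only.\<close>

lemma spectrum_subset:
  assumes "z \<in> spectrum A"
  shows "z \<notin> complex_of_real ` set C" "discriminant C p q z \<in> complex_of_real ` {-2..2}"
proof -
  have ninv: "\<not> invertible_on UNIV (\<lambda>f. z *\<^sub>C f - A f)"
    using assms by (simp add: spectrum_def spectrum_on_def)
  then show C: "z \<notin> complex_of_real ` set C" using invertible by auto
  have "Im z = 0" using ninv nonreal_invertible by blast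
  then obtain t where t: "z = complex_of_real t" by (metis complex_is_Real_iff Reals_cases)
  then have tC: "t \<notin> set C" using C by auto
  have "\<bar>\<delta> t\<bar> \<le> 2" using ninv invertible_of_discriminant[OF tC] t by force
  then have "\<delta> t \<in> {-2..2}" by (simp add: abs_le_iff)
  moreover have "discriminant C p q z = complex_of_real (\<delta> t)"
    unfolding t \<delta>_def using tC p_pos by (simp add: discriminant_of_real)
  ultimately show "discriminant C p q z \<in> complex_of_real ` {-2..2}" by (rule rev_image_eqI)
qed

lemma blockB_mult:
  fixes u :: "nat \<Rightarrow> complex"
  assumes "i \<le> g"
  shows "(\<Sum>l\<le>g. complex_of_real (blockB C p q i l) * u l) = of_real ((C @ [0]) ! i) * u i
    + of_real (q i) * (\<Sum>l\<in>{Suc i..g}. of_real (p l) * u l) + of_real (p i) * (\<Sum>l\<le>i. of_real (q l) * u l)"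
proof -
  have split: "{..g} = {..i} \<union> {Suc i..g}" "{..i} \<inter> {Suc i..g} = {}" using assms by auto
  have "(\<Sum>l\<le>g. complex_of_real (blockB C p q i l) * u l)
      = (\<Sum>l\<le>g. (if i < l then of_real (q i * p l) * u l else of_real (p i * q l) * u l)
          + (if l = i then of_real ((C @ [0]) ! l) * u l else 0))"
    by (rule sum.cong) (auto simp: blockB_def upper_def lower_def outer_def distrib_right)
  also have "\<dots> = (\<Sum>l\<le>g. if i < l then of_real (q i * p l) * u l else of_real (p i * q l) * u l)
      + of_real ((C @ [0]) ! i) * u i"
    using assms by (simp add: sum.distrib)
  also have "(\<Sum>l\<le>g. if i < l then of_real (q i * p l) * u l else of_real (p i * q l) * u l)
      = (\<Sum>l\<le>i. of_real (p i * q l) * u l) + (\<Sum>l\<in>{Suc i..g}. of_real (q i * p l) * u l)"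
    unfolding split(1) by (subst sum.union_disjoint) (auto intro!: arg_cong2[where f = "(+)"] sum.cong)
  finally show ?thesis by (simp add: sum_distrib_left mult_ac)
qed

text \<open>A Bloch solution of \<open>A u = z u\<close> with multiplier \<open>w\<close>, restricted to the block 0. It comes from a
  vector \<open>v\<close> with \<open>v = w \<AA>(z) v\<close>, through the same recursion that proves the magic formula.\<close>
lemma ex_bloch_solution:
  assumes z: "z \<notin> complex_of_real ` set C" and w: "w \<noteq> 0" "discriminant C p q z = w + 1 / w"
  obtains l and u :: "nat \<Rightarrow> complex" and x0 y0 where "l \<le> g" "u l \<noteq> 0" "x0 = (\<Sum>i\<le>g. of_real (p i) * u i)" "u g = w * y0"
    "\<forall>i\<le>g. (\<Sum>l\<le>g. complex_of_real (blockB C p q i l) * u l)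
       = z * u i - of_real (p i) * y0 - (if i = g then w * x0 else 0)"
proof -
  define T where "T k = foldr (\<lambda>k M. transfer_factor z (C ! k) (p k) (q k) ** M) [k..<g] (transfer_last z (p g) (q g))" for k
  have T0: "T 0 = transfer_matrix C p q z" by (simp add: T_def transfer_matrix_def)
  \<comment> \<open>The characteristic polynomial of the transfer matrix at 1/w: it vanishes because
    the determinant is 1 and Delta = w + 1/w.\<close>
  have "det (T 0 - mat (1 / w)) = det (T 0) - (1 / w) * trace (T 0) + (1 / w) * (1 / w)"
    by (simp add: det_2 trace_def sum_2 mat_def algebra_simps)
  also have "\<dots> = 0"
    unfolding T0 using det_transfer_matrix[OF z, of p q] p_pos w
    by (simp add: discriminant_def[symmetric] field_simps)
  finally obtain v where v: "v \<noteq> 0" "(T 0 - mat (1 / w)) *v v = 0"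
    by (rule singular_matrix_kernel)
  have Tv: "T 0 *v (w *s v) = v"
  proof -
    have "T 0 *v v = (1 / w) *s v"
      using v(2) by (simp add: matrix_vector_mult_diff_rdistrib vec_eq_iff matrix_vector_mult_def mat_def sum_2 forall_2)
        (auto simp: algebra_simps)
    then show ?thesis using w(1) by (simp add: vector_scalar_commute vec_eq_iff)
  qed
  \<comment> \<open>Here w v plays the part of the pair of the next block; passing through all
    factors leads back to V 0 = v.\<close>
  define V where "V k = T k *v (w *s v)" for k
  define x where "x k = - (V k $ 1)" for k
  define y where "y k = V k $ 2" for k
  have V0: "V 0 = v" using Tv by (simp add: V_def)
  \<comment> \<open>These values are forced by the scalar form of \<open>A_e\<close>, with z in
    place of A, and by that of e_g = W Y_0.\<close>
  define u where "u l = (if l = g then w * y 0 else (of_real (p l) * y (Suc l) + of_real (q l) * x (Suc l)) / (z - of_real (C ! l)))" for l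
  have rec: "x k = x (Suc k) + of_real (p k) * u k" "y (Suc k) = y k + of_real (q k) * u k" if "k < g" for k
  proof -
    have ne: "z \<noteq> of_real (C ! k)" using z that by auto
    have "V k = transfer_factor z (C ! k) (p k) (q k) *v V (Suc k)"
      using that by (simp add: V_def T_def upt_conv_Cons matrix_vector_mul_assoc)
    then have "V k $ 1 = (1 + of_real (p k * q k) / (z - of_real (C ! k))) * V (Suc k) $ 1
          + - of_real (p k * p k) / (z - of_real (C ! k)) * V (Suc k) $ 2"
      "V k $ 2 = of_real (q k * q k) / (z - of_real (C ! k)) * V (Suc k) $ 1
          + (1 - of_real (p k * q k) / (z - of_real (C ! k))) * V (Suc k) $ 2"
      by (simp_all add: transfer_factor_entries[OF ne] matrix_vector_mult_def sum_2)
    then show "x k = x (Suc k) + of_real (p k) * u k" "y (Suc k) = y k + of_real (q k) * u k"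
      using that by (simp_all add: x_def y_def u_def add_divide_distrib diff_divide_distrib algebra_simps)
  qed
  have "V g = transfer_last z (p g) (q g) *v (w *s v)" by (simp add: V_def T_def)
  then have last: "x g = of_real (p g) * u g"
    "of_real (p g) * y g = - w * x 0 + (z - of_real (p g * q g)) * u g"
    using p_pos by (simp_all add: transfer_last_def x_def y_def u_def V0 matrix_vector_mult_def sum_2 field_simps)
  have x: "x k = (\<Sum>i\<in>{k..g}. of_real (p i) * u i)" if "k \<le> g" for k
    using that
  proof (induction rule: inc_induct)
    case (step k)
    then show ?case by (simp add: rec(1) sum.atLeast_Suc_atMost[of k g])
  qed (simp add: last)
  have y: "y k = y 0 + (\<Sum>i<k. of_real (q i) * u i)" if "k \<le> g" for k
    using that by (induction k) (simp_all add: rec(2))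
  have "\<exists>l\<le>g. u l \<noteq> 0"
  proof (rule ccontr)
    assume "\<not> (\<exists>l\<le>g. u l \<noteq> 0)"
    then have "x 0 = 0" "u g = 0" unfolding x[OF le0] by auto
    then have "v = 0" using w(1) by (simp add: u_def x_def y_def V0 vec_eq_iff forall_2)
    with v(1) show False by simp
  qed
  then obtain l where l: "l \<le> g" "u l \<noteq> 0" by blast
  show ?thesis
  proof (rule that[of l u "x 0" "y 0"])
    show "l \<le> g" "u l \<noteq> 0" by (fact l)+
    show "x 0 = (\<Sum>i\<le>g. of_real (p i) * u i)" by (simp add: x atLeast0AtMost)
    show "u g = w * y 0" by (simp add: u_def)
    show "\<forall>i\<le>g. (\<Sum>l\<le>g. complex_of_real (blockB C p q i l) * u l)
       = z * u i - of_real (p i) * y 0 - (if i = g then w * x 0 else 0)"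
    proof (intro allI impI)
      fix i assume i: "i \<le> g"
      have q: "(\<Sum>l\<le>i. of_real (q l) * u l) = y i - y 0 + of_real (q i) * u i"
        using y[OF i] by (simp add: lessThan_Suc_atMost[symmetric])
      show "(\<Sum>l\<le>g. complex_of_real (blockB C p q i l) * u l)
         = z * u i - of_real (p i) * y 0 - (if i = g then w * x 0 else 0)"
      proof (cases "i = g")
        case True
        then show ?thesis
          unfolding blockB_mult[OF i] q using last(2) by (simp add: algebra_simps)
      next
        case False
        then have ig: "i < g" using i by simp
        have "z - of_real (C ! i) \<noteq> 0" using z ig by auto
        then have "(z - of_real (C ! i)) * u i = of_real (p i) * y (Suc i) + of_real (q i) * x (Suc i)"
          using ig by (simp add: u_def)
        then show ?thesis
          unfolding blockB_mult[OF i] q using ig x[of "Suc i"] rec(2)[OF ig]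
          by (simp add: nth_append algebra_simps)
      qed
    qed
  qed
qed

text \<open>Over n successive blocks of the Bloch solution, A - z telescopes to two boundary terms
  of fixed norm, whereas the norm of the truncation itself grows at least like the root of n, since
  |w| = 1. This rules out a bounded inverse.\<close>

lemma spectrum_superset:
  assumes z: "z \<notin> complex_of_real ` set C" and "discriminant C p q z \<in> complex_of_real ` {-2..2}"
  shows "z \<in> spectrum A"
proof -
  obtain t where t: "discriminant C p q z = complex_of_real t" "\<bar>t\<bar> \<le> 2" using assms(2) by auto
  \<comment> \<open>w = exp(i theta) with 2 cos theta = t, so that w + 1/w = t.\<close>
  define w where "w = Complex (t / 2) (sqrt (1 - (t / 2)\<^sup>2))"
  have "(t / 2)\<^sup>2 \<le> 1" using t(2) by (simp add: abs_square_le_1)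
  then have w1: "cmod w = 1" by (simp add: w_def cmod_def)
  then have w0: "w \<noteq> 0" by auto
  have "1 / w = cnj w" using w1 by (simp add: divide_conv_cnj)
  then have disc: "discriminant C p q z = w + 1 / w" by (simp add: t(1) w_def complex_eq_iff)
  obtain l u x0 y0 where l: "l \<le> g" "u l \<noteq> 0" and x0: "x0 = (\<Sum>i\<le>g. of_real (p i) * u i)"
    and ug: "u g = w * y0"
    and B: "\<forall>i\<le>g. (\<Sum>l\<le>g. complex_of_real (blockB C p q i l) * u l)
       = z * u i - of_real (p i) * y0 - (if i = g then w * x0 else 0)"
    by (rule ex_bloch_solution[OF z w0 disc])
  define F where "F = (\<Sum>i\<le>g. u i *\<^sub>C e i)"
  \<comment> \<open>The boundary term of a cut between the blocks -1 and 0. Restricting the Bloch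
    solution to block 0 leaves -G at this cut and w W G at the next one.\<close>
  define G where "G = y0 *\<^sub>C X 0 - x0 *\<^sub>C bv (-1) g"
  have real: "complex_of_real r *\<^sub>C f = r *\<^sub>R f" for r f by (rule scaleC_of_real)
  have AF: "A F - z *\<^sub>C F = w *\<^sub>C W 1 G - G"
  proof -
    have X0: "X 0 = (\<Sum>i\<le>g. complex_of_real (p i) *\<^sub>C e i)" by (simp add: X_def atLeast0AtMost real)
    have WX: "W 1 (X 0) = (\<Sum>i\<le>g. p i *\<^sub>R bv 1 i)" by (simp add: X_def W_linear atLeast0AtMost)
    have "A F = (\<Sum>l\<le>g. u l *\<^sub>C ((\<Sum>i\<le>g. complex_of_real (blockB C p q i l) *\<^sub>C e i)
        + (if l = g then W 1 (X 0) else 0) + complex_of_real (p l) *\<^sub>C bv (-1) g))"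
      unfolding F_def linear_sum[OF lin] A_scaleC
      by (intro sum.cong refl arg_cong2[where f = scaleC_ell2]) (auto simp: A_bv WX real)
    also have "\<dots> = (\<Sum>l\<le>g. \<Sum>i\<le>g. (complex_of_real (blockB C p q i l) * u l) *\<^sub>C e i)
        + u g *\<^sub>C W 1 (X 0) + x0 *\<^sub>C bv (-1) g"
    proof -
      have "(\<Sum>l\<le>g. (if l = g then u l *\<^sub>C W 1 (X 0) else 0)) = u g *\<^sub>C W 1 (X 0)" by (simp add: sum.delta)
      moreover have "(\<Sum>l\<le>g. (u l * complex_of_real (p l)) *\<^sub>C f) = x0 *\<^sub>C f" for f
        unfolding x0 by (simp add: scaleC_sum_left mult.commute)
      ultimately show ?thesis
        by (simp add: scaleC_add_right scaleC_sum_right sum.distrib if_distrib[of "(*\<^sub>C) _"] mult.commute cong: if_cong)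
    qed
    also have "(\<Sum>l\<le>g. \<Sum>i\<le>g. (complex_of_real (blockB C p q i l) * u l) *\<^sub>C e i)
        = (\<Sum>i\<le>g. (z * u i - of_real (p i) * y0 - (if i = g then w * x0 else 0)) *\<^sub>C e i)"
    proof (subst sum.swap, rule sum.cong)
      fix i assume "i \<in> {..g}"
      then have "(z * u i - of_real (p i) * y0 - (if i = g then w * x0 else 0)) *\<^sub>C e i
          = (\<Sum>l\<le>g. complex_of_real (blockB C p q i l) * u l) *\<^sub>C e i" by (simp add: B)
      also have "\<dots> = (\<Sum>l\<le>g. (complex_of_real (blockB C p q i l) * u l) *\<^sub>C e i)"
        by (rule scaleC_sum_left)
      finally show "(\<Sum>l\<le>g. (complex_of_real (blockB C p q i l) * u l) *\<^sub>C e i)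
          = (z * u i - of_real (p i) * y0 - (if i = g then w * x0 else 0)) *\<^sub>C e i" ..
    qed simp
    also have "\<dots> = z *\<^sub>C F - y0 *\<^sub>C X 0 - (w * x0) *\<^sub>C e g"
    proof -
      have "(\<Sum>i\<le>g. (if i = g then (w * x0) *\<^sub>C e i else 0)) = (w * x0) *\<^sub>C e g" by (simp add: sum.delta)
      moreover have "(if i = g then w * x0 else 0) *\<^sub>C f = (if i = g then (w * x0) *\<^sub>C f else 0)" for i f
        by simp
      ultimately show ?thesis
        by (simp add: F_def X0 scaleC_diff_left scaleC_sum_right sum_subtractf mult.commute)
    qed
    finally show ?thesis
      by (simp add: G_def ug W_linear W_scaleC scaleC_diff_right algebra_simps)
  qed
  define S where "S n = (\<Sum>j<n. w ^ j *\<^sub>C W (int j) F)" for n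
  have telescope: "A (S n) - z *\<^sub>C S n = w ^ n *\<^sub>C W (int n) G - G" for n
  proof (induction n)
    case (Suc n)
    have "A (w ^ n *\<^sub>C W (int n) F) - z *\<^sub>C (w ^ n *\<^sub>C W (int n) F) = w ^ n *\<^sub>C W (int n) (A F - z *\<^sub>C F)"
      by (simp add: A_scaleC W_A W_linear W_scaleC scaleC_diff_right mult.commute)
    also have "\<dots> = w ^ Suc n *\<^sub>C W (int (Suc n)) G - w ^ n *\<^sub>C W (int n) G"
      by (simp add: AF W_linear W_scaleC scaleC_diff_right mult.commute add.commute)
    finally have step: "A (w ^ n *\<^sub>C W (int n) F) - z *\<^sub>C (w ^ n *\<^sub>C W (int n) F)
        = w ^ Suc n *\<^sub>C W (int (Suc n)) G - w ^ n *\<^sub>C W (int n) G" .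
    have "S (Suc n) = S n + w ^ n *\<^sub>C W (int n) F" by (simp add: S_def)
    then have "A (S (Suc n)) - z *\<^sub>C S (Suc n)
        = (A (S n) - z *\<^sub>C S n) + (A (w ^ n *\<^sub>C W (int n) F) - z *\<^sub>C (w ^ n *\<^sub>C W (int n) F))"
      by (simp only: linear_add[OF lin] scaleC_add_right add_diff_add)
    then show ?case unfolding Suc step by simp
  qed (simp add: S_def linear_0[OF lin])
  have bounded_defect: "norm (A (S n) - z *\<^sub>C S n) \<le> 2 * norm G" for n
    unfolding telescope by (rule order.trans[OF norm_triangle_ineq4]) (simp add: norm_power w1 W_def)
  have unbounded: "real n * (cmod (u l))\<^sup>2 \<le> (norm (S n))\<^sup>2" for n
  proof -
    have coord: "coord (S n) (s * int j + int l) = w ^ j * u l" if "j < n" for j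
    proof -
      have "coord (W (int j') F) (s * int j + int l) = (if j' = j then u l else 0)" for j'
      proof -
        have "coord (W (int j') F) (s * int j + int l) = (\<Sum>i\<le>g. u i * coord (bv (int j') i) (s * int j + int l))"
          by (simp add: F_def W_linear W_scaleC)
        also have "\<dots> = (\<Sum>i\<le>g. if i = l then (if j' = j then u i else 0) else 0)"
          by (rule sum.cong) (auto simp: coord_bv l(1))
        finally show ?thesis using l(1) by simp
      qed
      then have "coord (S n) (s * int j + int l) = (\<Sum>j'<n. w ^ j' * (if j' = j then u l else 0))"
        by (simp add: S_def)
      also have "\<dots> = (\<Sum>j'<n. if j' = j then w ^ j' * u l else 0)"
        by (rule sum.cong) auto
      finally show ?thesis using that by simp
    qed
    have inj: "inj_on (\<lambda>j. s * int j + int l) {..<n}"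
      using index_eq_iff[OF l(1) l(1)] by (auto simp: inj_on_def)
    have "real n * (cmod (u l))\<^sup>2 = (\<Sum>j<n. (cmod (coord (S n) (s * int j + int l)))\<^sup>2)"
      by (simp add: coord norm_mult norm_power w1)
    also have "\<dots> = (\<Sum>m\<in>(\<lambda>j. s * int j + int l) ` {..<n}. (cmod (coord (S n) m))\<^sup>2)"
      by (simp add: sum.reindex[OF inj])
    also have "\<dots> \<le> (norm (S n))\<^sup>2" by (rule norm_ell2_le_infsum) simp
    finally show ?thesis .
  qed
  show ?thesis
    unfolding spectrum_def spectrum_on_def mem_Collect_eq
  proof
    assume "invertible_on UNIV (\<lambda>f. z *\<^sub>C f - A f)"
    then obtain K where K: "\<And>f. norm f \<le> K * norm (z *\<^sub>C f - A f)" unfolding invertible_on_def by auto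
    have "norm (S n) \<le> \<bar>K\<bar> * (2 * norm G)" for n
    proof -
      have "norm (S n) \<le> K * norm (A (S n) - z *\<^sub>C S n)" using K[of "S n"] by (simp add: norm_minus_commute)
      also have "\<dots> \<le> \<bar>K\<bar> * (2 * norm G)" using bounded_defect by (intro mult_mono) auto
      finally show ?thesis .
    qed
    then have "real n * (cmod (u l))\<^sup>2 \<le> (\<bar>K\<bar> * (2 * norm G))\<^sup>2" for n
      by (intro order.trans[OF unbounded[of n]] power_mono) auto
    moreover obtain n where "real n * (cmod (u l))\<^sup>2 > (\<bar>K\<bar> * (2 * norm G))\<^sup>2"
      using reals_Archimedean3[of "(cmod (u l))\<^sup>2"] l(2) by auto
    ultimately show False by (meson not_less)
  qed
qed

end

theorem theorem1p8:
  fixes C :: "real list" and A :: "ell2 \<Rightarrow> ell2" and p q :: "nat \<Rightarrow> real"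
  assumes "length C \<ge> 1" and "distinct C"
    and "GMP C A"
    and "generating_coeffs C A (\<lambda>_. p) (\<lambda>_. q)"
  shows "purely_ac_spectrum A \<and>
    spectrum A = ac_spectrum A \<and>
    ac_spectrum A = {z. z \<notin> complex_of_real ` set C \<and>
                        discriminant C p q z \<in> complex_of_real ` {-2..2}}"
proof -
  interpret periodic_GMP C A p q
  proof
    show "bounded_operator A" using assms(3) by (simp add: GMP_def class_A_def)
    fix c assume "c \<in> set C"
    then obtain i where "i < length C" "c = C ! i" by (auto simp: in_set_conv_nth)
    \<comment> \<open>\<open>GMP\<close> numbers the points from 1, so \<open>C ! i\<close> belongs
      to k = i + 1.\<close>
    then show "invertible_on UNIV (\<lambda>f. complex_of_real c *\<^sub>C f - A f)"
      using assms(3) unfolding GMP_def Let_def by (auto dest!: bspec[of _ _ "Suc i"])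
  qed (fact assms)
  have "ac_spectrum A = spectrum A"
    by (simp add: ac_spectrum_def spectrum_def ac_subspace_eq_UNIV)
  moreover have "spectrum A = {z. z \<notin> complex_of_real ` set C \<and>
      discriminant C p q z \<in> complex_of_real ` {-2..2}}"
    using spectrum_subset spectrum_superset by blast
  ultimately show ?thesis
    by (simp add: purely_ac_spectrum_def ac_subspace_eq_UNIV)
qed

end
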